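(* Let $k\in\mathbb{N}$, let $\mathbb{D}_Q\subset\mathbb{M}^d$ be an NC operator ball, and let $P\in M_k(\mathbb{C}\langle Z\rangle)$ be a $Q$-stable atom. Then $$\sup_{0\le r<1}\big\|\big(P^{(r)}\big)^{-1}P\big\|_Q<\infty\qquad\text{and}\qquad \sup_{0\le r<1}\big\|P\big(P^{(r)}\big)^{-1}\big\|_Q<\infty .$$
   Context: Fix $d\in\mathbb{N}$. Write $M_n$ for the complex $n\times n$ matrices, $M_n^d$ for $d$-tuples of such matrices, and $\mathbb{M}^d=\bigsqcup_{n\ge1}M_n^d$. Let $\mathcal{H}$ be a Hilbert space, let $\mathcal{E}\subseteq B(\mathcal{H})$ be a $d$-dimensional linear subspace (operator space) with basis $Q_1,\dots,Q_d$, and put $Q(X)=\sum_{j=1}^d Q_j\otimes X_j\in B(\mathcal{H}\otimes\mathbb{C}^n)$ for $X=(X_1,\dots,X_d)\in M_n^d$. The associated NC operator ball is $\mathbb{D}_Q=\{X\in\mathbb{M}^d:\|Q(X)\|<1\}$ (operator norm). $\mathbb{C}\langle Z\rangle$ is the algebra of polynomials over $\mathbb{C}$ in $d$ freely non-commuting variables $Z_1,\dots,Z_d$. An element $P\in M_k(\mathbb{C}\langle Z\rangle)$ is written $P=\sum_w C_wZ^w$ (finite sum over words $w$ in $\{1,\dots,d\}$, with $C_w\in M_k$) and is evaluated at $X\in M_n^d$ by $P(X)=\sum_w C_w\otimes X^w\in M_k(M_n)$. For $0\le r<1$, $P^{(r)}(X):=P(rX)$. $P$ is $Q$-stable if $\det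 P(X)\ne0$ for all $X\in\mathbb{D}_Q$. For a matrix-valued function $F$ on $\mathbb{D}_Q$, $\|F\|_Q:=\sup_{X\in\mathbb{D}_Q}\|F(X)\|$ (operator norm); products and inverses of such functions are taken pointwise, e.g. $((P^{(r)})^{-1}P)(X)=P(rX)^{-1}P(X)$. $GL_k(\mathbb{C}\langle Z\rangle)$ is the set of $P\in M_k(\mathbb{C}\langle Z\rangle)$ having an inverse in $M_k(\mathbb{C}\langle Z\rangle)$. $P\in M_k(\mathbb{C}\langle Z\rangle)$ is an atom if it is not a product of two elements $F,G\in M_k(\mathbb{C}\langle Z\rangle)$ with $F,G\notin GL_k(\mathbb{C}\langle Z\rangle)$. *)

theory Defs
  imports
    "HOL-Analysis.Analysis"
    "HOL-Library.Poly_Mapping"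
    "Jordan_Normal_Form.Determinant"
    "Jordan_Normal_Form.Gauss_Jordan_Elimination"
begin

section \<open>Complex Hilbert spaces\<close>

text \<open>The inner product is linear in the first argument; no separability or dimension
  restriction is imposed.\<close>

class complex_hilbert_space = banach +
  fixes scaleC :: "complex \<Rightarrow> 'a \<Rightarrow> 'a" (infixr "*\<^sub>C" 75)
    and cinner :: "'a \<Rightarrow> 'a \<Rightarrow> complex"
  assumes scaleC_add_right: "c *\<^sub>C (x + y) = c *\<^sub>C x + c *\<^sub>C y"
    and scaleC_add_left: "(c + c') *\<^sub>C x = c *\<^sub>C x + c' *\<^sub>C x"
    and scaleC_scaleC: "c *\<^sub>C (c' *\<^sub>C x) = (c * c') *\<^sub>C x"
    and scaleC_one: "1 *\<^sub>C x = x"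
    and scaleR_scaleC: "r *\<^sub>R x = complex_of_real r *\<^sub>C x"
    and cinner_commute: "cinner x y = cnj (cinner y x)"
    and cinner_add_left: "cinner (x + y) z = cinner x z + cinner y z"
    and cinner_scaleC_left: "cinner (c *\<^sub>C x) y = c * cinner x y"
    and cinner_nonneg: "0 \<le> Re (cinner x x)"
    and cinner_eq_zero_iff: "cinner x x = 0 \<longleftrightarrow> x = 0"
    and norm_eq_sqrt_cinner: "norm x = sqrt (Re (cinner x x))"

instantiation complex :: complex_hilbert_space
begin

definition "scaleC_complex (c :: complex) (x :: complex) = c * x"
definition "cinner_complex (x :: complex) (y :: complex) = x * cnj y"

instance
  by standard
    (auto simp: scaleC_complex_def cinner_complex_def ring_distribs mult.assoc scaleR_conv_of_real
      cmod_def power2_eq_square mult_ac complex_eq_iff sum_squares_eq_zero_iff)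

end

definition bounded_clinear ::
    "('h :: complex_hilbert_space \<Rightarrow> 'h) \<Rightarrow> bool" where
  "bounded_clinear T \<longleftrightarrow> bounded_linear T \<and> (\<forall>c x. T (c *\<^sub>C x) = c *\<^sub>C T x)"

text \<open>\<open>E\<close> is a linear subspace of the bounded operators with basis \<open>Q\<close>; in
  particular its complex dimension is the cardinality of the index type \<open>'d\<close>.\<close>

definition operator_space_basis ::
    "('h :: complex_hilbert_space \<Rightarrow> 'h) set \<Rightarrow> ('d :: finite \<Rightarrow> 'h \<Rightarrow> 'h) \<Rightarrow> bool" where
  "operator_space_basis E Q \<longleftrightarrow>
     (\<forall>j. bounded_clinear (Q j)) \<and>
     (\<forall>c. (\<forall>h. (\<Sum>j\<in>UNIV. c j *\<^sub>C Q j h) = 0) \<longrightarrow> (\<forall>j. c j = 0)) \<and>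
     E = {\<lambda>h. \<Sum>j\<in>UNIV. c j *\<^sub>C Q j h | c. True}"


section \<open>The NC universe and NC operator balls\<close>

text \<open>The disjoint union over all sizes is a set of pairs (size, tuple).\<close>

definition nc_universe :: "(nat \<times> ('d \<Rightarrow> complex mat)) set" where
  "nc_universe = Sigma {1..} (\<lambda>n. {X. \<forall>j. X j \<in> carrier_mat n n})"

text \<open>The Hilbert space \<open>H \<otimes> \<complex>\<^sup>n\<close> is the \<open>n\<close>-fold Hilbert sum of \<open>H\<close>: its elements are
  families \<open>h :: nat \<Rightarrow> 'h\<close> of which only the entries below \<open>n\<close> matter, \<open>h\<close> standing for
  the sum of the \<open>h b \<otimes> e\<^sub>b\<close>.\<close>

definition tensor_op ::
    "('h :: complex_hilbert_space \<Rightarrow> 'h) \<Rightarrow> complex mat \<Rightarrow> (nat \<Rightarrow> 'h) \<Rightarrow> (nat \<Rightarrow> 'h)" where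
  "tensor_op T A h = (\<lambda>a. \<Sum>b<dim_col A. (A $$ (a, b)) *\<^sub>C T (h b))"

definition pencil ::
    "('d :: finite \<Rightarrow> 'h \<Rightarrow> 'h :: complex_hilbert_space) \<Rightarrow> ('d \<Rightarrow> complex mat)
      \<Rightarrow> (nat \<Rightarrow> 'h) \<Rightarrow> (nat \<Rightarrow> 'h)" where
  "pencil Q X h = (\<lambda>a. \<Sum>j\<in>UNIV. tensor_op (Q j) (X j) h a)"

text \<open>These suprema are over bounded sets when the \<open>Q j\<close> are bounded.\<close>

definition tensor_norm ::
    "nat \<Rightarrow> ((nat \<Rightarrow> 'h :: complex_hilbert_space) \<Rightarrow> (nat \<Rightarrow> 'h)) \<Rightarrow> real" where
  "tensor_norm n T =
     (SUP h\<in>{h. L2_set (\<lambda>b. norm (h b)) {..<n} \<le> 1}. L2_set (\<lambda>a. norm (T h a)) {..<n})"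

definition nc_ball ::
    "('d :: finite \<Rightarrow> 'h \<Rightarrow> 'h :: complex_hilbert_space) \<Rightarrow> (nat \<times> ('d \<Rightarrow> complex mat)) set" where
  "nc_ball Q = {(n, X) \<in> nc_universe. tensor_norm n (pencil Q X) < 1}"

definition vec_l2norm :: "complex vec \<Rightarrow> real" where
  "vec_l2norm v = L2_set (\<lambda>i. cmod (v $ i)) {..<dim_vec v}"

definition mat_opnorm :: "complex mat \<Rightarrow> real" where
  "mat_opnorm A =
     (SUP v\<in>{v \<in> carrier_vec (dim_col A). vec_l2norm v \<le> 1}. vec_l2norm (A *\<^sub>v v))"

definition nc_supnorm ::
    "('d :: finite \<Rightarrow> 'h \<Rightarrow> 'h :: complex_hilbert_space)
      \<Rightarrow> (nat \<Rightarrow> ('d \<Rightarrow> complex mat) \<Rightarrow> complex mat) \<Rightarrow> ennreal" where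
  "nc_supnorm Q F = (SUP (n, X)\<in>nc_ball Q. ennreal (mat_opnorm (F n X)))"


section \<open>The free algebra\<close>

text \<open>Words are wrapped in a type of their own so that concatenation can be the (additively
  written) monoid operation from which \<^typ>\<open>'a \<Rightarrow>\<^sub>0 'b\<close> derives its convolution product;
  polynomials then form the monoid algebra of the free monoid.\<close>

datatype 'd nc_word = NC_Word (letters: "'d list")

instantiation nc_word :: (type) monoid_add
begin

definition "zero_nc_word = NC_Word []"
definition "plus_nc_word u v = NC_Word (letters u @ letters v)"

instance
  by standard (simp_all add: zero_nc_word_def plus_nc_word_def)

end

type_synonym 'd nc_poly = "'d nc_word \<Rightarrow>\<^sub>0 complex"

definition nc_GL :: "nat \<Rightarrow> 'd nc_poly mat set" where
  "nc_GL k = Units (ring_mat TYPE('d nc_poly) k ())"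

definition nc_atom :: "nat \<Rightarrow> 'd nc_poly mat \<Rightarrow> bool" where
  "nc_atom k P \<longleftrightarrow> P \<in> carrier_mat k k \<and>
     \<not> (\<exists>F \<in> carrier_mat k k. \<exists>G \<in> carrier_mat k k.
          F \<notin> nc_GL k \<and> G \<notin> nc_GL k \<and> P = F * G)"


section \<open>Evaluation\<close>

definition word_eval :: "nat \<Rightarrow> ('d \<Rightarrow> complex mat) \<Rightarrow> 'd nc_word \<Rightarrow> complex mat" where
  "word_eval n X w = foldr (\<lambda>j A. X j * A) (letters w) (1\<^sub>m n)"

definition kron :: "complex mat \<Rightarrow> complex mat \<Rightarrow> complex mat" where
  "kron A B = mat (dim_row A * dim_row B) (dim_col A * dim_col B)
     (\<lambda>(i, j). A $$ (i div dim_row B, j div dim_col B) * B $$ (i mod dim_row B, j mod dim_col B))"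

definition coeff_mat :: "'d nc_poly mat \<Rightarrow> 'd nc_word \<Rightarrow> complex mat" where
  "coeff_mat P w = map_mat (\<lambda>p. Poly_Mapping.lookup p w) P"

definition nc_support :: "'d nc_poly mat \<Rightarrow> 'd nc_word set" where
  "nc_support P = (\<Union>p\<in>elements_mat P. Poly_Mapping.keys p)"

text \<open>The sum of the matrices \<open>C\<^sub>w \<otimes> X\<^sup>w\<close>, formed entrywise because matrices of unspecified
  size have no additive monoid structure.\<close>

definition nc_eval :: "'d nc_poly mat \<Rightarrow> nat \<Rightarrow> ('d \<Rightarrow> complex mat) \<Rightarrow> complex mat" where
  "nc_eval P n X = mat (dim_row P * n) (dim_col P * n)
     (\<lambda>ij. \<Sum>w\<in>nc_support P. kron (coeff_mat P w) (word_eval n X w) $$ ij)"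

definition nc_dilate ::
    "real \<Rightarrow> 'd nc_poly mat \<Rightarrow> nat \<Rightarrow> ('d \<Rightarrow> complex mat) \<Rightarrow> complex mat" where
  "nc_dilate r P n X = nc_eval P n (\<lambda>j. complex_of_real r \<cdot>\<^sub>m X j)"

definition nc_stable ::
    "('d :: finite \<Rightarrow> 'h \<Rightarrow> 'h :: complex_hilbert_space) \<Rightarrow> 'd nc_poly mat \<Rightarrow> bool" where
  "nc_stable Q P \<longleftrightarrow> (\<forall>(n, X) \<in> nc_ball Q. det (nc_eval P n X) \<noteq> 0)"

text \<open>\<^const>\<open>mat_inverse\<close> returns \<^const>\<open>None\<close> exactly on the non-invertible matrices.\<close>

abbreviation mat_inv :: "complex mat \<Rightarrow> complex mat" where
  "mat_inv A \<equiv> the (mat_inverse A)"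

end

theory Submission
  imports Defs "Jordan_Normal_Form.Spectral_Radius"
begin

text \<open>
  Write \<open>R\<close> for the free algebra. Since \<open>0\<close> lies in the ball, \<open>P(0)\<close> is invertible, and since the
  \<open>Q\<^sub>j\<close> are linearly independent, the coordinates \<open>X\<^sub>j\<close> are bounded on the ball
  (\<open>coordinates_bounded\<close>), so that \<open>P(X) - P(rX)\<close> is of order \<open>1 - r\<close>. As
  \<open>P(rX)\<^bsup>-1\<^esup> P(X) = 1 + P(rX)\<^bsup>-1\<^esup> (P(X) - P(rX))\<close>, and similarly on the other side, it is enough to
  prove that the inverse grows at most to first order, \<open>(1 - r) \<parallel>P(rX)\<^bsup>-1\<^esup>\<parallel> \<le> C\<close> (\<open>inverse_growth\<close>).
  This is where atomicity is needed: a product of \<open>m\<close> atoms can grow like \<open>(1 - r)\<^bsup>-m\<^esup>\<close>.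

  Algebra. Every row \<open>u\<close> over \<open>R\<close> can be divided uniquely by \<open>P\<close>, \<open>u = c P + \<Sum>\<^sub>j Z\<^sub>j (D\<^sub>j u)\<close> with a
  constant row \<open>c\<close>; the operators \<open>D\<^sub>j\<close> are backward shifts. If a space \<open>U\<close> of rows is stable under
  all \<open>D\<^sub>j\<close> and contains the rows of \<open>P\<close>, then \<open>k\<close> rows of \<open>U\<close> generate the same left module as \<open>U\<close>
  (\<open>shift_module_generated\<close>), which yields a factorization of \<open>P\<close>. For an atom, therefore, \<open>U\<close>
  either consists of left multiples of \<open>P\<close> or generates all rows (\<open>shift_module_dichotomy\<close>). If
  \<open>P\<close> is invertible over \<open>R\<close>, its inverse is a polynomial and bounded. Otherwise choose \<open>U\<close> not
  contained in the multiples of \<open>P\<close> and of least dimension modulo them. On this quotient the \<open>D\<^sub>j\<close>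
  act by an irreducible tuple \<open>A\<close> of complex matrices, and \<open>P\<close> is stably associated to the linear
  pencil \<open>1 - L\<close>, \<open>L = \<Sum>\<^sub>j A\<^sub>j Z\<^sub>j\<close> (\<open>stable_association\<close>). So \<open>1 - L(X)\<close> is invertible wherever
  \<open>P(X)\<close> is, and \<open>P\<^bsup>-1\<^esup> = a (1 - L)\<^bsup>-1\<^esup> H + b\<close> with polynomial matrices \<open>a\<close>, \<open>b\<close>, \<open>H\<close>: the inverse of
  \<open>P\<close> grows no faster than the resolvent of \<open>L\<close>.

  Analysis. It remains to see that the powers \<open>L(X)\<^bsup>m\<^esup>\<close> are bounded uniformly over the ball
  (\<open>power_bounded\<close>). Compress \<open>L(X)\<^bsup>m\<^esup>\<close> by two unit vectors \<open>g\<close>, \<open>h\<close> of the space on which \<open>X\<close> acts,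
  to an \<open>N \<times> N\<close> matrix \<open>B\<close>. For a word \<open>w\<close> and a small \<open>\<epsilon> > 0\<close>, every eigenvalue of \<open>\<epsilon>\<^bsup>|w|\<^esup> B A\<^sup>w\<close> is
  an eigenvalue of a product of operators \<open>L(Y\<^sub>t)\<close> with contractive \<open>Y\<^sub>t\<close>. Putting the \<open>Y\<^sub>t\<close> into a
  cyclic block matrix, which is again contractive, stability of the pencil forces these
  eigenvalues into the closed unit disc (\<open>cyclic_product_eigenvalue_le_1\<close>), hence
  \<open>|tr (B A\<^sup>w)| \<le> N \<epsilon>\<^bsup>-|w|\<^esup>\<close>. By Burnside's theorem (\<open>elementary_matrix_in_span\<close>) the \<open>A\<^sup>w\<close> span all
  matrices, so these traces determine the entries of \<open>B\<close>, with a bound that depends neither on \<open>m\<close>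
  nor on \<open>X\<close>.
\<close>

text \<open>Matrices and vectors are functions of natural numbers, of which only the values below the
  relevant size matter. This avoids carrier conditions, and lets the sizes vary freely inside
  statements.\<close>

abbreviation delta :: "'i \<Rightarrow> 'i \<Rightarrow> 'c::zero_neq_one" where
  "delta i m \<equiv> if i = m then 1 else 0"

abbreviation mprod ::
    "nat \<Rightarrow> ('i \<Rightarrow> nat \<Rightarrow> 'c::semiring_0) \<Rightarrow> (nat \<Rightarrow> 'j \<Rightarrow> 'c) \<Rightarrow> 'i \<Rightarrow> 'j \<Rightarrow> 'c" where
  "mprod L F G i m \<equiv> \<Sum>l<L. F i l * G l m"

section \<open>The free algebra\<close>

abbreviation lookup :: "'d nc_poly \<Rightarrow> 'd nc_word \<Rightarrow> complex" where
  "lookup \<equiv> Poly_Mapping.lookup"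

definition coeff0 :: "'d nc_poly \<Rightarrow> complex" where
  "coeff0 p = lookup p 0"

definition const :: "complex \<Rightarrow> 'd nc_poly" where
  "const c = Poly_Mapping.single 0 c"

definition var :: "'d \<Rightarrow> 'd nc_poly" where
  "var j = Poly_Mapping.single (NC_Word [j]) 1"

text \<open>The free algebra is \<open>\<complex> \<oplus> \<Oplus>\<^sub>j Z\<^sub>j R\<close>; \<open>shift j\<close> is the projection to the \<open>j\<close>-th summand
  followed by the removal of \<open>Z\<^sub>j\<close> on the left.\<close>

definition shift :: "'d \<Rightarrow> 'd nc_poly \<Rightarrow> 'd nc_poly" where
  "shift j p = Poly_Mapping.map_key (\<lambda>w. NC_Word (j # letters w)) p"

lemma inj_Cons_word: "inj (\<lambda>w. NC_Word (j # letters w))"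
  by (auto simp: inj_def nc_word.expand)

lemma lookup_shift: "lookup (shift j p) w = lookup p (NC_Word (j # letters w))"
  unfolding shift_def by (simp add: Poly_Mapping.map_key.rep_eq[OF inj_Cons_word])

lemma nc_poly_sum_singles:
  "p = (\<Sum>w\<in>Poly_Mapping.keys p. Poly_Mapping.single w (lookup p w))"
  by (rule poly_mapping_eqI)
    (auto simp: lookup_sum lookup_single when_def sum.delta in_keys_iff)

lemma nc_poly_induct [case_names zero single add]:
  fixes p :: "'d nc_poly"
  assumes "R 0" "\<And>w c. R (Poly_Mapping.single w c)" "\<And>p q. R p \<Longrightarrow> R q \<Longrightarrow> R (p + q)"
  shows "R p"
proof -
  have "R (\<Sum>w\<in>S. Poly_Mapping.single w (lookup p w))" if "finite S" for S
    using that by (induction S rule: finite_induct) (auto intro: assms)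
  from this[of "Poly_Mapping.keys p"] show ?thesis
    by (simp add: nc_poly_sum_singles[symmetric])
qed

lemma const_0 [simp]: "const 0 = 0" by (simp add: const_def)
lemma const_1 [simp]: "const 1 = 1" by (simp add: const_def)
lemma const_add: "const (a + b) = const a + const b" by (simp add: const_def single_add)
lemma const_minus: "const (- a) = - const a" by (simp add: const_def single_uminus)
lemma const_mult: "const (a * b) = const a * const b" by (simp add: const_def mult_single)
lemma const_sum: "const (sum f S) = (\<Sum>i\<in>S. const (f i))"
  by (induction S rule: infinite_finite_induct) (auto simp: const_add)

lemma lookup_const_mult [simp]: "lookup (const c * p) w = c * lookup p w"
  unfolding const_def mult_map_scale_conv_mult[symmetric]
  by (simp add: Poly_Mapping.map.rep_eq when_def)

lemma coeff0_0 [simp]: "coeff0 0 = 0" by (simp add: coeff0_def)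
lemma coeff0_add: "coeff0 (p + q) = coeff0 p + coeff0 q" by (simp add: coeff0_def lookup_add)
lemma coeff0_sum: "coeff0 (sum f S) = (\<Sum>i\<in>S. coeff0 (f i))" by (simp add: coeff0_def lookup_sum)
lemma coeff0_const [simp]: "coeff0 (const c) = c" by (simp add: coeff0_def const_def)

lemma coeff0_const_mult: "coeff0 (const c * p) = c * coeff0 p"
  by (simp add: coeff0_def)

lemma word_add_eq_0_iff: "(u :: 'd nc_word) + v = 0 \<longleftrightarrow> u = 0 \<and> v = 0"
  by (cases u; cases v) (auto simp: zero_nc_word_def plus_nc_word_def)

lemma coeff0_mult: "coeff0 (p * q) = coeff0 p * coeff0 q"
proof (induction p rule: nc_poly_induct)
  case (single u c)
  show ?case
    by (induction q rule: nc_poly_induct)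
      (auto simp: coeff0_def mult_single lookup_single when_def word_add_eq_0_iff distrib_left lookup_add)
qed (auto simp: coeff0_add distrib_right)

lemma coeff0_var_mult [simp]: "coeff0 (var j * p) = 0"
  by (simp add: coeff0_mult) (simp add: coeff0_def var_def zero_nc_word_def lookup_single when_def)

lemma shift_0 [simp]: "shift j 0 = 0"
  by (rule poly_mapping_eqI) (simp add: lookup_shift)
lemma shift_add: "shift j (p + q) = shift j p + shift j q"
  by (rule poly_mapping_eqI) (simp add: lookup_shift lookup_add)
lemma shift_diff: "shift j (p - q) = shift j p - shift j q"
  by (rule poly_mapping_eqI) (simp add: lookup_shift lookup_minus)
lemma shift_sum: "shift j (sum f S) = (\<Sum>i\<in>S. shift j (f i))"
  by (rule poly_mapping_eqI) (simp add: lookup_shift lookup_sum)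
lemma shift_const_mult: "shift j (const c * p) = const c * shift j p"
  by (rule poly_mapping_eqI) (simp add: lookup_shift)

lemma shift_var_mult: "shift j (var i * p) = (if i = j then p else 0)"
proof (induction p rule: nc_poly_induct)
  case (single u c)
  show ?case
    by (rule poly_mapping_eqI)
      (auto simp: lookup_shift var_def mult_single lookup_single when_def plus_nc_word_def
        nc_word.expand)
qed (auto simp: shift_add distrib_left)

lemma nc_poly_split:
  fixes p :: "'d::finite nc_poly"
  shows "p = const (coeff0 p) + (\<Sum>j\<in>UNIV. var j * shift j p)"
proof (rule poly_mapping_eqI)
  fix w :: "'d nc_word"
  show "lookup p w = lookup (const (coeff0 p) + (\<Sum>j\<in>UNIV. var j * shift j p)) w"
  proof (cases "letters w")
    case Nil
    then have "w = 0" by (simp add: zero_nc_word_def nc_word.expand)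
    then show ?thesis
      by (simp add: coeff0_add coeff0_sum flip: coeff0_def)
  next
    case (Cons i w')
    then have w: "w = NC_Word (i # letters (NC_Word w'))" by (simp add: nc_word.expand)
    have "lookup (var j * shift j p) w = (if j = i then lookup p w else 0)" for j
      using arg_cong[OF shift_var_mult[of i j "shift j p"], of "\<lambda>q. lookup q (NC_Word w')"]
      by (auto simp: lookup_shift w)
    moreover have "lookup (const (coeff0 p)) w = 0"
      by (simp add: const_def lookup_single w zero_nc_word_def)
    ultimately show ?thesis
      by (simp add: lookup_add lookup_sum)
  qed
qed

text \<open>A twisted Leibniz rule: the second summand comes from the part of \<open>p\<close> on which \<open>shift j\<close>
  has nothing to remove.\<close>

lemma shift_mult:
  fixes p q :: "'d::finite nc_poly"
  shows "shift j (p * q) = shift j p * q + const (coeff0 p) * shift j q"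
proof -
  have "shift j (p * q) = shift j ((const (coeff0 p) + (\<Sum>i\<in>UNIV. var i * shift i p)) * q)"
    by (simp flip: nc_poly_split)
  also have "\<dots> = const (coeff0 p) * shift j q + (\<Sum>i\<in>UNIV. shift j (var i * (shift i p * q)))"
    by (simp add: distrib_right shift_add shift_const_mult sum_distrib_right shift_sum mult.assoc)
  also have "\<dots> = shift j p * q + const (coeff0 p) * shift j q"
    by (simp add: shift_var_mult)
  finally show ?thesis .
qed

definition deg_le :: "'d nc_poly \<Rightarrow> nat \<Rightarrow> bool" where
  "deg_le p e \<longleftrightarrow> (\<forall>w. e < length (letters w) \<longrightarrow> lookup p w = 0)"

lemma deg_le_0 [simp]: "deg_le 0 e" by (simp add: deg_le_def)
lemma deg_le_mono: "deg_le p e \<Longrightarrow> e \<le> e' \<Longrightarrow> deg_le p e'" by (auto simp: deg_le_def)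
lemma deg_le_add: "deg_le p e \<Longrightarrow> deg_le q e \<Longrightarrow> deg_le (p + q) e" by (simp add: deg_le_def lookup_add)
lemma deg_le_diff: "deg_le p e \<Longrightarrow> deg_le q e \<Longrightarrow> deg_le (p - q) e" by (simp add: deg_le_def lookup_minus)
lemma deg_le_const_mult: "deg_le p e \<Longrightarrow> deg_le (const c * p) e" by (simp add: deg_le_def)
lemma deg_le_sum: "(\<And>i. i \<in> S \<Longrightarrow> deg_le (f i) e) \<Longrightarrow> deg_le (sum f S) e" by (simp add: deg_le_def lookup_sum)
lemma deg_le_const [simp]: "deg_le (const c) e"
  by (auto simp: deg_le_def const_def lookup_single when_def zero_nc_word_def)
lemma deg_le_shift: "deg_le p e \<Longrightarrow> deg_le (shift j p) (e - 1)" by (simp add: deg_le_def lookup_shift)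
lemma deg_le_0_shift: "deg_le p 0 \<Longrightarrow> shift j p = 0"
  by (rule poly_mapping_eqI) (simp add: deg_le_def lookup_shift)
lemma deg_le_ex:
  fixes p :: "'a nc_poly"
  shows "\<exists>e. deg_le p e"
proof
  show "deg_le p (Max (insert 0 (length ` letters ` Poly_Mapping.keys p)))"
    unfolding deg_le_def
  proof (intro allI impI)
    fix w :: "'a nc_word" assume *: "Max (insert 0 (length ` letters ` Poly_Mapping.keys p)) < length (letters w)"
    have "w \<notin> Poly_Mapping.keys p"
    proof
      assume "w \<in> Poly_Mapping.keys p"
      then have "length (letters w) \<le> Max (insert 0 (length ` letters ` Poly_Mapping.keys p))"
        by (intro Max_ge) auto
      then show False using * by simp
    qed
    then show "lookup p w = 0" by (simp add: in_keys_iff)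
  qed
qed

lemma deg_le_ex_family:
  assumes "finite I" shows "\<exists>e. \<forall>i\<in>I. deg_le (f i) e"
proof -
  have "\<forall>i. \<exists>e. deg_le (f i) e" using deg_le_ex by blast
  then obtain d where d: "\<And>i. deg_le (f i) (d i)" by metis
  have "deg_le (f i) (sum d I)" if "i \<in> I" for i
    by (rule deg_le_mono[OF d], rule member_le_sum) (use that assms in auto)
  then show ?thesis by blast
qed

lemma finite_words_le: "finite {w :: 'd::finite nc_word. length (letters w) \<le> e}"
proof -
  have "{w :: 'd nc_word. length (letters w) \<le> e} \<subseteq> NC_Word ` {l. set l \<subseteq> UNIV \<and> length l \<le> e}"
    by (auto intro!: image_eqI[of _ _ "letters _"])
  then show ?thesis
    by (rule finite_subset) (rule finite_imageI, rule finite_lists_length_le, rule finite)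
qed


lemma const_var_commute: "const c * (var j * p) = var j * (const c * p)"
proof -
  have "const c * var j = var j * const c"
    by (simp add: const_def var_def mult_single)
  then show ?thesis by (simp flip: mult.assoc)
qed

section \<open>Evaluation\<close>

type_synonym 'd tuple = "'d \<Rightarrow> nat \<Rightarrow> nat \<Rightarrow> complex"

text \<open>A tuple \<open>X\<close> of \<open>n \<times> n\<close> matrices turns the vectors of length \<open>n\<close> into a left module over
  the free algebra. Working with this action instead of evaluated matrices makes compatibility
  with products an equation without side conditions.\<close>

fun word_act :: "nat \<Rightarrow> 'd tuple \<Rightarrow> 'd list \<Rightarrow> (nat \<Rightarrow> complex) \<Rightarrow> nat \<Rightarrow> complex" where
  "word_act n X [] h = h"
| "word_act n X (j # w) h = (\<lambda>a. \<Sum>b<n. X j a b * word_act n X w h b)"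

definition act :: "nat \<Rightarrow> 'd tuple \<Rightarrow> 'd nc_poly \<Rightarrow> (nat \<Rightarrow> complex) \<Rightarrow> nat \<Rightarrow> complex" where
  "act n X p h a = (\<Sum>w\<in>Poly_Mapping.keys p. lookup p w * word_act n X (letters w) h a)"

text \<open>The action of a matrix over the free algebra on families of vectors; in tensor notation,
  \<open>M(X)\<close> applied to \<open>\<Sum>\<^sub>l e\<^sub>l \<otimes> y\<^sub>l\<close>.\<close>

abbreviation mat_act :: "nat \<Rightarrow> nat \<Rightarrow> 'd tuple \<Rightarrow> (nat \<Rightarrow> nat \<Rightarrow> 'd nc_poly) \<Rightarrow>
    (nat \<Rightarrow> nat \<Rightarrow> complex) \<Rightarrow> nat \<Rightarrow> nat \<Rightarrow> complex" where
  "mat_act L n X M y i a \<equiv> \<Sum>l<L. act n X (M i l) (y l) a"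

abbreviation dilate :: "real \<Rightarrow> 'd tuple \<Rightarrow> 'd tuple" where
  "dilate r X j a b \<equiv> complex_of_real r * X j a b"

lemma word_act_append: "word_act n X (u @ v) h = word_act n X u (word_act n X v h)"
  by (induction u) auto

lemma word_act_linear:
  "word_act n X w (\<lambda>b. x b + c * y b) a = word_act n X w x a + c * word_act n X w y a"
  by (induction w arbitrary: a) (auto simp: distrib_left sum.distrib sum_distrib_left mult_ac)

lemma word_act_cong:
  "(\<And>b. b < n \<Longrightarrow> h b = h' b) \<Longrightarrow> a < n \<Longrightarrow> word_act n X w h a = word_act n X w h' a"
  by (induction w arbitrary: a) auto

lemma act_superset:
  "finite S \<Longrightarrow> Poly_Mapping.keys p \<subseteq> S \<Longrightarrow>
    act n X p h a = (\<Sum>w\<in>S. lookup p w * word_act n X (letters w) h a)"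
  unfolding act_def by (rule sum.mono_neutral_left) (auto simp: in_keys_iff)

lemma act_add: "act n X (p + q) h a = act n X p h a + act n X q h a"
  using act_superset[of "Poly_Mapping.keys p \<union> Poly_Mapping.keys q" p n X h a]
    act_superset[of "Poly_Mapping.keys p \<union> Poly_Mapping.keys q" q n X h a]
    act_superset[of "Poly_Mapping.keys p \<union> Poly_Mapping.keys q" "p + q" n X h a]
    Poly_Mapping.keys_add[of p q]
  by (simp add: lookup_add distrib_right sum.distrib)

lemma act_single [simp]: "act n X (Poly_Mapping.single w c) h a = c * word_act n X (letters w) h a"
  using act_superset[of "{w}" "Poly_Mapping.single w c" n X h a] by (simp add: keys_single)

lemma act_zero [simp]: "act n X 0 h a = 0" by (simp add: act_def)

lemma act_const [simp]: "act n X (const c) h a = c * h a"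
  by (simp add: const_def zero_nc_word_def)

lemma act_one [simp]: "act n X 1 h = h"
  using act_const[of n X 1 h] by (simp add: fun_eq_iff)

lemma act_uminus: "act n X (- p) h a = - act n X p h a"
  using act_add[of n X p "- p" h a] by (simp add: eq_neg_iff_add_eq_0 add.commute)

lemma act_diff: "act n X (p - q) h a = act n X p h a - act n X q h a"
  using act_add[of n X p "- q" h a] by (simp add: act_uminus)

lemma act_sum: "act n X (\<Sum>i\<in>S. f i) h a = (\<Sum>i\<in>S. act n X (f i) h a)"
  by (induction S rule: infinite_finite_induct) (auto simp: act_add)

lemma act_linear: "act n X p (\<lambda>b. x b + c * y b) a = act n X p x a + c * act n X p y a"
  by (simp add: act_def word_act_linear distrib_left sum.distrib sum_distrib_left mult_ac)

lemma act_arg_zero [simp]: "act n X p (\<lambda>b. 0) a = 0"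
  using act_linear[of n X p "\<lambda>b. 0" "-1" "\<lambda>b. 0" a] by simp

lemma act_arg_sum: "act n X p (\<lambda>b. \<Sum>i\<in>S. c i * f i b) a = (\<Sum>i\<in>S. c i * act n X p (f i) a)"
proof (induction S rule: infinite_finite_induct)
  case (insert i S)
  then show ?case using act_linear[of n X p "\<lambda>b. \<Sum>i\<in>S. c i * f i b" "c i" "f i" a]
    by (simp add: add.commute)
qed auto

lemma act_arg_diff: "act n X p (\<lambda>b. x b - y b) a = act n X p x a - act n X p y a"
  using act_linear[of n X p x "-1" y a] by simp

lemma act_cong:
  "(\<And>b. b < n \<Longrightarrow> h b = h' b) \<Longrightarrow> a < n \<Longrightarrow> act n X p h a = act n X p h' a"
  unfolding act_def by (intro sum.cong refl arg_cong[of _ _ "\<lambda>x. _ * x"] word_act_cong)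

lemma act_mult: "act n X (p * q) h = act n X p (act n X q h)"
proof (induction p rule: nc_poly_induct)
  case (single u c)
  show ?case
  proof (induction q rule: nc_poly_induct)
    case (single v d)
    have "act n X (Poly_Mapping.single v d) h = (\<lambda>b. 0 + d * word_act n X (letters v) h b)"
      by (simp add: fun_eq_iff)
    then show ?case
      by (simp only: act_linear) (simp add: fun_eq_iff mult_single plus_nc_word_def word_act_append)
  next
    case (add p q)
    have "act n X (p + q) h = (\<lambda>b. act n X p h b + 1 * act n X q h b)"
      by (simp add: fun_eq_iff act_add)
    then show ?case using add
      by (simp only: act_linear distrib_left) (simp add: fun_eq_iff act_add act_linear)
  qed (simp add: fun_eq_iff act_def)
qed (auto simp: fun_eq_iff act_add distrib_right)

lemma act_var [simp]: "act n X (var j) h a = (\<Sum>b<n. X j a b * h b)"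
  by (simp add: var_def)

lemma act_expand:
  assumes "m < n"
  shows "act n X p z m = (\<Sum>l<n. z l * act n X p (\<lambda>b. delta b l) m)"
proof -
  have "act n X p z m = act n X p (\<lambda>b. \<Sum>l<n. z l * delta b l) m"
    using assms by (intro act_cong) (auto simp: if_distrib[of "\<lambda>c. _ * c"] cong: if_cong)
  then show ?thesis by (simp only: act_arg_sum)
qed

lemma act_matrix_mult:
  "(\<Sum>m\<in>M. act n X (\<Sum>l\<in>L. F l * G l m) (y m) a) = (\<Sum>l\<in>L. act n X (F l) (\<lambda>b. \<Sum>m\<in>M. act n X (G l m) (y m) b) a)"
proof -
  have "act n X (F l) (\<lambda>b. \<Sum>m\<in>M. act n X (G l m) (y m) b) a = (\<Sum>m\<in>M. act n X (F l) (act n X (G l m) (y m)) a)" for l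
    using act_arg_sum[of n X "F l" "\<lambda>_. 1" "\<lambda>m. act n X (G l m) (y m)" M a] by simp
  then show ?thesis by (simp add: act_sum act_mult) (rule sum.swap)
qed

lemma word_act_scale: "word_act n (\<lambda>j a b. c * X j a b) w h a = c ^ length w * word_act n X w h a"
  by (induction w arbitrary: a) (auto simp: sum_distrib_left mult_ac)

lemma act_at_zero: "act n (\<lambda>j a b. 0) p h a = coeff0 p * h a"
proof (induction p rule: nc_poly_induct)
  case (single w c)
  show ?case
  proof (cases "letters w")
    case Nil
    then have "w = 0" by (simp add: zero_nc_word_def nc_word.expand)
    then show ?thesis by (simp add: coeff0_def zero_nc_word_def)
  next
    case (Cons j v)
    then have "w \<noteq> 0" by (auto simp: zero_nc_word_def)
    then show ?thesis using Cons by (simp add: coeff0_def lookup_single)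
  qed
qed (auto simp: act_add coeff0_add distrib_right)

lemma act_cong_tuple:
  assumes "\<And>j a b. a < n \<Longrightarrow> b < n \<Longrightarrow> X j a b = X' j a b" and "a < n"
  shows "act n X p h a = act n X' p h a"
proof -
  have "word_act n X w h a = word_act n X' w h a" if "a < n" for w a
    using that
  proof (induction w arbitrary: a)
    case (Cons j w)
    then show ?case using assms(1) by (auto intro!: sum.cong)
  qed simp
  then show ?thesis using assms(2) by (simp add: act_def)
qed

section \<open>Finite-dimensional linear algebra\<close>

lemma sum_mult_assoc:
  fixes f :: "'a \<Rightarrow> 'c::semiring_0"
  shows "(\<Sum>m\<in>M. (\<Sum>l\<in>L. f l * g l m) * h m) = (\<Sum>l\<in>L. f l * (\<Sum>m\<in>M. g l m * h m))"
  by (simp add: sum_distrib_left sum_distrib_right mult.assoc) (rule sum.swap)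

lemma sum_blocks: "(\<Sum>p<s * n. f p) = (\<Sum>t<s. \<Sum>a<n. f (t * n + a :: nat))"
proof -
  have "(\<Sum>p<s * n. f p) = (\<Sum>t<s. sum f {t * n..<t * n + n})" by (rule sum.nat_group[symmetric])
  also have "\<dots> = (\<Sum>t<s. \<Sum>a<n. f (t * n + a))"
  proof (rule sum.cong[OF refl])
    fix t :: nat
    show "sum f {t * n..<t * n + n} = (\<Sum>a<n. f (t * n + a))"
      using sum.shift_bounds_nat_ivl[of f 0 "t * n" n] by (simp add: atLeast0LessThan add.commute)
  qed
  finally show ?thesis .
qed

lemma sum_cyclic:
  assumes "0 < s"
  shows "(\<Sum>t<s. F (Suc t mod s)) = (\<Sum>t<s. F t)"
proof -
  obtain r where s: "s = Suc r" using assms by (cases s) auto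
  have "(\<Sum>t<Suc r. F (Suc t mod Suc r)) = (\<Sum>t<r. F (Suc t)) + F 0" by simp
  also have "\<dots> = (\<Sum>t<Suc r. F t)" by (simp add: sum.lessThan_Suc_shift add.commute del: sum.lessThan_Suc)
  finally show ?thesis by (simp only: s)
qed

text \<open>For dropping the index \<open>l0\<close> from \<open>0, \<dots>, N - 1\<close>: the last index takes its place.\<close>

lemma bij_betw_skip:
  assumes "l0 < (N :: nat)"
  shows "bij_betw (\<lambda>l. if l = l0 then N - 1 else l) {..<N - 1} ({..<N} - {l0})"
  using assms by (intro bij_betw_byWitness[where f' = "\<lambda>l. if l = N - 1 then l0 else l"])
    (auto split: if_splits)

lemma left_eigenvector_exists:
  fixes G :: "nat \<Rightarrow> nat \<Rightarrow> complex"
  assumes "0 < r"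
  obtains \<mu> z s0 where "s0 < r" "z s0 \<noteq> 0" "\<And>t. t < r \<Longrightarrow> (\<Sum>s<r. z s * G s t) = \<mu> * z t"
proof -
  define M where "M = mat r r (\<lambda>(i, j). G j i)"
  have M: "M \<in> carrier_mat r r" by (simp add: M_def)
  obtain \<mu> where "\<mu> \<in> spectrum M" using spectrum_non_empty[OF M assms] by blast
  then obtain v where v: "v \<in> carrier_vec r" "v \<noteq> 0\<^sub>v r" "M *\<^sub>v v = \<mu> \<cdot>\<^sub>v v"
    using M by (auto simp: spectrum_def eigenvalue_def eigenvector_def)
  obtain s0 where "s0 < r" "v $ s0 \<noteq> 0" using v(1,2) by (metis eq_vecI carrier_vecD index_zero_vec)
  moreover have "(\<Sum>s<r. v $ s * G s t) = \<mu> * v $ t" if t: "t < r" for t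
  proof -
    have "(M *\<^sub>v v) $ t = (\<Sum>s<r. G s t * v $ s)"
      using t v(1) by (simp add: M_def scalar_prod_def atLeast0LessThan)
    moreover have "(M *\<^sub>v v) $ t = \<mu> * v $ t" using t v by simp
    ultimately show ?thesis by (simp add: mult.commute)
  qed
  ultimately show thesis by (rule that[of s0 "\<lambda>i. v $ i"])
qed

text \<open>The trace is the sum of the \<open>N\<close> eigenvalues, read off from a Schur triangulation.\<close>

lemma norm_trace_le:
  fixes T :: "nat \<Rightarrow> nat \<Rightarrow> complex"
  assumes eig: "\<And>\<mu> y l. l < N \<Longrightarrow> y l \<noteq> 0 \<Longrightarrow> (\<And>i. i < N \<Longrightarrow> (\<Sum>m<N. T i m * y m) = \<mu> * y i) \<Longrightarrow> cmod \<mu> \<le> 1"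
  shows "cmod (\<Sum>i<N. T i i) \<le> real N"
proof -
  define M where "M = mat N N (\<lambda>(i, j). T i j)"
  have M: "M \<in> carrier_mat N N" by (simp add: M_def)
  obtain es where es: "char_poly M = (\<Prod>e\<leftarrow>es. [:- e, 1:])" "length es = N"
    using char_poly_factorized[OF M] by blast
  obtain B S S' where dec: "schur_decomposition M es = (B, S, S')" by (metis surj_pair)
  from schur_decomposition[OF M es(1) dec] have sim: "similar_mat_wit M B S S'" and diag: "diag_mat B = es"
    by auto
  note w = similar_mat_witD2[OF M sim]
  have carrier: "S \<in> carrier_mat N N" "S' \<in> carrier_mat N N" "B \<in> carrier_mat N N"
    and "S' * S = 1\<^sub>m N" using w by auto
  have le1: "cmod e \<le> 1" if "e \<in> set es" for e
  proof -
    have "poly (char_poly M) e = 0"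
      unfolding es(1) using that by (auto simp: poly_prod_list prod_list_zero_iff)
    then have "eigenvalue M e" using eigenvalue_root_char_poly[OF M] by simp
    then obtain v where v: "v \<in> carrier_vec N" "v \<noteq> 0\<^sub>v N" "M *\<^sub>v v = e \<cdot>\<^sub>v v"
      using M by (auto simp: eigenvalue_def eigenvector_def)
    obtain l where l: "l < N" "v $ l \<noteq> 0" using v(1,2) by (metis eq_vecI carrier_vecD index_zero_vec)
    show ?thesis
    proof (rule eig[of l "\<lambda>i. v $ i" e])
      fix i assume i: "i < N"
      have "(M *\<^sub>v v) $ i = (\<Sum>s<N. T i s * v $ s)"
        using i v(1) by (simp add: M_def scalar_prod_def atLeast0LessThan)
      moreover have "(M *\<^sub>v v) $ i = e * v $ i" using i v by simp
      ultimately show "(\<Sum>m<N. T i m * v $ m) = e * v $ i" by simp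
    qed (use l in auto)
  qed
  have SBS: "M $$ (i, i) = (\<Sum>a<N. \<Sum>b<N. S $$ (i, a) * B $$ (a, b) * S' $$ (b, i))" if i: "i < N" for i
  proof -
    have "M $$ (i, i) = ((S * B) * S') $$ (i, i)" using w by simp
    also have "\<dots> = (\<Sum>b<N. (S * B) $$ (i, b) * S' $$ (b, i))"
      using carrier i by (simp add: times_mat_def scalar_prod_def atLeast0LessThan)
    also have "\<dots> = (\<Sum>b<N. (\<Sum>a<N. S $$ (i, a) * B $$ (a, b)) * S' $$ (b, i))"
      using carrier i by (intro sum.cong) (auto simp: times_mat_def scalar_prod_def atLeast0LessThan)
    finally show ?thesis
      by (simp add: sum_distrib_right) (rule sum.swap)
  qed
  have S'S: "(\<Sum>i<N. S' $$ (b, i) * S $$ (i, a)) = delta b a" if "a < N" "b < N" for a b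
  proof -
    have "(S' * S) $$ (b, a) = (\<Sum>i<N. S' $$ (b, i) * S $$ (i, a))"
      using carrier that by (simp add: times_mat_def scalar_prod_def atLeast0LessThan)
    then show ?thesis unfolding \<open>S' * S = 1\<^sub>m N\<close> using that by simp
  qed
  have "(\<Sum>i<N. T i i) = (\<Sum>i<N. M $$ (i, i))" by (simp add: M_def)
  also have "\<dots> = (\<Sum>i<N. \<Sum>a<N. \<Sum>b<N. S $$ (i, a) * B $$ (a, b) * S' $$ (b, i))"
    by (intro sum.cong) (auto simp: SBS)
  also have "\<dots> = (\<Sum>a<N. \<Sum>i<N. \<Sum>b<N. S $$ (i, a) * B $$ (a, b) * S' $$ (b, i))"
    by (rule sum.swap)
  also have "\<dots> = (\<Sum>a<N. \<Sum>b<N. \<Sum>i<N. S $$ (i, a) * B $$ (a, b) * S' $$ (b, i))"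
    by (intro sum.cong refl sum.swap)
  also have "\<dots> = (\<Sum>a<N. \<Sum>b<N. B $$ (a, b) * (\<Sum>i<N. S' $$ (b, i) * S $$ (i, a)))"
    by (simp add: sum_distrib_left mult_ac)
  also have "\<dots> = (\<Sum>a<N. \<Sum>b<N. if b = a then B $$ (a, b) else 0)"
    by (intro sum.cong) (auto simp: S'S)
  also have "\<dots> = (\<Sum>a<N. B $$ (a, a))" by simp
  also have "\<dots> = sum_list es"
    using w unfolding diag[symmetric] diag_mat_def by (simp add: interv_sum_list_conv_sum_set_nat atLeast0LessThan)
  finally have "cmod (\<Sum>i<N. T i i) = cmod (sum_list es)" by simp
  also have "\<dots> \<le> sum_list (map cmod es)" by (induction es) (auto intro: norm_triangle_le)
  also have "\<dots> \<le> sum_list (map (\<lambda>_. 1) es)" by (rule sum_list_mono) (rule le1)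
  also have "\<dots> = real N" using es(2) by (simp add: sum_list_triv)
  finally show ?thesis .
qed

text \<open>Below, this alternative takes the place of dimension counts. The induction on \<open>J\<close>
  eliminates the coordinate \<open>j0\<close>: either all of \<open>K\<close> vanishes there, or \<open>K\<close> is spanned by a vector
  \<open>x0\<close> with \<open>x0 j0 = 1\<close> and the part \<open>K'\<close> that vanishes at \<open>j0\<close>.\<close>

lemma subspace_full_or_annihilated:
  fixes K :: "('i \<Rightarrow> complex) set"
  assumes "finite J"
    and "\<And>x y c. x \<in> K \<Longrightarrow> y \<in> K \<Longrightarrow> (\<lambda>i. x i + c * y i) \<in> K"
    and "\<exists>x. x \<in> K"
  shows "(\<forall>z. \<exists>x\<in>K. \<forall>j\<in>J. x j = z j) \<or>
         (\<exists>y. (\<exists>j\<in>J. y j \<noteq> 0) \<and> (\<forall>x\<in>K. (\<Sum>j\<in>J. x j * y j) = 0))"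
  using assms
proof (induction J arbitrary: K rule: finite_induct)
  case empty
  then show ?case by auto
next
  case (insert j0 J)
  note lin = insert.prems(1)
  have scale: "(\<lambda>i. c * y i) \<in> K" if "y \<in> K" for y c
    using lin[OF that that, of "c - 1"] by (simp add: algebra_simps)
  show ?case
  proof (cases "\<forall>x\<in>K. x j0 = 0")
    case True
    have "(\<Sum>j\<in>insert j0 J. x j * delta j j0) = 0" if "x \<in> K" for x
      using True that insert.hyps by (auto intro!: sum.neutral)
    then show ?thesis by (intro disjI2 exI[of _ "\<lambda>j. delta j j0"]) auto
  next
    case False
    then obtain x1 where x1: "x1 \<in> K" "x1 j0 \<noteq> 0" by auto
    define x0 where "x0 = (\<lambda>i. (1 / x1 j0) * x1 i)"
    have x0: "x0 \<in> K" "x0 j0 = 1" using x1 scale[of x1 "1 / x1 j0"] by (simp_all add: x0_def)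
    define K' where "K' = {x \<in> K. x j0 = 0}"
    have "(\<forall>z. \<exists>x\<in>K'. \<forall>j\<in>J. x j = z j) \<or>
         (\<exists>y. (\<exists>j\<in>J. y j \<noteq> 0) \<and> (\<forall>x\<in>K'. (\<Sum>j\<in>J. x j * y j) = 0))"
    proof (rule insert.IH)
      show "\<exists>x. x \<in> K'" using scale[OF x1(1), of 0] by (auto simp: K'_def)
    qed (use lin in \<open>auto simp: K'_def\<close>)
    then show ?thesis
    proof
      assume full: "\<forall>z. \<exists>x\<in>K'. \<forall>j\<in>J. x j = z j"
      have "\<exists>x\<in>K. \<forall>j\<in>insert j0 J. x j = z j" for z
      proof -
        obtain x where x: "x \<in> K'" "\<forall>j\<in>J. x j = z j - z j0 * x0 j"
          using full[rule_format, of "\<lambda>j. z j - z j0 * x0 j"] by auto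
        have "(\<lambda>i. x i + z j0 * x0 i) \<in> K" using lin x x0 by (auto simp: K'_def)
        moreover have "\<forall>j\<in>insert j0 J. x j + z j0 * x0 j = z j"
          using x x0 insert.hyps by (auto simp: K'_def)
        ultimately show ?thesis by (intro bexI[of _ "\<lambda>i. x i + z j0 * x0 i"]) auto
      qed
      then show ?thesis by blast
    next
      assume "\<exists>y. (\<exists>j\<in>J. y j \<noteq> 0) \<and> (\<forall>x\<in>K'. (\<Sum>j\<in>J. x j * y j) = 0)"
      then obtain y where y: "\<exists>j\<in>J. y j \<noteq> 0" "\<And>x. x \<in> K' \<Longrightarrow> (\<Sum>j\<in>J. x j * y j) = 0" by auto
      define y' where "y' = y(j0 := - (\<Sum>j\<in>J. x0 j * y j))"
      have J: "(\<Sum>j\<in>J. x j * y' j) = (\<Sum>j\<in>J. x j * y j)" for x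
        using insert.hyps by (intro sum.cong) (auto simp: y'_def)
      have "(\<Sum>j\<in>insert j0 J. x j * y' j) = 0" if "x \<in> K" for x
      proof -
        have "(\<lambda>i. x i + (- x j0) * x0 i) \<in> K'"
          using lin[OF that x0(1), of "- x j0"] x0(2) by (simp add: K'_def)
        from y(2)[OF this] have "(\<Sum>j\<in>J. x j * y j) = x j0 * (\<Sum>j\<in>J. x0 j * y j)"
          by (simp add: algebra_simps sum_subtractf sum_distrib_left)
        then show ?thesis using insert.hyps by (simp add: J) (simp add: y'_def)
      qed
      moreover have "\<exists>j\<in>insert j0 J. y' j \<noteq> 0"
        using y(1) insert.hyps by (auto simp: y'_def)
      ultimately show ?thesis by blast
    qed
  qed
qed

section \<open>Irreducible tuples of matrices\<close>

text \<open>Equivalent to the absence of a common nontrivial invariant subspace: the subspace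
  generated by \<open>y\<close> must not be annihilated by a nonzero \<open>x\<close>.\<close>

definition irreducible_tuple :: "nat \<Rightarrow> 'd tuple \<Rightarrow> bool" where
  "irreducible_tuple N A \<longleftrightarrow>
     (\<forall>x y. (\<exists>l<N. x l \<noteq> 0) \<longrightarrow> (\<exists>m<N. y m \<noteq> 0) \<longrightarrow> (\<exists>w. (\<Sum>l<N. x l * word_act N A w y l) \<noteq> 0))"

context
  fixes N :: nat and A :: "'d tuple"
  assumes irr: "irreducible_tuple N A"
begin

lemma transitive_action:
  assumes y: "m < N" "y m \<noteq> 0"
  shows "\<exists>p. \<forall>m<N. act N A p y m = z m"
proof -
  define K where "K = {x. \<exists>p. \<forall>m<N. act N A p y m = x m}"
  have "(\<forall>z. \<exists>x\<in>K. \<forall>j\<in>{..<N}. x j = z j) \<or>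
         (\<exists>y. (\<exists>j\<in>{..<N}. y j \<noteq> 0) \<and> (\<forall>x\<in>K. (\<Sum>j<N. x j * y j) = 0))"
  proof (rule subspace_full_or_annihilated)
    fix x x' c assume "x \<in> K" "x' \<in> K"
    then obtain p p' where "\<forall>m<N. act N A p y m = x m" "\<forall>m<N. act N A p' y m = x' m"
      by (auto simp: K_def)
    then have "\<forall>m<N. act N A (p + const c * p') y m = x m + c * x' m"
      by (simp add: act_add act_mult)
    then show "(\<lambda>i. x i + c * x' i) \<in> K" by (auto simp: K_def)
  next
    have "act N A 0 y \<in> K" unfolding K_def by blast
    then show "\<exists>x. x \<in> K" by blast
  qed simp
  then show ?thesis
  proof
    assume "\<forall>z. \<exists>x\<in>K. \<forall>j\<in>{..<N}. x j = z j"
    then obtain x where "x \<in> K" "\<forall>j\<in>{..<N}. x j = z j" by blast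
    then show ?thesis by (auto simp: K_def)
  next
    assume "\<exists>y. (\<exists>j\<in>{..<N}. y j \<noteq> 0) \<and> (\<forall>x\<in>K. (\<Sum>j<N. x j * y j) = 0)"
    then obtain x where x: "\<exists>j<N. x j \<noteq> 0" "\<And>x'. x' \<in> K \<Longrightarrow> (\<Sum>j<N. x' j * x j) = 0" by auto
    obtain w where w: "(\<Sum>l<N. x l * word_act N A w y l) \<noteq> 0"
      using irr x(1) y unfolding irreducible_tuple_def by blast
    have "act N A (Poly_Mapping.single (NC_Word w) 1) y \<in> K" unfolding K_def by blast
    from x(2)[OF this] w show ?thesis by (simp add: mult.commute)
  qed
qed

text \<open>\<open>p(A)\<close> is a sum of \<open>r\<close> matrices of rank one.\<close>

definition rank_rep :: "nat \<Rightarrow> 'd nc_poly \<Rightarrow> bool" where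
  "rank_rep r p \<longleftrightarrow> (\<exists>f g. \<forall>y. \<forall>m<N. act N A p y m = (\<Sum>s<r. f s m * (\<Sum>l<N. g s l * y l)))"

text \<open>The heart of Burnside's theorem. Take \<open>T = p(A)\<close> nonzero of least rank \<open>r\<close>, written as
  \<open>T = \<Sum>\<^sub>s f\<^sub>s g\<^sub>s\<close>. For \<open>S = q(A)\<close>, \<open>T S T\<close> is given by the \<open>r \<times> r\<close> matrix \<open>G\<close> of the numbers
  \<open>g\<^sub>s (S f\<^sub>t)\<close>. With an eigenvalue \<open>\<mu>\<close> of \<open>G\<close>, \<open>T S T - \<mu> T\<close> has smaller rank and so vanishes.
  Hence \<open>T S u\<close> is a multiple of \<open>u\<close> for every \<open>u\<close> in the range of \<open>T\<close>; as the vectors \<open>S u\<close>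
  exhaust the space, \<open>T\<close> has rank one.\<close>

lemma rank_one_exists:
  assumes "0 < N"
  obtains p f g where "\<And>y m. m < N \<Longrightarrow> act N A p y m = f m * (\<Sum>l<N. g l * y l)"
    "\<exists>m<N. f m \<noteq> 0" "\<exists>l<N. g l \<noteq> 0"
proof -
  define good where "good r \<longleftrightarrow> (\<exists>p. rank_rep r p \<and> (\<exists>y. \<exists>m<N. act N A p y m \<noteq> 0))" for r
  have "good N"
  proof -
    have "rank_rep N 1"
      unfolding rank_rep_def
      by (intro exI[of _ "\<lambda>s m. delta s m"])
        (auto simp: if_distrib[of "\<lambda>c. c * _"] cong: if_cong)
    moreover have "\<exists>y. \<exists>m<N. act N A 1 y m \<noteq> 0"
      using assms by (intro exI[of _ "\<lambda>_. 1"]) auto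
    ultimately show ?thesis unfolding good_def by blast
  qed
  define r where "r = (LEAST r. good r)"
  have "good r" unfolding r_def by (rule LeastI) (rule \<open>good N\<close>)
  have minimal: "r \<le> r'" if "good r'" for r' unfolding r_def by (rule Least_le) (rule that)
  obtain p y0 m1 where p: "rank_rep r p" and y0: "m1 < N" "act N A p y0 m1 \<noteq> 0"
    using \<open>good r\<close> unfolding good_def by blast
  obtain f g where fg: "\<And>y m. m < N \<Longrightarrow> act N A p y m = (\<Sum>s<r. f s m * (\<Sum>l<N. g s l * y l))"
    using p unfolding rank_rep_def by blast
  have r: "0 < r" using y0 fg[OF y0(1), of y0] by (cases r) auto
  define u where "u = act N A p y0"
  have scalar: "\<exists>\<mu>. \<forall>m<N. act N A p (act N A q u) m = \<mu> * u m" for q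
  proof -
    define G where "G s t = (\<Sum>l<N. g s l * act N A q (f t) l)" for s t
    obtain \<mu> z s0 where s0: "s0 < r" "z s0 \<noteq> 0" and z: "\<And>t. t < r \<Longrightarrow> (\<Sum>s<r. z s * G s t) = \<mu> * z t"
      by (rule left_eigenvector_exists[OF r, of G]) (rule that)
    define g' where "g' s l = (\<Sum>t<r. G s t * g t l) - \<mu> * g s l" for s l
    have zg': "(\<Sum>s<r. z s * g' s l) = 0" for l
    proof -
      have "(\<Sum>s<r. z s * (\<Sum>t<r. G s t * g t l)) = (\<Sum>t<r. (\<Sum>s<r. z s * G s t) * g t l)"
        by (rule sum_mult_assoc[symmetric])
      also have "\<dots> = (\<Sum>t<r. z t * (\<mu> * g t l))" by (intro sum.cong) (auto simp: z)
      finally show ?thesis by (simp add: g'_def right_diff_distrib sum_subtractf)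
    qed
    have pqp: "act N A (p * q * p - const \<mu> * p) y m = (\<Sum>s<r. f s m * (\<Sum>l<N. g' s l * y l))"
      if m: "m < N" for y m
    proof -
      have q: "act N A q (act N A p y) l = (\<Sum>t<r. (\<Sum>l<N. g t l * y l) * act N A q (f t) l)"
        if "l < N" for l
      proof -
        have "act N A q (act N A p y) l = act N A q (\<lambda>b. \<Sum>t<r. (\<Sum>l<N. g t l * y l) * f t b) l"
          using that by (intro act_cong) (auto simp: fg mult.commute)
        then show ?thesis by (simp only: act_arg_sum)
      qed
      have "act N A (p * q * p) y m = (\<Sum>s<r. f s m * (\<Sum>l<N. g s l * act N A q (act N A p y) l))"
        by (simp add: act_mult fg[OF m])
      also have "\<dots> = (\<Sum>s<r. f s m * (\<Sum>l<N. g s l * (\<Sum>t<r. act N A q (f t) l * (\<Sum>l<N. g t l * y l))))"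
        by (intro sum.cong refl arg_cong[of _ _ "\<lambda>x. _ * x"]) (simp add: q mult.commute)
      also have "\<dots> = (\<Sum>s<r. f s m * (\<Sum>t<r. G s t * (\<Sum>l<N. g t l * y l)))"
        unfolding G_def sum_mult_assoc ..
      also have "\<dots> = (\<Sum>s<r. f s m * (\<Sum>l<N. (\<Sum>t<r. G s t * g t l) * y l))"
        unfolding sum_mult_assoc ..
      finally show ?thesis
        by (simp add: act_diff act_mult fg[OF m] g'_def left_diff_distrib right_diff_distrib
            sum_subtractf sum_distrib_left mult_ac)
    qed
    have "rank_rep (r - 1) (p * q * p - const \<mu> * p)"
    proof -
      define \<sigma> where "\<sigma> s = (if s = s0 then r - 1 else s)" for s
      have \<sigma>: "bij_betw \<sigma> {..<r - 1} ({..<r} - {s0})"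
        unfolding \<sigma>_def by (rule bij_betw_skip[OF s0(1)])
      have g's0: "g' s0 l = - (\<Sum>s\<in>{..<r} - {s0}. z s / z s0 * g' s l)" for l
        using zg'[of l] s0 by (simp add: sum.remove[of _ s0] sum_divide_distrib[symmetric] field_simps
            add_eq_0_iff)
      have "act N A (p * q * p - const \<mu> * p) y m
          = (\<Sum>s<r - 1. (f (\<sigma> s) m - z (\<sigma> s) / z s0 * f s0 m) * (\<Sum>l<N. g' (\<sigma> s) l * y l))"
        if m: "m < N" for y m
      proof -
        define D where "D s = (\<Sum>l<N. g' s l * y l)" for s
        have "D s0 = - (\<Sum>s\<in>{..<r} - {s0}. z s / z s0 * D s)"
          unfolding D_def g's0 sum_mult_assoc[symmetric] by (simp add: sum_negf)
        then have "(\<Sum>s<r. f s m * D s)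
            = (\<Sum>s\<in>{..<r} - {s0}. f s m * D s) - f s0 m * (\<Sum>s\<in>{..<r} - {s0}. z s / z s0 * D s)"
          using s0(1) by (simp add: sum.remove[of _ s0])
        also have "\<dots> = (\<Sum>s\<in>{..<r} - {s0}. (f s m - z s / z s0 * f s0 m) * D s)"
          unfolding sum_distrib_left sum_subtractf[symmetric]
          by (intro sum.cong refl) (simp add: algebra_simps)
        also have "\<dots> = (\<Sum>s<r - 1. (f (\<sigma> s) m - z (\<sigma> s) / z s0 * f s0 m) * D (\<sigma> s))"
          by (rule sum.reindex_bij_betw[OF \<sigma>, symmetric])
        finally show ?thesis unfolding pqp[OF m] D_def .
      qed
      then show ?thesis unfolding rank_rep_def
        by (intro exI[of _ "\<lambda>s m. f (\<sigma> s) m - z (\<sigma> s) / z s0 * f s0 m"] exI[of _ "\<lambda>s. g' (\<sigma> s)"]) auto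
    qed
    then have "\<forall>m<N. act N A (p * q * p - const \<mu> * p) y0 m = 0"
      using minimal[of "r - 1"] r unfolding good_def by fastforce
    then show ?thesis
      by (intro exI[of _ \<mu>]) (simp add: act_diff act_mult u_def)
  qed
  have um1: "u m1 \<noteq> 0" using y0 by (simp add: u_def)
  define g1 where "g1 l = act N A p (\<lambda>b. delta b l) m1 / u m1" for l
  have rank1: "act N A p y m = u m * (\<Sum>l<N. g1 l * y l)" if m: "m < N" for y m
  proof -
    obtain q where q: "\<forall>m<N. act N A q u m = y m" using transitive_action[of m1 u y] y0 um1 by blast
    obtain \<mu> where \<mu>: "\<forall>m<N. act N A p (act N A q u) m = \<mu> * u m" using scalar by blast
    have *: "act N A p y m = \<mu> * u m" if "m < N" for m
      using act_cong[of N "act N A q u" y m A p] q \<mu> that by simp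
    have "\<mu> = act N A p y m1 / u m1" using *[OF y0(1)] um1 by simp
    also have "\<dots> = (\<Sum>l<N. g1 l * y l)"
      unfolding act_expand[OF y0(1), of A p y] g1_def sum_divide_distrib
      by (intro sum.cong) auto
    finally show ?thesis using *[OF m] by simp
  qed
  have "\<exists>l<N. g1 l \<noteq> 0"
  proof (rule ccontr)
    assume "\<not> ?thesis"
    then have "act N A p y0 m1 = 0" using rank1[OF y0(1), of y0] by simp
    with y0 show False by simp
  qed
  then show thesis using that[of p u g1] rank1 y0(1) um1 by blast
qed

text \<open>Burnside's theorem. From one matrix of rank one, multiplication on the left moves the
  column factor to any vector, and multiplication on the right moves the row factor to any
  functional.\<close>

theorem elementary_matrix_in_span:
  assumes i: "i < N" and l: "l < N"
  shows "\<exists>p. \<forall>y. \<forall>m<N. act N A p y m = (if m = i then y l else 0)"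
proof -
  have "0 < N" using i by simp
  then obtain p f g where p: "\<And>y m. m < N \<Longrightarrow> act N A p y m = f m * (\<Sum>l<N. g l * y l)"
    and f: "\<exists>m<N. f m \<noteq> 0" and g: "\<exists>l<N. g l \<noteq> 0" using rank_one_exists by blast
  obtain p1 where p1: "\<forall>m<N. act N A p1 f m = delta m i"
    using transitive_action[of _ f "\<lambda>m. delta m i"] f by blast
  define K where "K = {x. \<exists>p2. \<forall>z. (\<Sum>m<N. g m * act N A p2 z m) = (\<Sum>j<N. x j * z j)}"
  have "(\<forall>z. \<exists>x\<in>K. \<forall>j\<in>{..<N}. x j = z j) \<or>
         (\<exists>y. (\<exists>j\<in>{..<N}. y j \<noteq> 0) \<and> (\<forall>x\<in>K. (\<Sum>j<N. x j * y j) = 0))"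
  proof (rule subspace_full_or_annihilated)
    fix x x' c assume "x \<in> K" "x' \<in> K"
    then obtain p p' where pp: "\<forall>z. (\<Sum>m<N. g m * act N A p z m) = (\<Sum>j<N. x j * z j)"
      "\<forall>z. (\<Sum>m<N. g m * act N A p' z m) = (\<Sum>j<N. x' j * z j)"
      by (auto simp: K_def)
    have "(\<Sum>m<N. g m * act N A (p + const c * p') z m) = (\<Sum>j<N. (x j + c * x' j) * z j)" for z
    proof -
      have "(\<Sum>m<N. g m * act N A (p + const c * p') z m)
          = (\<Sum>m<N. g m * act N A p z m) + c * (\<Sum>m<N. g m * act N A p' z m)"
        by (simp add: act_add act_mult distrib_left sum.distrib sum_distrib_left mult_ac)
      also have "\<dots> = (\<Sum>j<N. x j * z j) + c * (\<Sum>j<N. x' j * z j)" using pp by simp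
      also have "\<dots> = (\<Sum>j<N. (x j + c * x' j) * z j)"
        by (simp add: distrib_right sum.distrib sum_distrib_left mult.assoc)
      finally show ?thesis .
    qed
    then show "(\<lambda>i. x i + c * x' i) \<in> K" by (auto simp: K_def)
  next
    have "(\<lambda>_. 0) \<in> K" unfolding K_def by (auto intro!: exI[of _ 0])
    then show "\<exists>x. x \<in> K" by blast
  qed simp
  then have "\<exists>x\<in>K. \<forall>j\<in>{..<N}. x j = delta j l"
  proof
    assume "\<exists>y. (\<exists>j\<in>{..<N}. y j \<noteq> 0) \<and> (\<forall>x\<in>K. (\<Sum>j<N. x j * y j) = 0)"
    then obtain y j where y: "j < N" "y j \<noteq> 0" "\<And>x. x \<in> K \<Longrightarrow> (\<Sum>j<N. x j * y j) = 0" by auto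
    obtain l' where l': "l' < N" "g l' \<noteq> 0" using g by blast
    obtain p2 where p2: "\<forall>m<N. act N A p2 y m = delta m l'"
      using transitive_action[where y = y and m = j, OF y(1,2), of "\<lambda>m. delta m l'"] by blast
    define x where "x l = (\<Sum>m<N. g m * act N A p2 (\<lambda>b. delta b l) m)" for l
    have x: "(\<Sum>m<N. g m * act N A p2 z m) = (\<Sum>j<N. x j * z j)" for z
      unfolding x_def sum_mult_assoc
      by (intro sum.cong refl arg_cong[of _ _ "\<lambda>x. _ * x"]) (simp add: act_expand[of _ N A p2 z] mult.commute)
    then have "x \<in> K" by (auto simp: K_def)
    from y(3)[OF this] have "(\<Sum>m<N. g m * act N A p2 y m) = 0" by (simp add: x)
    moreover have "(\<Sum>m<N. g m * act N A p2 y m) = (\<Sum>m<N. if m = l' then g m else 0)"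
      by (intro sum.cong) (auto simp: p2)
    ultimately show ?thesis using l' by simp
  qed (erule spec)
  then obtain x where xK: "x \<in> K" and x: "\<forall>j\<in>{..<N}. x j = delta j l" by blast
  obtain p2 where p2: "\<forall>z. (\<Sum>m<N. g m * act N A p2 z m) = (\<Sum>j<N. x j * z j)"
    using xK by (auto simp: K_def)
  have p2': "(\<Sum>m<N. g m * act N A p2 z m) = z l" for z
  proof -
    have "(\<Sum>j<N. x j * z j) = (\<Sum>j<N. if j = l then z j else 0)"
      by (intro sum.cong) (auto simp: x)
    then show ?thesis using l p2 by simp
  qed
  have "act N A (p1 * p * p2) y m = (if m = i then y l else 0)" if m: "m < N" for y m
  proof -
    have "act N A (p1 * p * p2) y m = act N A p1 (\<lambda>b. 0 + y l * f b) m"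
      unfolding act_mult using m by (intro act_cong) (auto simp: p p2')
    also have "\<dots> = y l * act N A p1 f m" by (simp only: act_linear) simp
    finally show ?thesis using p1 m by simp
  qed
  then show ?thesis by blast
qed

end

section \<open>The linear pencil of an atom\<close>

text \<open>The entries of the linear matrix \<open>L = \<Sum>\<^sub>j A\<^sub>j Z\<^sub>j\<close>.\<close>

definition lin_entry :: "'d::finite tuple \<Rightarrow> nat \<Rightarrow> nat \<Rightarrow> 'd nc_poly" where
  "lin_entry A l m = (\<Sum>j\<in>UNIV. var j * const (A j l m))"

text \<open>\<open>Ci\<close> is the inverse of the constant term \<open>P(0)\<close>.\<close>

locale invertible_at_zero =
  fixes k :: nat and P :: "nat \<Rightarrow> nat \<Rightarrow> 'd::finite nc_poly" and Ci :: "nat \<Rightarrow> nat \<Rightarrow> complex"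
  assumes Ci_left: "i < k \<Longrightarrow> m < k \<Longrightarrow> (\<Sum>l<k. Ci i l * coeff0 (P l m)) = delta i m"
    and Ci_right: "i < k \<Longrightarrow> m < k \<Longrightarrow> (\<Sum>l<k. coeff0 (P i l) * Ci l m) = delta i m"
begin

text \<open>The left module \<open>R\<^bsup>1 \<times> k\<^esup> P\<close>.\<close>

definition multiples :: "(nat \<Rightarrow> 'd nc_poly) set" where
  "multiples = {u. \<exists>q. \<forall>i<k. u i = (\<Sum>l<k. q l * P l i)}"

text \<open>The constant row \<open>u(0) P(0)\<^bsup>-1\<^esup>\<close>, the quotient of the division of \<open>u\<close> by \<open>P\<close>.\<close>

definition quot0 :: "(nat \<Rightarrow> 'd nc_poly) \<Rightarrow> nat \<Rightarrow> complex" where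
  "quot0 u l = (\<Sum>i<k. coeff0 (u i) * Ci i l)"

text \<open>The backward shifts \<open>D\<^sub>j\<close> of the division by \<open>P\<close>, see \<open>row_split\<close>.\<close>

definition bshift :: "'d \<Rightarrow> (nat \<Rightarrow> 'd nc_poly) \<Rightarrow> nat \<Rightarrow> 'd nc_poly" where
  "bshift j u i = shift j (u i) - (\<Sum>l<k. const (quot0 u l) * shift j (P l i))"

lemma row_split:
  assumes "i < k"
  shows "u i = (\<Sum>l<k. const (quot0 u l) * P l i) + (\<Sum>j\<in>UNIV. var j * bshift j u i)"
proof -
  have coeff0: "(\<Sum>l<k. quot0 u l * coeff0 (P l i)) = coeff0 (u i)"
  proof -
    have "(\<Sum>l<k. quot0 u l * coeff0 (P l i)) = (\<Sum>m<k. coeff0 (u m) * (\<Sum>l<k. Ci m l * coeff0 (P l i)))"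
      unfolding quot0_def by (rule sum_mult_assoc)
    also have "\<dots> = (\<Sum>m<k. if m = i then coeff0 (u m) else 0)"
      using assms by (intro sum.cong) (auto simp: Ci_left)
    finally show ?thesis using assms by simp
  qed
  have "(\<Sum>l<k. const (quot0 u l) * P l i) =
      (\<Sum>l<k. const (quot0 u l) * (const (coeff0 (P l i)) + (\<Sum>j\<in>UNIV. var j * shift j (P l i))))"
    by (simp flip: nc_poly_split)
  also have "\<dots> = const (coeff0 (u i)) + (\<Sum>l<k. \<Sum>j\<in>UNIV. var j * (const (quot0 u l) * shift j (P l i)))"
    unfolding coeff0[symmetric]
    by (simp add: distrib_left sum.distrib const_sum const_mult sum_distrib_left const_var_commute)
  also have "\<dots> = const (coeff0 (u i)) + (\<Sum>j\<in>UNIV. var j * (\<Sum>l<k. const (quot0 u l) * shift j (P l i)))"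
    by (subst sum.swap) (simp add: sum_distrib_left)
  finally have "(\<Sum>l<k. const (quot0 u l) * P l i) + (\<Sum>j\<in>UNIV. var j * bshift j u i)
      = const (coeff0 (u i)) + (\<Sum>j\<in>UNIV. var j * shift j (u i))"
    by (simp add: bshift_def right_diff_distrib sum_subtractf)
  then show ?thesis by (simp flip: nc_poly_split)
qed

lemma multiples_ext: "u \<in> multiples \<Longrightarrow> (\<And>i. i < k \<Longrightarrow> u i = u' i) \<Longrightarrow> u' \<in> multiples"
  by (auto simp: multiples_def)

lemma multiples_zero: "(\<lambda>i. 0) \<in> multiples"
  unfolding multiples_def by (auto intro: exI[of _ "\<lambda>_. 0"])

lemma multiples_row: "l < k \<Longrightarrow> P l \<in> multiples"
  unfolding multiples_def
  by (auto intro!: exI[of _ "\<lambda>m. delta m l"] simp: if_distrib[of "\<lambda>x. x * _"] cong: if_cong)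

lemma multiples_add: "u \<in> multiples \<Longrightarrow> u' \<in> multiples \<Longrightarrow> (\<lambda>i. u i + u' i) \<in> multiples"
  unfolding multiples_def
proof safe
  fix q q' assume "\<forall>i<k. u i = (\<Sum>l<k. q l * P l i)" "\<forall>i<k. u' i = (\<Sum>l<k. q' l * P l i)"
  then show "\<exists>q. \<forall>i<k. u i + u' i = (\<Sum>l<k. q l * P l i)"
    by (intro exI[of _ "\<lambda>l. q l + q' l"]) (simp add: distrib_right sum.distrib)
qed

lemma multiples_mult: "u \<in> multiples \<Longrightarrow> (\<lambda>i. r * u i) \<in> multiples"
  unfolding multiples_def
proof safe
  fix q assume "\<forall>i<k. u i = (\<Sum>l<k. q l * P l i)"
  then show "\<exists>q. \<forall>i<k. r * u i = (\<Sum>l<k. q l * P l i)"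
    by (intro exI[of _ "\<lambda>l. r * q l"]) (simp add: sum_distrib_left mult.assoc)
qed

lemma multiples_diff: "u \<in> multiples \<Longrightarrow> u' \<in> multiples \<Longrightarrow> (\<lambda>i. u i - u' i) \<in> multiples"
  using multiples_add[OF _ multiples_mult[of u' "-1"]] by simp

lemma multiples_sum: "(\<And>t. t \<in> S \<Longrightarrow> w t \<in> multiples) \<Longrightarrow> (\<lambda>i. \<Sum>t\<in>S. r t * w t i) \<in> multiples"
proof (induction S rule: infinite_finite_induct)
  case (insert t S)
  have "(\<lambda>i. r t * w t i + (\<Sum>t\<in>S. r t * w t i)) \<in> multiples"
    by (intro multiples_add multiples_mult) (use insert in auto)
  then show ?case using insert.hyps by simp
qed (auto intro: multiples_zero)

lemma multiples_combination: "(\<lambda>i. \<Sum>l<k. q l * P l i) \<in> multiples"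
  by (intro multiples_sum multiples_row) auto

text \<open>If \<open>u = q P\<close>, then \<open>D\<^sub>j u\<close> is the multiple of \<open>P\<close> by the shift of \<open>q\<close>.\<close>

lemma multiples_bshift:
  assumes "u \<in> multiples" shows "bshift j u \<in> multiples"
proof -
  obtain q where q: "\<And>i. i < k \<Longrightarrow> u i = (\<Sum>l<k. q l * P l i)" using assms by (auto simp: multiples_def)
  have quot0: "quot0 u m = coeff0 (q m)" if "m < k" for m
  proof -
    have "quot0 u m = (\<Sum>i<k. (\<Sum>l<k. coeff0 (q l) * coeff0 (P l i)) * Ci i m)"
      unfolding quot0_def by (intro sum.cong) (auto simp: q coeff0_sum coeff0_mult)
    also have "\<dots> = (\<Sum>l<k. coeff0 (q l) * (\<Sum>i<k. coeff0 (P l i) * Ci i m))" by (rule sum_mult_assoc)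
    also have "\<dots> = (\<Sum>l<k. if l = m then coeff0 (q l) else 0)"
      using that by (intro sum.cong) (auto simp: Ci_right)
    finally show ?thesis using that by simp
  qed
  have "bshift j u i = (\<Sum>l<k. shift j (q l) * P l i)" if "i < k" for i
    using that by (simp add: bshift_def q quot0 shift_sum shift_mult sum.distrib)
  then show ?thesis unfolding multiples_def by auto
qed

lemma bshift_of_var_sum: "bshift j (\<lambda>i. \<Sum>j\<in>UNIV. var j * y j i) = y j"
  by (rule ext) (simp add: bshift_def quot0_def coeff0_sum shift_sum shift_var_mult)

text \<open>The module \<open>R\<^bsup>1 \<times> k\<^esup> / R\<^bsup>1 \<times> k\<^esup> P\<close> has no nontrivial relations of the form \<open>\<Sum>\<^sub>j Z\<^sub>j y\<^sub>j = 0\<close>.\<close>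

lemma multiples_var_sum: "(\<lambda>i. \<Sum>j\<in>UNIV. var j * y j i) \<in> multiples \<Longrightarrow> y j \<in> multiples"
  by (drule multiples_bshift[of _ j]) (simp only: bshift_of_var_sum)

lemma quot0_linear: "quot0 (\<lambda>i. u i + const c * u' i) l = quot0 u l + c * quot0 u' l"
  by (simp add: quot0_def coeff0_add coeff0_const_mult distrib_right sum.distrib sum_distrib_left mult.assoc)

lemma bshift_linear: "bshift j (\<lambda>i. u i + const c * u' i) i = bshift j u i + const c * bshift j u' i"
  by (simp add: bshift_def quot0_linear shift_add shift_const_mult const_add const_mult distrib_right
      sum.distrib right_diff_distrib sum_distrib_left mult.assoc)

lemma bshift_diff: "bshift j (\<lambda>i. u i - u' i) i = bshift j u i - bshift j u' i"
  using bshift_linear[of j u "-1" u' i] by (simp add: const_minus)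

definition shift_module :: "(nat \<Rightarrow> 'd nc_poly) set \<Rightarrow> bool" where
  "shift_module U \<longleftrightarrow> (\<lambda>i. 0) \<in> U \<and> (\<forall>u\<in>U. \<forall>u'\<in>U. \<forall>c. (\<lambda>i. u i + const c * u' i) \<in> U) \<and>
     (\<forall>l<k. P l \<in> U) \<and> (\<forall>u\<in>U. \<forall>j. bshift j u \<in> U)"

lemma shift_module_sum:
  assumes "shift_module U" "u \<in> U" "\<And>t. t < K \<Longrightarrow> T t \<in> U"
  shows "(\<lambda>i. u i + (\<Sum>t<(K::nat). const (c t) * T t i)) \<in> U"
  using assms(3)
proof (induction K)
  case 0
  then show ?case using assms by simp
next
  case (Suc K)
  have "(\<lambda>i. (u i + (\<Sum>t<K. const (c t) * T t i)) + const (c K) * T K i) \<in> U"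
    using Suc assms(1) by (auto simp: shift_module_def)
  then show ?case by (simp add: add.assoc)
qed

definition const_terms_span :: "(nat \<Rightarrow> nat \<Rightarrow> 'd nc_poly) \<Rightarrow> bool" where
  "const_terms_span T \<longleftrightarrow> (\<forall>z. \<exists>c. \<forall>i<k. z i = (\<Sum>t<k. c t * coeff0 (T t i)))"

definition row_degree :: "(nat \<Rightarrow> 'd nc_poly) \<Rightarrow> nat" where
  "row_degree u = (LEAST e. \<forall>i<k. deg_le (u i) e)"

lemma row_degree: "i < k \<Longrightarrow> deg_le (u i) (row_degree u)"
proof -
  have "\<exists>e. \<forall>i<k. deg_le (u i) e" using deg_le_ex_family[of "{..<k}" u] by auto
  then have "\<forall>i<k. deg_le (u i) (row_degree u)" unfolding row_degree_def by (rule LeastI_ex)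
  then show "i < k \<Longrightarrow> deg_le (u i) (row_degree u)" by blast
qed

lemma row_degree_le: "(\<And>i. i < k \<Longrightarrow> deg_le (u i) e) \<Longrightarrow> row_degree u \<le> e"
  unfolding row_degree_def by (rule Least_le) auto

text \<open>Steinitz exchange.\<close>

lemma const_terms_span_exchange:
  assumes T: "const_terms_span T" and u: "\<And>i. i < k \<Longrightarrow> coeff0 (u i) = (\<Sum>t<k. c t * coeff0 (T t i))"
    and t: "t < k" "c t \<noteq> 0"
  shows "const_terms_span (T(t := u))"
  unfolding const_terms_span_def
proof
  fix z :: "nat \<Rightarrow> complex"
  obtain d where d: "\<And>i. i < k \<Longrightarrow> z i = (\<Sum>s<k. d s * coeff0 (T s i))"
    using T by (auto simp: const_terms_span_def)
  define d' where "d' s = (if s = t then d t / c t else d s - d t / c t * c s)" for s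
  have "z i = (\<Sum>s<k. d' s * coeff0 ((T(t := u)) s i))" if "i < k" for i
  proof -
    have "(\<Sum>s<k. d' s * coeff0 ((T(t := u)) s i)) =
        d t / c t * coeff0 (u i) + (\<Sum>s\<in>{..<k} - {t}. (d s - d t / c t * c s) * coeff0 (T s i))"
      using t by (subst sum.remove[of _ t]) (auto simp: d'_def intro!: sum.cong)
    also have "coeff0 (u i) = c t * coeff0 (T t i) + (\<Sum>s\<in>{..<k} - {t}. c s * coeff0 (T s i))"
      unfolding u[OF that] using t by (subst sum.remove[of _ t]) auto
    also have "d t / c t * (c t * coeff0 (T t i) + (\<Sum>s\<in>{..<k} - {t}. c s * coeff0 (T s i)))
        + (\<Sum>s\<in>{..<k} - {t}. (d s - d t / c t * c s) * coeff0 (T s i))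
        = d t * coeff0 (T t i) + (\<Sum>s\<in>{..<k} - {t}. d s * coeff0 (T s i))"
      using t by (simp add: algebra_simps sum_subtractf sum_distrib_left sum_divide_distrib)
    also have "\<dots> = z i"
      unfolding d[OF that] using t by (subst sum.remove[of _ t]) auto
    finally show ?thesis by simp
  qed
  then show "\<exists>c. \<forall>i<k. z i = (\<Sum>s<k. c s * coeff0 ((T(t := u)) s i))" by blast
qed

text \<open>Among the \<open>k\<close>-tuples in \<open>U\<close> whose constant terms span \<open>\<complex>\<^sup>k\<close> take one of least total degree.
  By exchange, the rows of \<open>T\<close> that occur in the expansion of \<open>u(0)\<close> have degree at most that of
  \<open>u\<close>. Subtracting them leaves \<open>u' \<in> U\<close> with \<open>u'(0) = 0\<close>, so \<open>u' = \<Sum>\<^sub>j Z\<^sub>j (D\<^sub>j u')\<close> with \<open>D\<^sub>j u' \<in> U\<close>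
  of smaller degree, and induction on the degree applies.\<close>

lemma shift_module_generated:
  assumes U: "shift_module U"
  obtains T where "\<And>t. t < k \<Longrightarrow> T t \<in> U"
    "\<And>u. u \<in> U \<Longrightarrow> \<exists>a. \<forall>i<k. u i = (\<Sum>t<k. a t * T t i)"
proof -
  define good where "good T \<longleftrightarrow> (\<forall>t<k. T t \<in> U) \<and> const_terms_span T" for T
  have "good P"
  proof -
    have "\<exists>c. \<forall>i<k. z i = (\<Sum>t<k. c t * coeff0 (P t i))" for z
    proof (intro exI[of _ "\<lambda>t. \<Sum>m<k. z m * Ci m t"] allI impI)
      fix i assume i: "i < k"
      have "(\<Sum>t<k. (\<Sum>m<k. z m * Ci m t) * coeff0 (P t i)) = (\<Sum>m<k. z m * (\<Sum>t<k. Ci m t * coeff0 (P t i)))"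
        by (rule sum_mult_assoc)
      also have "\<dots> = (\<Sum>m<k. if m = i then z m else 0)"
        using i by (intro sum.cong) (auto simp: Ci_left)
      finally show "z i = (\<Sum>t<k. (\<Sum>m<k. z m * Ci m t) * coeff0 (P t i))" using i by simp
    qed
    then show ?thesis using U by (auto simp: good_def const_terms_span_def shift_module_def)
  qed
  from ex_has_least_nat[of good, OF this, of "\<lambda>T. \<Sum>t<k. row_degree (T t)"]
  obtain T where T: "good T" and
    minimal: "\<And>T'. good T' \<Longrightarrow> (\<Sum>t<k. row_degree (T t)) \<le> (\<Sum>t<k. row_degree (T' t))" by blast
  have TU: "\<And>t. t < k \<Longrightarrow> T t \<in> U" using T by (auto simp: good_def)
  have gen: "\<exists>a. \<forall>i<k. u i = (\<Sum>t<k. a t * T t i)" if "u \<in> U" "row_degree u \<le> e" for u e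
    using that
  proof (induction e arbitrary: u rule: less_induct)
    case (less e)
    obtain c where c: "\<And>i. i < k \<Longrightarrow> coeff0 (u i) = (\<Sum>t<k. c t * coeff0 (T t i))"
    proof -
      have "\<exists>c. \<forall>i<k. coeff0 (u i) = (\<Sum>t<k. c t * coeff0 (T t i))"
        using T unfolding good_def const_terms_span_def by simp
      then show ?thesis using that by blast
    qed
    \<comment> \<open>Otherwise replacing \<open>T t\<close> by \<open>u\<close> would lower the total degree.\<close>
    have le: "row_degree (T t) \<le> row_degree u" if "t < k" "c t \<noteq> 0" for t
    proof (rule ccontr)
      assume gt: "\<not> ?thesis"
      have "good (T(t := u))"
        using T less.prems const_terms_span_exchange[of T u c t] c that by (auto simp: good_def)
      from minimal[OF this] have "(\<Sum>t<k. row_degree (T t)) \<le> (\<Sum>s<k. row_degree ((T(t := u)) s))" .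
      also have "(\<Sum>s<k. row_degree ((T(t := u)) s)) = row_degree u + (\<Sum>s\<in>{..<k} - {t}. row_degree (T s))"
        using that by (subst sum.remove[of _ t]) (auto intro!: sum.cong)
      also have "(\<Sum>t<k. row_degree (T t)) = row_degree (T t) + (\<Sum>s\<in>{..<k} - {t}. row_degree (T s))"
        using that by (subst sum.remove[of _ t]) auto
      finally show False using gt by simp
    qed
    define u' where "u' i = u i + (\<Sum>t<k. const (- c t) * T t i)" for i
    have u'U: "u' \<in> U" unfolding u'_def by (rule shift_module_sum[OF U less.prems(1)]) (rule TU)
    have coeff0: "coeff0 (u' i) = 0" if "i < k" for i
      using that by (simp add: u'_def coeff0_add coeff0_sum coeff0_const_mult c sum_negf)
    have quot0: "quot0 u' l = 0" for l by (simp add: quot0_def coeff0)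
    have bshift: "bshift j u' i = shift j (u' i)" for j i by (simp add: bshift_def quot0)
    have deg: "deg_le (u' i) e" if "i < k" for i
    proof -
      have "deg_le (const (- c t) * T t i) e" if "t < k" for t
      proof (cases "c t = 0")
        case False
        then show ?thesis
          using le[OF that False] less.prems(2)
          by (intro deg_le_const_mult deg_le_mono[OF row_degree[OF \<open>i < k\<close>, of "T t"]]) simp
      qed auto
      moreover have "deg_le (u i) e" by (rule deg_le_mono[OF row_degree[OF that] less.prems(2)])
      ultimately show ?thesis unfolding u'_def by (intro deg_le_add deg_le_sum) auto
    qed
    have "\<forall>j. \<exists>a. \<forall>i<k. bshift j u' i = (\<Sum>t<k. a t * T t i)"
    proof
      fix j
      show "\<exists>a. \<forall>i<k. bshift j u' i = (\<Sum>t<k. a t * T t i)"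
      proof (cases "e = 0")
        case True
        then show ?thesis using deg by (intro exI[of _ "\<lambda>_. 0"]) (auto simp: bshift deg_le_0_shift)
      next
        case False
        moreover have "bshift j u' \<in> U" using U u'U by (auto simp: shift_module_def)
        moreover have "row_degree (bshift j u') \<le> e - 1"
          by (rule row_degree_le) (simp only: bshift deg_le_shift deg)
        ultimately show ?thesis using less.IH[of "e - 1"] by simp
      qed
    qed
    then obtain a where a: "\<And>j i. i < k \<Longrightarrow> bshift j u' i = mprod k a T j i" by metis
    have "u i = (\<Sum>t<k. (const (c t) + (\<Sum>j\<in>UNIV. var j * a j t)) * T t i)" if "i < k" for i
    proof -
      have "u' i = (\<Sum>j\<in>UNIV. var j * (mprod k a T j i))"
        using row_split[OF that, of u'] a[OF that] by (simp add: quot0)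
      also have "\<dots> = (\<Sum>t<k. (\<Sum>j\<in>UNIV. var j * a j t) * T t i)" by (rule sum_mult_assoc[symmetric])
      finally show ?thesis
        by (simp add: u'_def distrib_right sum.distrib const_minus sum_negf algebra_simps)
    qed
    then show ?case
      by (intro exI[of _ "\<lambda>t. const (c t) + (\<Sum>j\<in>UNIV. var j * a j t)"]) simp
  qed
  show ?thesis by (rule that[of T]) (use TU gen in auto)
qed

end

locale invertible_at_zero_atom = invertible_at_zero k P Ci
  for k :: nat and P :: "nat \<Rightarrow> nat \<Rightarrow> 'd::finite nc_poly" and Ci :: "nat \<Rightarrow> nat \<Rightarrow> complex" +
  assumes atom: "\<And>F G. (\<And>i m. i < k \<Longrightarrow> m < k \<Longrightarrow> P i m = mprod k F G i m) \<Longrightarrow>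
     (\<exists>F'. \<forall>i<k. \<forall>m<k. (\<Sum>t<k. F' i t * F t m) = delta i m) \<or>
     (\<exists>G'. \<forall>i<k. \<forall>m<k. (\<Sum>t<k. G' i t * G t m) = delta i m)"
begin

text \<open>The generators \<open>T\<close> of \<open>U\<close> give \<open>P = F T\<close>. If \<open>F\<close> is invertible, then \<open>T\<close> consists of
  multiples of \<open>P\<close>; if \<open>T\<close> is invertible, then its rows generate all rows.\<close>

lemma shift_module_dichotomy:
  assumes U: "shift_module U"
  shows "U \<subseteq> multiples \<or>
    (\<exists>T a. (\<forall>t<k. T t \<in> U) \<and> (\<forall>i<k. \<forall>m<k. mprod k a T i m = delta i m))"
proof -
  obtain T where T: "\<And>t. t < k \<Longrightarrow> T t \<in> U"
    and gen: "\<And>u. u \<in> U \<Longrightarrow> \<exists>a. \<forall>i<k. u i = (\<Sum>t<k. a t * T t i)"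
    using shift_module_generated[OF U] by blast
  have "\<forall>l. \<exists>a. l < k \<longrightarrow> (\<forall>i<k. P l i = (\<Sum>t<k. a t * T t i))"
    using gen U by (auto simp: shift_module_def)
  then obtain F where F: "\<And>l i. l < k \<Longrightarrow> i < k \<Longrightarrow> P l i = mprod k F T l i" by metis
  have "(\<exists>F'. \<forall>i<k. \<forall>m<k. (\<Sum>t<k. F' i t * F t m) = delta i m) \<or>
     (\<exists>G'. \<forall>i<k. \<forall>m<k. (\<Sum>t<k. G' i t * T t m) = delta i m)"
    by (rule atom) (rule F)
  then show ?thesis
  proof (elim disjE exE)
    fix F' assume F': "\<forall>i<k. \<forall>m<k. (\<Sum>t<k. F' i t * F t m) = delta i m"
    have "T s \<in> multiples" if s: "s < k" for s
    proof (rule multiples_ext)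
      show "(\<lambda>i. \<Sum>l<k. F' s l * P l i) \<in> multiples" by (rule multiples_combination)
      fix i assume i: "i < k"
      have "(\<Sum>l<k. F' s l * P l i) = (\<Sum>l<k. F' s l * (mprod k F T l i))"
        using i by (intro sum.cong) (auto simp: F)
      also have "\<dots> = (\<Sum>t<k. (\<Sum>l<k. F' s l * F l t) * T t i)" by (rule sum_mult_assoc[symmetric])
      also have "\<dots> = (\<Sum>t<k. if t = s then T t i else 0)"
        using s by (intro sum.cong) (auto simp: F')
      finally show "(\<Sum>l<k. F' s l * P l i) = T s i" using s by simp
    qed
    have "u \<in> multiples" if "u \<in> U" for u
    proof -
      obtain a where "\<forall>i<k. u i = (\<Sum>t<k. a t * T t i)" using gen[OF \<open>u \<in> U\<close>] by blast
      moreover have "(\<lambda>i. \<Sum>t<k. a t * T t i) \<in> multiples"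
        by (intro multiples_sum) (use \<open>\<And>s. s < k \<Longrightarrow> T s \<in> multiples\<close> in auto)
      ultimately show ?thesis by (intro multiples_ext[of _ u]) auto
    qed
    then show ?thesis by blast
  next
    fix G' assume "\<forall>i<k. \<forall>m<k. (\<Sum>t<k. G' i t * T t m) = delta i m"
    then show ?thesis using T by blast
  qed
qed

end

context invertible_at_zero_atom
begin

text \<open>The quotient of \<open>U\<close> by the multiples of \<open>P\<close> is nonzero and lies in the span of the classes
  of \<open>v\<^sub>0, \<dots>, v\<^bsub>N-1\<^esub>\<close>, which need not belong to \<open>U\<close>. The least such \<open>N\<close> is the dimension of the
  quotient.\<close>

definition covers :: "nat \<Rightarrow> (nat \<Rightarrow> nat \<Rightarrow> 'd nc_poly) \<Rightarrow> (nat \<Rightarrow> 'd nc_poly) set \<Rightarrow> bool" where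
  "covers N v U \<longleftrightarrow> shift_module U \<and> \<not> U \<subseteq> multiples \<and>
     (\<forall>u\<in>U. \<exists>x. (\<lambda>i. u i - (\<Sum>l<N. const (x l) * v l i)) \<in> multiples)"

text \<open>The rows whose degree does not exceed that of \<open>P\<close> form a finite-dimensional space that is
  stable under the backward shifts.\<close>

lemma covers_exists:
  assumes "\<exists>i0<k. (\<lambda>i. delta i i0) \<notin> multiples"
  shows "\<exists>N v U. covers N v U"
proof -
  have "\<forall>l. \<exists>e. \<forall>i\<in>{..<k}. deg_le (P l i) e" by (auto intro: deg_le_ex_family)
  then obtain d where d: "\<And>l i. i < k \<Longrightarrow> deg_le (P l i) (d l)" by (metis lessThan_iff)
  define e where "e = sum d {..<k}"
  have e: "deg_le (P l i) e" if "l < k" "i < k" for l i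
    unfolding e_def by (rule deg_le_mono[OF d], rule that) (rule member_le_sum, use that in auto)
  define U where "U = {u :: nat \<Rightarrow> 'd nc_poly. \<forall>i<k. deg_le (u i) e}"
  have "shift_module U"
    unfolding shift_module_def
  proof (intro conjI ballI allI impI)
    fix u j assume u: "u \<in> U"
    have "deg_le (bshift j u i) e" if "i < k" for i
      unfolding bshift_def
    proof (intro deg_le_diff deg_le_sum deg_le_const_mult)
      show "deg_le (shift j (u i)) e"
        using u that by (intro deg_le_mono[OF deg_le_shift[of _ e]]) (auto simp: U_def)
      show "deg_le (shift j (P l i)) e" if "l \<in> {..<k}" for l
        using that \<open>i < k\<close> by (intro deg_le_mono[OF deg_le_shift[of _ e]]) (auto simp: e)
    qed
    then show "bshift j u \<in> U" by (simp add: U_def)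
  qed (auto simp: U_def intro: e deg_le_add deg_le_const_mult)
  moreover have "\<not> U \<subseteq> multiples"
  proof -
    obtain i0 where i0: "i0 < k" "(\<lambda>i. delta i i0) \<notin> multiples" using assms by blast
    have "(\<lambda>i. delta i i0) \<in> U"
      using deg_le_const[of 1 e] by (auto simp: U_def simp del: deg_le_const)
    with i0 show ?thesis by blast
  qed
  moreover
  define W where "W = {w :: 'd nc_word. length (letters w) \<le> e}"
  have W: "finite W" unfolding W_def by (rule finite_words_le)
  define N where "N = card ({..<k} \<times> W)"
  obtain h where h: "bij_betw h {..<N} ({..<k} \<times> W)"
    using ex_bij_betw_nat_finite[of "{..<k} \<times> W"] W by (auto simp: N_def atLeast0LessThan)
  define v :: "nat \<Rightarrow> nat \<Rightarrow> 'd nc_poly"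
    where "v l i = (if i = fst (h l) then Poly_Mapping.single (snd (h l)) 1 else 0)" for l i
  have "\<exists>x. (\<lambda>i. u i - (\<Sum>l<N. const (x l) * v l i)) \<in> multiples" if u: "u \<in> U" for u
  proof (intro exI[of _ "\<lambda>l. lookup (u (fst (h l))) (snd (h l))"] multiples_ext[OF multiples_zero])
    fix i assume i: "i < k"
    have "(\<Sum>l<N. const (lookup (u (fst (h l))) (snd (h l))) * v l i)
        = (\<Sum>(a, w)\<in>{..<k} \<times> W. const (lookup (u a) w) * (if i = a then Poly_Mapping.single w 1 else 0))"
      using sum.reindex_bij_betw[OF h, of "\<lambda>(a, w). const (lookup (u a) w) * (if i = a then Poly_Mapping.single w 1 else 0)"]
      by (simp add: v_def case_prod_unfold)
    also have "\<dots> = (\<Sum>a<k. \<Sum>w\<in>W. if a = i then Poly_Mapping.single w (lookup (u i) w) else 0)"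
      unfolding sum.cartesian_product[symmetric]
      by (intro sum.cong) (auto simp: const_def mult_single)
    also have "\<dots> = (\<Sum>a<k. if a = i then (\<Sum>w\<in>W. Poly_Mapping.single w (lookup (u i) w)) else 0)"
      by (intro sum.cong) auto
    also have "\<dots> = (\<Sum>w\<in>W. Poly_Mapping.single w (lookup (u i) w))"
      using i by simp
    also have "\<dots> = (\<Sum>w\<in>Poly_Mapping.keys (u i). Poly_Mapping.single w (lookup (u i) w))"
    proof (rule sum.mono_neutral_right[OF W])
      show "Poly_Mapping.keys (u i) \<subseteq> W"
        using u i by (auto simp: U_def W_def deg_le_def in_keys_iff) (meson not_le)
    qed (auto simp: in_keys_iff)
    also have "\<dots> = u i" by (rule nc_poly_sum_singles[symmetric])
    finally show "0 = u i - (\<Sum>l<N. const (lookup (u (fst (h l))) (snd (h l))) * v l i)" by simp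
  qed
  ultimately show ?thesis unfolding covers_def by blast
qed

text \<open>If the coordinates with respect to \<open>v\<close> can be chosen in the hyperplane orthogonal to \<open>y\<close>,
  where \<open>y l0 \<noteq> 0\<close>, then the \<open>N - 1\<close> vectors \<open>v\<^sub>l - (y\<^sub>l / y\<^bsub>l0\<^esub>) v\<^bsub>l0\<^esub>\<close> with \<open>l \<noteq> l0\<close> suffice.\<close>

lemma covers_hyperplane:
  assumes U: "shift_module U" "\<not> U \<subseteq> multiples"
    and y: "l0 < N" "y l0 \<noteq> 0"
    and x: "\<And>u. u \<in> U \<Longrightarrow> \<exists>x. (\<Sum>l<N. x l * y l) = 0 \<and> (\<lambda>i. u i - (\<Sum>l<N. const (x l) * v l i)) \<in> multiples"
  shows "\<exists>v'. covers (N - 1) v' U"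
proof -
  define \<sigma> where "\<sigma> l = (if l = l0 then N - 1 else l)" for l
  have \<sigma>: "bij_betw \<sigma> {..<N - 1} ({..<N} - {l0})"
    unfolding \<sigma>_def by (rule bij_betw_skip[OF y(1)])
  define v' where "v' l i = v (\<sigma> l) i - const (y (\<sigma> l) / y l0) * v l0 i" for l i
  have "\<exists>x'. (\<lambda>i. u i - (\<Sum>l<N - 1. const (x' l) * v' l i)) \<in> multiples" if "u \<in> U" for u
  proof -
    obtain x where xy: "(\<Sum>l<N. x l * y l) = 0"
      and xv: "(\<lambda>i. u i - (\<Sum>l<N. const (x l) * v l i)) \<in> multiples"
      using x[OF \<open>u \<in> U\<close>] by blast
    have xl0: "x l0 = - (\<Sum>l\<in>{..<N} - {l0}. x l * y l) / y l0"
      using xy y by (simp add: sum.remove[of _ l0] field_simps add_eq_0_iff)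
    have "(\<Sum>l<N - 1. const (x (\<sigma> l)) * v' l i) = (\<Sum>l<N. const (x l) * v l i)" for i
    proof -
      have "(\<Sum>l<N - 1. const (x (\<sigma> l)) * v' l i)
          = (\<Sum>l\<in>{..<N} - {l0}. const (x l) * (v l i - const (y l / y l0) * v l0 i))"
        unfolding v'_def
        by (rule sum.reindex_bij_betw[OF \<sigma>, of "\<lambda>l. const (x l) * (v l i - const (y l / y l0) * v l0 i)"])
      also have "\<dots> = (\<Sum>l\<in>{..<N} - {l0}. const (x l) * v l i) + const (x l0) * v l0 i"
        unfolding xl0
        by (simp add: right_diff_distrib sum_subtractf const_sum const_minus sum_divide_distrib
            sum_distrib_right sum_negf flip: mult.assoc const_mult)
      also have "\<dots> = (\<Sum>l<N. const (x l) * v l i)"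
        using y(1) by (subst (2) sum.remove[of _ l0]) auto
      finally show ?thesis .
    qed
    then show ?thesis using xv by (intro exI[of _ "\<lambda>l. x (\<sigma> l)"]) simp
  qed
  then show ?thesis using U unfolding covers_def by blast
qed

context
  fixes N v U
  assumes cov: "covers N v U"
    and minimal: "\<forall>N' v' U'. covers N' v' U' \<longrightarrow> N \<le> N'"
begin

definition comb :: "(nat \<Rightarrow> complex) \<Rightarrow> nat \<Rightarrow> 'd nc_poly" where
  "comb x i = (\<Sum>l<N. const (x l) * v l i)"

lemma comb_cong: "(\<And>l. l < N \<Longrightarrow> x l = y l) \<Longrightarrow> comb x = comb y"
  by (rule ext) (simp add: comb_def)

lemma comb_linear: "comb (\<lambda>l. x l + c * y l) i = comb x i + const c * comb y i"
  by (simp add: comb_def const_add const_mult distrib_right sum.distrib sum_distrib_left mult.assoc)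

lemma shift_module_U: "shift_module U" and U_not_multiples: "\<not> U \<subseteq> multiples"
  using cov by (auto simp: covers_def)

lemma U_comb: "u \<in> U \<Longrightarrow> \<exists>x. (\<lambda>i. u i - comb x i) \<in> multiples"
  using cov by (auto simp: covers_def comb_def)

text \<open>Minimality of \<open>N\<close> in the form in which it is used: it makes the \<open>v\<^sub>l\<close> a basis of the
  quotient of \<open>U\<close> (\<open>comb_in_U\<close>, \<open>comb_independent\<close>), and it excludes proper submodules
  (\<open>irreducible_A\<close>).\<close>

lemma no_hyperplane:
  assumes "shift_module U'" "\<not> U' \<subseteq> multiples"
    and "\<And>u. u \<in> U' \<Longrightarrow> \<exists>x. (\<Sum>l<N. x l * y l) = 0 \<and> (\<lambda>i. u i - comb x i) \<in> multiples"
    and "l < N"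
  shows "y l = 0"
proof (rule ccontr)
  assume "y l \<noteq> 0"
  from covers_hyperplane[where U = U' and ?l0.0 = l and N = N and y = y and v = v, OF assms(1,2,4) this] assms(3)
  obtain v' where "covers (N - 1) v' U'" unfolding comb_def by blast
  then have "N \<le> N - 1" using minimal by blast
  with \<open>l < N\<close> show False by simp
qed

lemma comb_in_U: "\<exists>u\<in>U. (\<lambda>i. u i - comb x i) \<in> multiples"
proof -
  define K where "K = {x. \<exists>u\<in>U. (\<lambda>i. u i - comb x i) \<in> multiples}"
  have "(\<forall>z. \<exists>x\<in>K. \<forall>j\<in>{..<N}. x j = z j) \<or>
         (\<exists>y. (\<exists>j\<in>{..<N}. y j \<noteq> 0) \<and> (\<forall>x\<in>K. (\<Sum>j<N. x j * y j) = 0))"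
  proof (rule subspace_full_or_annihilated)
    fix x y c assume "x \<in> K" "y \<in> K"
    then obtain u u' where u: "u \<in> U" "(\<lambda>i. u i - comb x i) \<in> multiples"
      "u' \<in> U" "(\<lambda>i. u' i - comb y i) \<in> multiples" by (auto simp: K_def)
    have "(\<lambda>i. u i + const c * u' i) \<in> U" using u shift_module_U by (auto simp: shift_module_def)
    moreover have "(\<lambda>i. (u i + const c * u' i) - comb (\<lambda>l. x l + c * y l) i) \<in> multiples"
      by (rule multiples_ext[OF multiples_add[OF u(2) multiples_mult[OF u(4), of "const c"]]])
        (simp add: comb_linear algebra_simps)
    ultimately show "(\<lambda>i. x i + c * y i) \<in> K"
      unfolding K_def mem_Collect_eq by (intro bexI)
  next
    have "(\<lambda>i. 0 - comb (\<lambda>_. 0) i) \<in> multiples" by (simp add: comb_def multiples_zero)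
    moreover have "(\<lambda>i. 0) \<in> U" using shift_module_U by (simp add: shift_module_def)
    ultimately show "\<exists>x. x \<in> K"
      unfolding K_def mem_Collect_eq by (intro exI[of _ "\<lambda>_. 0"] bexI)
  qed simp
  then show ?thesis
  proof
    assume "\<forall>z. \<exists>x\<in>K. \<forall>j\<in>{..<N}. x j = z j"
    then obtain x' where "x' \<in> K" "\<forall>j\<in>{..<N}. x' j = x j" by blast
    moreover from this have "comb x' = comb x" by (intro comb_cong) auto
    ultimately show ?thesis by (auto simp: K_def)
  next
    assume "\<exists>y. (\<exists>j\<in>{..<N}. y j \<noteq> 0) \<and> (\<forall>x\<in>K. (\<Sum>j<N. x j * y j) = 0)"
    then obtain y l where y: "l < N" "y l \<noteq> 0" "\<And>x. x \<in> K \<Longrightarrow> (\<Sum>j<N. x j * y j) = 0" by auto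
    have "y l = 0"
    proof (rule no_hyperplane[OF shift_module_U U_not_multiples _ y(1)])
      fix u assume u: "u \<in> U"
      obtain x where x: "(\<lambda>i. u i - comb x i) \<in> multiples" using U_comb[OF u] by blast
      then have "x \<in> K" using u by (auto simp: K_def)
      then show "\<exists>x. (\<Sum>l<N. x l * y l) = 0 \<and> (\<lambda>i. u i - comb x i) \<in> multiples" using x y(3) by blast
    qed
    with y(2) show ?thesis by simp
  qed
qed

lemma comb_independent:
  assumes x: "comb x \<in> multiples" and l: "l < N"
  shows "x l = 0"
proof (rule ccontr)
  assume xl: "x l \<noteq> 0"
  have "(\<lambda>m. if m = l then 1 else 0 :: complex) l = 0"
  proof (rule no_hyperplane[where y = "\<lambda>m. delta m l", OF shift_module_U U_not_multiples _ l])
    fix u assume "u \<in> U"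
    obtain x' where x': "(\<lambda>i. u i - comb x' i) \<in> multiples" using U_comb[OF \<open>u \<in> U\<close>] by blast
    define x'' where "x'' = (\<lambda>m. x' m + (- (x' l / x l)) * x m)"
    have "(\<lambda>i. u i - comb x'' i) \<in> multiples"
      unfolding x''_def comb_linear
      by (rule multiples_ext[OF multiples_add[OF x' multiples_mult[OF x, of "const (x' l / x l)"]]]) (simp add: const_minus)
    moreover have "x'' l = 0" using xl by (simp add: x''_def)
    then have "(\<Sum>m<N. x'' m * delta m l) = 0"
      by (intro sum.neutral) auto
    ultimately show "\<exists>x. (\<Sum>m<N. x m * delta m l) = 0 \<and> (\<lambda>i. u i - comb x i) \<in> multiples"
      by blast
  qed
  then show False by simp
qed

lemma bshift_comb: "bshift j (comb x) i = (\<Sum>l<N. const (x l) * bshift j (v l) i)"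
proof -
  have "bshift j (\<lambda>i. \<Sum>l<M. const (x l) * v l i) i = (\<Sum>l<M. const (x l) * bshift j (v l) i)" for M i
  proof (induction M arbitrary: i)
    case 0
    then show ?case by (simp add: bshift_def quot0_def)
  next
    case (Suc M)
    then show ?case by (simp add: bshift_linear)
  qed
  then show ?thesis by (simp add: comb_def[abs_def])
qed

lemma bshift_v_exists: "\<exists>A. \<forall>j l. l < N \<longrightarrow> (\<lambda>i. bshift j (v l) i - comb (A j l) i) \<in> multiples"
proof -
  have "\<exists>x'. (\<lambda>i. bshift j (v l) i - comb x' i) \<in> multiples" if l: "l < N" for j l
  proof -
    define x where "x m = (if m = l then 1 else 0 :: complex)" for m
    have cx: "comb x = v l"
      using l by (auto simp: comb_def x_def fun_eq_iff if_distrib[of const] if_distrib[of "\<lambda>c. c * _"] cong: if_cong)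
    obtain u where u: "u \<in> U" "(\<lambda>i. u i - comb x i) \<in> multiples" using comb_in_U by blast
    have "bshift j u \<in> U" using u shift_module_U by (auto simp: shift_module_def)
    then obtain x' where x': "(\<lambda>i. bshift j u i - comb x' i) \<in> multiples" using U_comb by blast
    have "(\<lambda>i. bshift j (v l) i - comb x' i) \<in> multiples"
      by (rule multiples_ext[OF multiples_diff[OF x' multiples_bshift[OF u(2), of j]]]) (simp add: bshift_diff cx)
    then show ?thesis by blast
  qed
  then have "\<forall>j l. \<exists>x'. l < N \<longrightarrow> (\<lambda>i. bshift j (v l) i - comb x' i) \<in> multiples" by blast
  then show ?thesis by metis
qed

context
  fixes A :: "'d tuple"
  assumes A: "\<forall>j l. l < N \<longrightarrow> (\<lambda>i. bshift j (v l) i - comb (A j l) i) \<in> multiples"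
begin

lemma bshift_comb_A: "(\<lambda>i. bshift j (comb x) i - comb (\<lambda>m. \<Sum>l<N. x l * A j l m) i) \<in> multiples"
proof (rule multiples_ext)
  show "(\<lambda>i. \<Sum>l<N. const (x l) * (bshift j (v l) i - comb (A j l) i)) \<in> multiples"
    by (rule multiples_sum) (use A in auto)
  fix i
  have "(\<Sum>l<N. const (x l) * comb (A j l) i) = comb (\<lambda>m. \<Sum>l<N. x l * A j l m) i"
    unfolding comb_def const_sum const_mult by (rule sum_mult_assoc[symmetric])
  then show "(\<Sum>l<N. const (x l) * (bshift j (v l) i - comb (A j l) i))
      = bshift j (comb x) i - comb (\<lambda>m. \<Sum>l<N. x l * A j l m) i"
    by (simp add: right_diff_distrib sum_subtractf bshift_comb)
qed

text \<open>If \<open>x A\<^sup>w y = 0\<close> for all words \<open>w\<close>, then the coordinate vectors orthogonal to all \<open>A\<^sup>w y\<close>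
  define a smaller shift module \<open>U'\<close>. It is not contained in the multiples of \<open>P\<close> because \<open>x \<noteq> 0\<close>,
  and its coordinates lie in the hyperplane orthogonal to \<open>y\<close>, against the minimality of \<open>N\<close>.\<close>

lemma irreducible_A: "irreducible_tuple N A"
  unfolding irreducible_tuple_def
proof (intro allI impI)
  fix x y :: "nat \<Rightarrow> complex"
  assume x: "\<exists>l<N. x l \<noteq> 0" and "\<exists>m<N. y m \<noteq> 0"
  then obtain m where m: "m < N" "y m \<noteq> 0" by blast
  show "\<exists>w. (\<Sum>l<N. x l * word_act N A w y l) \<noteq> 0"
  proof (rule ccontr)
    assume neg: "\<not> ?thesis"
    define K where "K = {x'. \<forall>w. (\<Sum>l<N. x' l * word_act N A w y l) = 0}"
    have xK: "x \<in> K" using neg by (auto simp: K_def)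
    have K_lin: "(\<lambda>l. a l + c * b l) \<in> K" if "a \<in> K" "b \<in> K" for a b c
    proof -
      have "(\<Sum>l<N. (a l + c * b l) * g l) = (\<Sum>l<N. a l * g l) + c * (\<Sum>l<N. b l * g l)" for g
        by (simp add: distrib_right sum.distrib sum_distrib_left mult.assoc)
      then show ?thesis using that by (simp add: K_def)
    qed
    have K_inv: "(\<lambda>m. \<Sum>l<N. x' l * A j l m) \<in> K" if "x' \<in> K" for x' j
    proof -
      have "(\<Sum>m<N. (\<Sum>l<N. x' l * A j l m) * word_act N A w y m) = (\<Sum>l<N. x' l * word_act N A (j # w) y l)" for w
        by (simp add: sum_mult_assoc)
      then show ?thesis using that unfolding K_def mem_Collect_eq by metis
    qed
    define U' where "U' = {u \<in> U. \<exists>x'\<in>K. (\<lambda>i. u i - comb x' i) \<in> multiples}"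
    have K0: "(\<lambda>_. 0) \<in> K" by (simp add: K_def)
    have comb0: "comb (\<lambda>_. 0) i = 0" for i by (simp add: comb_def)
    have "shift_module U'"
      unfolding shift_module_def
    proof (intro conjI ballI allI impI)
      show "(\<lambda>i. 0) \<in> U'"
        unfolding U'_def using shift_module_U
        by (auto simp: shift_module_def intro!: bexI[OF _ K0] simp: comb0 multiples_zero)
    next
      fix l assume "l < k"
      then show "P l \<in> U'"
        unfolding U'_def using shift_module_U
        by (auto simp: shift_module_def intro!: bexI[OF _ K0] simp: comb0 intro: multiples_row)
    next
      fix u u' c assume "u \<in> U'" "u' \<in> U'"
      then obtain a b where ab: "u \<in> U" "u' \<in> U" "a \<in> K" "b \<in> K"
        "(\<lambda>i. u i - comb a i) \<in> multiples" "(\<lambda>i. u' i - comb b i) \<in> multiples" by (auto simp: U'_def)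
      have "(\<lambda>i. (u i + const c * u' i) - comb (\<lambda>l. a l + c * b l) i) \<in> multiples"
        by (rule multiples_ext[OF multiples_add[OF ab(5) multiples_mult[OF ab(6), of "const c"]]])
          (simp add: comb_linear algebra_simps)
      moreover have "(\<lambda>i. u i + const c * u' i) \<in> U"
        using shift_module_U ab by (auto simp: shift_module_def)
      ultimately show "(\<lambda>i. u i + const c * u' i) \<in> U'"
        unfolding U'_def using K_lin[OF ab(3,4), of c] by blast
    next
      fix u j assume "u \<in> U'"
      then obtain a where a: "u \<in> U" "a \<in> K" "(\<lambda>i. u i - comb a i) \<in> multiples" by (auto simp: U'_def)
      have "(\<lambda>i. bshift j u i - comb (\<lambda>m. \<Sum>l<N. a l * A j l m) i) \<in> multiples"
        by (rule multiples_ext[OF multiples_add[OF multiples_bshift[OF a(3), of j] bshift_comb_A[of j a]]])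
          (simp add: bshift_diff)
      moreover have "bshift j u \<in> U" using shift_module_U a by (auto simp: shift_module_def)
      ultimately show "bshift j u \<in> U'" unfolding U'_def using K_inv[OF a(2), of j] by blast
    qed
    moreover have "\<not> U' \<subseteq> multiples"
    proof
      assume sub: "U' \<subseteq> multiples"
      obtain u where u: "u \<in> U" "(\<lambda>i. u i - comb x i) \<in> multiples" using comb_in_U by blast
      then have "u \<in> multiples" using sub xK by (auto simp: U'_def)
      then have "comb x \<in> multiples" using multiples_diff[OF _ u(2), of u] by simp
      then show False using comb_independent x by blast
    qed
    ultimately have "y m = 0"
    proof (rule no_hyperplane)
      fix u assume "u \<in> U'"
      then obtain a where a: "a \<in> K" "(\<lambda>i. u i - comb a i) \<in> multiples" by (auto simp: U'_def)
      have "(\<Sum>l<N. a l * word_act N A [] y l) = 0" using a(1) unfolding K_def by blast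
      then show "\<exists>x. (\<Sum>l<N. x l * y l) = 0 \<and> (\<lambda>i. u i - comb x i) \<in> multiples"
        using a(2) by auto
    qed (rule m)
    with m show False by simp
  qed
qed

lemma pencil_v:
  assumes l: "l < N"
  shows "(\<lambda>i. v l i - mprod N (lin_entry A) v l i) \<in> multiples"
proof (rule multiples_ext)
  show "(\<lambda>i. (\<Sum>t<k. const (quot0 (v l) t) * P t i)
      + (\<Sum>j\<in>UNIV. var j * (bshift j (v l) i - comb (A j l) i))) \<in> multiples"
    by (intro multiples_add multiples_combination multiples_sum A[rule_format] l)
  fix i assume i: "i < k"
  have "(\<Sum>j\<in>UNIV. var j * comb (A j l) i) = mprod N (lin_entry A) v l i"
    unfolding comb_def lin_entry_def by (rule sum_mult_assoc[symmetric])
  then show "(\<Sum>t<k. const (quot0 (v l) t) * P t i) + (\<Sum>j\<in>UNIV. var j * (bshift j (v l) i - comb (A j l) i))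
      = v l i - mprod N (lin_entry A) v l i"
    using row_split[OF i, of "v l"] by (simp add: right_diff_distrib sum_subtractf algebra_simps)
qed

text \<open>The map \<open>x \<mapsto> x v\<close> induces an injection of \<open>R\<^bsup>1 \<times> N\<^esup> / R\<^bsup>1 \<times> N\<^esup> (1 - L)\<close> into
  \<open>R\<^bsup>1 \<times> k\<^esup> / R\<^bsup>1 \<times> k\<^esup> P\<close>. Modulo the multiples of \<open>1 - L\<close>, a row \<open>x\<close> is congruent to \<open>\<Sum>\<^sub>j Z\<^sub>j y\<^sub>j\<close>,
  where \<open>y\<^sub>j = x(0) A\<^sub>j + shift j x\<close> has smaller degree than \<open>x\<close>; and every \<open>y\<^sub>j v\<close> is again a
  multiple of \<open>P\<close>. A constant \<open>x\<close> vanishes by \<open>comb_independent\<close>.\<close>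

lemma kernel_of_v_deg_le:
  assumes "\<And>l. l < N \<Longrightarrow> deg_le (x l) e" and "(\<lambda>i. \<Sum>l<N. x l * v l i) \<in> multiples"
  shows "\<exists>c. \<forall>m<N. x m = c m - (\<Sum>l<N. c l * lin_entry A l m)"
  using assms
proof (induction e arbitrary: x)
  case 0
  have x: "x l = const (coeff0 (x l))" if "l < N" for l
    using nc_poly_split[of "x l"] 0(1)[OF that] by (simp add: deg_le_0_shift)
  have "comb (\<lambda>l. coeff0 (x l)) \<in> multiples"
    by (rule multiples_ext[OF 0(2)]) (simp add: comb_def x[symmetric])
  then have "coeff0 (x l) = 0" if "l < N" for l by (rule comb_independent[OF _ that])
  then have "x l = 0" if "l < N" for l using x[OF that] that by simp
  then show ?case by (intro exI[of _ "\<lambda>_. 0"]) simp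
next
  case (Suc e)
  define y where "y j m = const (\<Sum>l<N. coeff0 (x l) * A j l m) + shift j (x m)" for j m
  have xy: "x m = const (coeff0 (x m)) - (\<Sum>l<N. const (coeff0 (x l)) * lin_entry A l m) + (\<Sum>j\<in>UNIV. var j * y j m)" for m
  proof -
    have "(\<Sum>l<N. const (coeff0 (x l)) * lin_entry A l m) = (\<Sum>j\<in>UNIV. var j * const (\<Sum>l<N. coeff0 (x l) * A j l m))"
      unfolding lin_entry_def const_sum sum_distrib_left
      by (subst sum.swap) (simp add: const_var_commute const_mult)
    then show ?thesis
      using nc_poly_split[of "x m"] by (simp add: y_def distrib_left sum.distrib)
  qed
  have "(\<lambda>i. \<Sum>l<N. y j l * v l i) \<in> multiples" for j
  proof (rule multiples_var_sum, rule multiples_ext)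
    show "(\<lambda>i. (\<Sum>l<N. x l * v l i) - (\<Sum>l<N. const (coeff0 (x l)) * (v l i - mprod N (lin_entry A) v l i))) \<in> multiples"
      by (intro multiples_diff Suc.prems(2) multiples_sum pencil_v) auto
    fix i
    have "(\<Sum>l<N. x l * v l i) = (\<Sum>l<N. const (coeff0 (x l)) * v l i)
       - (\<Sum>m<N. (\<Sum>l<N. const (coeff0 (x l)) * lin_entry A l m) * v m i)
       + (\<Sum>m<N. (\<Sum>j\<in>UNIV. var j * y j m) * v m i)"
      by (subst xy) (simp add: distrib_right left_diff_distrib sum.distrib sum_subtractf)
    then show "(\<Sum>l<N. x l * v l i) - (\<Sum>l<N. const (coeff0 (x l)) * (v l i - mprod N (lin_entry A) v l i))
       = (\<Sum>j\<in>UNIV. var j * (mprod N y v j i))"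
      by (simp add: sum_mult_assoc right_diff_distrib sum_subtractf)
  qed
  moreover have "deg_le (y j l) e" if "l < N" for j l
    unfolding y_def using Suc.prems(1)[OF that] deg_le_shift[of "x l" "Suc e" j] by (intro deg_le_add) auto
  ultimately have "\<forall>j. \<exists>c. \<forall>m<N. y j m = c m - (\<Sum>l<N. c l * lin_entry A l m)"
    using Suc.IH by blast
  then obtain c where c: "\<And>j m. m < N \<Longrightarrow> y j m = c j m - mprod N c (lin_entry A) j m" by metis
  define b where "b m = const (coeff0 (x m)) + (\<Sum>j\<in>UNIV. var j * c j m)" for m
  have "x m = b m - (\<Sum>l<N. b l * lin_entry A l m)" if "m < N" for m
    by (subst xy) (simp add: c[OF that] b_def right_diff_distrib distrib_right sum.distrib
        sum_subtractf sum_mult_assoc)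
  then show ?case by blast
qed

lemma kernel_of_v:
  assumes "(\<lambda>i. \<Sum>l<N. x l * v l i) \<in> multiples"
  shows "\<exists>c. \<forall>m<N. x m = c m - (\<Sum>l<N. c l * lin_entry A l m)"
  using kernel_of_v_deg_le[OF _ assms] deg_le_ex_family[of "{..<N}" x] by auto

end

end

text \<open>The second alternative is stable association of \<open>P\<close> and \<open>1 - L\<close>, with \<open>L\<close> the matrix
  \<open>lin_entry A\<close>: \<open>(1 - L) v = H P\<close>, \<open>a v + b P = 1\<close>, \<open>v a + c (1 - L) = 1\<close> and \<open>P a = e (1 - L)\<close>.
  The first alternative is the case of an invertible \<open>P\<close>, for which all rows are multiples of \<open>P\<close>.
  The last two identities come from the injectivity in \<open>kernel_of_v\<close>, since \<open>(1 - v a) v = v b P\<close>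
  and \<open>P a v = (1 - P b) P\<close>.\<close>

theorem stable_association:
  "(\<exists>q. \<forall>i<k. \<forall>m<k. mprod k q P i m = delta i m) \<or>
   (\<exists>N A v H a b c e. irreducible_tuple N A
     \<and> (\<forall>i<N. \<forall>m<k. v i m = mprod k H P i m + mprod N (lin_entry A) v i m)
     \<and> (\<forall>i<k. \<forall>m<k. mprod N a v i m + mprod k b P i m = delta i m)
     \<and> (\<forall>i<N. \<forall>m<N. mprod k v a i m + (c i m - mprod N c (lin_entry A) i m) = delta i m)
     \<and> (\<forall>i<k. \<forall>m<N. mprod k P a i m = e i m - mprod N e (lin_entry A) i m))"
proof (cases "\<exists>i0<k. (\<lambda>i. delta i i0) \<notin> multiples")
  case False
  then have "\<forall>i0. \<exists>q. i0 < k \<longrightarrow> (\<forall>i<k. delta i i0 = (\<Sum>l<k. q l * P l i))"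
    by (auto simp: multiples_def)
  then obtain q where q: "\<And>i0 i. i0 < k \<Longrightarrow> i < k \<Longrightarrow> (delta i i0) = mprod k q P i0 i"
    by metis
  show ?thesis
    by (intro disjI1 exI[of _ q]) (auto simp: q[symmetric])
next
  case True
  define N where "N = (LEAST N. \<exists>v U. covers N v U)"
  have "\<exists>v U. covers N v U" unfolding N_def by (rule LeastI_ex) (rule covers_exists[OF True])
  then obtain v U where cov: "covers N v U" by blast
  have minimal: "\<forall>N' v' U'. covers N' v' U' \<longrightarrow> N \<le> N'"
    unfolding N_def by (auto intro!: Least_le)
  note mini = cov minimal
  obtain A where A: "\<forall>j l. l < N \<longrightarrow> (\<lambda>i. bshift j (v l) i - comb N v (A j l) i) \<in> multiples"
    using bshift_v_exists[OF mini] by blast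
  note kernel = kernel_of_v[OF mini A]
  have irr: "irreducible_tuple N A" by (rule irreducible_A[OF mini A])
  have "\<forall>i. \<exists>H. i < N \<longrightarrow> (\<forall>m<k. v i m - mprod N (lin_entry A) v i m = (\<Sum>l<k. H l * P l m))"
    using pencil_v[OF mini A] by (auto simp: multiples_def)
  from choice[OF this] obtain H where
    "\<forall>i. i < N \<longrightarrow> (\<forall>m<k. v i m - mprod N (lin_entry A) v i m = mprod k H P i m)"
    by blast
  note H = this[rule_format]
  obtain T g where T: "\<And>t. t < k \<Longrightarrow> T t \<in> U"
    and g: "\<And>i m. i < k \<Longrightarrow> m < k \<Longrightarrow> (mprod k g T i m) = delta i m"
    using shift_module_dichotomy[OF shift_module_U[OF mini]] U_not_multiples[OF mini] by blast
  have "\<forall>t. \<exists>x q. t < k \<longrightarrow> (\<forall>m<k. T t m - comb N v x m = (\<Sum>s<k. q s * P s m))"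
    using U_comb[OF mini T] by (auto simp: multiples_def)
  from choice[OF this] obtain x where
    "\<forall>t. \<exists>q. t < k \<longrightarrow> (\<forall>m<k. T t m - comb N v (x t) m = (\<Sum>s<k. q s * P s m))" by blast
  from choice[OF this] obtain q where
    "\<forall>t. t < k \<longrightarrow> (\<forall>m<k. T t m - comb N v (x t) m = mprod k q P t m)" by blast
  note xq = this[rule_format]
  define a where "a i l = (\<Sum>t<k. g i t * const (x t l))" for i l
  define b where "b i s = mprod k g q i s" for i s
  have ab: "mprod N a v i m + mprod k b P i m = delta i m"
    if "i < k" "m < k" for i m
  proof -
    have "mprod N a v i m + mprod k b P i m
        = (\<Sum>t<k. g i t * (comb N v (x t) m + mprod k q P t m))"
      unfolding a_def b_def sum_mult_assoc comb_def[OF mini] by (simp add: distrib_left sum.distrib)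
    also have "\<dots> = mprod k g T i m"
      using that by (intro sum.cong) (auto simp: xq[symmetric])
    finally show ?thesis using g that by simp
  qed
  have ab': "mprod N a v i m = delta i m - mprod k b P i m"
    if "i < k" "m < k" for i m
    using ab[OF that] by (simp add: algebra_simps)
  have "\<exists>c. \<forall>m<N. delta i m - mprod k v a i m = c m - (\<Sum>l<N. c l * lin_entry A l m)"
    if i: "i < N" for i
  proof (rule kernel, rule multiples_ext)
    show "(\<lambda>m. \<Sum>l<k. mprod k v b i l * P l m) \<in> multiples" by (rule multiples_combination)
    fix m assume m: "m < k"
    have "(\<Sum>l<N. (delta i l - mprod k v a i l) * v l m)
        = v i m - (\<Sum>s<k. v i s * (mprod N a v s m))"
      using i by (simp add: left_diff_distrib sum_subtractf sum_mult_assoc if_distrib[of "\<lambda>c. c * _"] cong: if_cong)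
    also have "(\<Sum>s<k. v i s * (mprod N a v s m)) =
        (\<Sum>s<k. v i s * (delta s m - mprod k b P s m))"
      using m by (intro sum.cong) (auto simp: ab')
    also have "\<dots> = v i m - (\<Sum>s<k. v i s * (mprod k b P s m))"
      using m by (simp add: right_diff_distrib sum_subtractf if_distrib[of "\<lambda>c. _ * c"] cong: if_cong)
    finally show "(\<Sum>l<k. mprod k v b i l * P l m) = (\<Sum>l<N. (delta i l - mprod k v a i l) * v l m)"
      by (simp add: sum_mult_assoc)
  qed
  then have "\<forall>i. \<exists>c. i < N \<longrightarrow> (\<forall>m<N. delta i m - mprod k v a i m = c m - (\<Sum>l<N. c l * lin_entry A l m))"
    by blast
  from choice[OF this] obtain c where "\<forall>i. i < N \<longrightarrow>
      (\<forall>m<N. delta i m - mprod k v a i m = c i m - mprod N c (lin_entry A) i m)"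
    by blast
  note c = this[rule_format]
  have "\<exists>e. \<forall>m<N. mprod k P a i m = e m - (\<Sum>l<N. e l * lin_entry A l m)"
    if i: "i < k" for i
  proof (rule kernel, rule multiples_ext)
    show "(\<lambda>m. \<Sum>l<k. (delta i l - mprod k P b i l) * P l m) \<in> multiples"
      by (rule multiples_combination)
    fix m assume m: "m < k"
    have "(\<Sum>l<N. mprod k P a i l * v l m) = (\<Sum>s<k. P i s * (mprod N a v s m))"
      by (rule sum_mult_assoc)
    also have "\<dots> = (\<Sum>s<k. P i s * (delta s m - mprod k b P s m))"
      using m by (intro sum.cong) (auto simp: ab')
    also have "\<dots> = P i m - (\<Sum>s<k. P i s * (mprod k b P s m))"
      using m by (simp add: right_diff_distrib sum_subtractf if_distrib[of "\<lambda>c. _ * c"] cong: if_cong)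
    also have "\<dots> = (\<Sum>l<k. (delta i l - mprod k P b i l) * P l m)"
      using i by (simp add: left_diff_distrib sum_subtractf sum_mult_assoc if_distrib[of "\<lambda>c. c * _"] cong: if_cong)
    finally show "(\<Sum>l<k. (delta i l - mprod k P b i l) * P l m)
        = (\<Sum>l<N. mprod k P a i l * v l m)" by simp
  qed
  then have "\<forall>i. \<exists>e. i < k \<longrightarrow> (\<forall>m<N. mprod k P a i m = e m - (\<Sum>l<N. e l * lin_entry A l m))" by blast
  from choice[OF this] obtain e where "\<forall>i. i < k \<longrightarrow>
      (\<forall>m<N. mprod k P a i m = e i m - mprod N e (lin_entry A) i m)" by blast
  note e = this[rule_format]
  show ?thesis
  proof (rule disjI2, intro exI conjI allI impI)
    show "irreducible_tuple N A" by (rule irr)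
    show "v i m = mprod k H P i m + mprod N (lin_entry A) v i m" if "i < N" "m < k" for i m
      using H[OF that] by (simp add: algebra_simps)
    show "mprod N a v i m + mprod k b P i m = delta i m"
      if "i < k" "m < k" for i m by (rule ab[OF that])
    show "mprod k v a i m + (c i m - mprod N c (lin_entry A) i m) = delta i m"
      if "i < N" "m < N" for i m using c[OF that] by (simp add: algebra_simps)
    show "mprod k P a i m = e i m - mprod N e (lin_entry A) i m"
      if "i < k" "m < N" for i m by (rule e[OF that])
  qed
qed

end

section \<open>Operator balls\<close>

definition norm2 :: "nat \<Rightarrow> (nat \<Rightarrow> 'a::real_normed_vector) \<Rightarrow> real" where
  "norm2 n h = L2_set (\<lambda>a. norm (h a)) {..<n}"

lemma norm2_nonneg [simp]: "0 \<le> norm2 n h" by (simp add: norm2_def L2_set_nonneg)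

lemma norm2_cong: "(\<And>a. a < n \<Longrightarrow> h a = h' a) \<Longrightarrow> norm2 n h = norm2 n h'"
  unfolding norm2_def by (intro L2_set_cong) auto

lemma norm2_mono: "(\<And>a. a < n \<Longrightarrow> norm (h a) \<le> norm (h' a)) \<Longrightarrow> norm2 n h \<le> norm2 n h'"
  unfolding norm2_def by (intro L2_set_mono) auto

lemma norm2_triangle: "norm2 n (\<lambda>a. h a + h' a) \<le> norm2 n h + norm2 n h'"
proof -
  have "norm2 n (\<lambda>a. h a + h' a) \<le> L2_set (\<lambda>a. norm (h a) + norm (h' a)) {..<n}"
    unfolding norm2_def by (intro L2_set_mono norm_triangle_ineq) auto
  also have "\<dots> \<le> norm2 n h + norm2 n h'" unfolding norm2_def by (rule L2_set_triangle_ineq)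
  finally show ?thesis .
qed

lemma norm2_le_scale: "(\<And>a. a < n \<Longrightarrow> norm (h a) \<le> c * norm (h' a)) \<Longrightarrow> 0 \<le> c \<Longrightarrow> norm2 n h \<le> c * norm2 n h'"
  unfolding norm2_def by (subst L2_set_right_distrib) (auto intro!: L2_set_mono)

lemma norm2_mult: "norm2 n (\<lambda>a. (c :: complex) * h a) = cmod c * norm2 n h"
  unfolding norm2_def by (subst L2_set_right_distrib) (auto simp: norm_mult)

lemma norm2_zero [simp]: "norm2 n (\<lambda>a. 0) = 0" by (simp add: norm2_def L2_set_def)

lemma norm2_eq_0_iff: "norm2 n h = 0 \<longleftrightarrow> (\<forall>a<n. h a = 0)"
  unfolding norm2_def by (subst L2_set_eq_0_iff) auto

lemma norm2_sum: "norm2 n (\<lambda>a. \<Sum>i\<in>S. f i a) \<le> (\<Sum>i\<in>S. norm2 n (f i))"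
proof (induction S rule: infinite_finite_induct)
  case (insert i S)
  then show ?case using norm2_triangle[of n "f i" "\<lambda>a. \<Sum>i\<in>S. f i a"] by simp
qed auto

lemma norm2_member: "a < n \<Longrightarrow> norm (h a) \<le> norm2 n h"
  unfolding norm2_def by (rule member_le_L2_set) auto

lemma norm2_inner_le: "(\<Sum>c<n. norm (g c) * norm (h c)) \<le> norm2 n g * norm2 n h"
  using L2_set_mult_ineq[of "\<lambda>c. norm (g c)" "\<lambda>c. norm (h c)" "{..<n}"] by (simp add: norm2_def)

text \<open>Tested with \<open>g = v / \<parallel>v\<parallel>\<close>.\<close>

lemma norm2_le_dual:
  fixes v :: "nat \<Rightarrow> complex"
  assumes "\<And>g :: nat \<Rightarrow> complex. norm2 n g \<le> 1 \<Longrightarrow> cmod (\<Sum>c<n. cnj (g c) * v c) \<le> M" "0 \<le> M"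
  shows "norm2 n v \<le> M"
proof (cases "norm2 n v = 0")
  case False
  define s where "s = norm2 n v"
  have s: "s > 0" using False norm2_nonneg[of n v] unfolding s_def by linarith
  define g where "g c = complex_of_real (1 / s) * v c" for c
  have "norm2 n g = cmod (complex_of_real (1 / s)) * s" unfolding g_def s_def by (rule norm2_mult)
  then have "norm2 n g \<le> 1" using s by (simp add: norm_divide)
  moreover have "(\<Sum>c<n. cnj (g c) * v c) = complex_of_real s"
  proof -
    have "v c * cnj (v c) = (complex_of_real (cmod (v c)))\<^sup>2" for c
      using complex_norm_square[of "v c"] by simp
    then have "(\<Sum>c<n. cnj (g c) * v c) = (\<Sum>c<n. complex_of_real (1 / s * (cmod (v c))\<^sup>2))"
      by (intro sum.cong refl) (simp add: g_def mult_ac)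
    also have "\<dots> = complex_of_real (1 / s * s\<^sup>2)"
      by (simp add: s_def norm2_def L2_set_def sum_nonneg sum_divide_distrib)
    finally show ?thesis using s by (simp add: power2_eq_square)
  qed
  ultimately show ?thesis using assms(1)[of g] s by (simp add: s_def)
qed (use assms in simp)

lemma scaleC_zero_left [simp]: "0 *\<^sub>C x = 0"
  using scaleC_add_left[of 0 0 x] by simp

lemma scaleC_zero_right [simp]: "c *\<^sub>C 0 = 0"
  using scaleC_add_right[of c 0 0] by simp

lemma scaleC_sum_right: "c *\<^sub>C (\<Sum>i\<in>S. f i) = (\<Sum>i\<in>S. c *\<^sub>C f i)"
  by (induction S rule: infinite_finite_induct) (auto simp: scaleC_add_right)

lemma scaleC_sum_left: "(\<Sum>i\<in>S. f i) *\<^sub>C x = (\<Sum>i\<in>S. f i *\<^sub>C x)"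
  by (induction S rule: infinite_finite_induct) (auto simp: scaleC_add_left)

lemma cinner_zero_left [simp]: "cinner 0 y = 0"
  using cinner_scaleC_left[of 0 0 y] by simp

lemma cinner_sum_left: "cinner (\<Sum>i\<in>S. f i) y = (\<Sum>i\<in>S. cinner (f i) y)"
  by (induction S rule: infinite_finite_induct) (auto simp: cinner_add_left)

lemma cinner_scaleC_right: "cinner x (c *\<^sub>C y) = cnj c * cinner x y"
  by (metis cinner_commute cinner_scaleC_left complex_cnj_mult)

lemma cinner_add_right: "cinner x (y + z) = cinner x y + cinner x z"
  by (metis cinner_commute cinner_add_left complex_cnj_add)

lemma cinner_self: "cinner x x = complex_of_real ((norm x)\<^sup>2)"
proof -
  have "cnj (cinner x x) = cinner x x" by (metis cinner_commute)
  then have "Im (cinner x x) = 0" by (metis complex_cnj_zero_iff cnj.sel(2) neg_equal_zero)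
  then show ?thesis
    by (intro complex_eqI) (auto simp: norm_eq_sqrt_cinner cinner_nonneg)
qed

lemma norm_scaleC: "norm (c *\<^sub>C x) = cmod c * norm x"
proof -
  have "cinner (c *\<^sub>C x) (c *\<^sub>C x) = (c * cnj c) * cinner x x"
    by (simp add: cinner_scaleC_left cinner_scaleC_right)
  also have "\<dots> = complex_of_real ((cmod c * norm x)\<^sup>2)"
    unfolding cinner_self by (simp add: complex_mult_cnj cmod_power2 power_mult_distrib)
  finally have "(norm (c *\<^sub>C x))\<^sup>2 = (cmod c * norm x)\<^sup>2"
    unfolding cinner_self of_real_eq_iff .
  then show ?thesis by (rule power2_eq_imp_eq) auto
qed

text \<open>Positivity of \<open>\<parallel>x + a y\<parallel>\<^sup>2\<close> at its minimum \<open>a = - \<langle>x, y\<rangle> / \<parallel>y\<parallel>\<^sup>2\<close>.\<close>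

lemma cinner_Cauchy_Schwarz: "cmod (cinner x y) \<le> norm x * norm y"
proof (cases "y = 0")
  case True
  have "cinner x 0 = 0" using cinner_commute[of x 0] by simp
  then show ?thesis using True by simp
next
  case False
  define s where "s = (norm y)\<^sup>2"
  have s: "s > 0" using False by (simp add: s_def)
  define t where "t = cinner x y"
  define a where "a = - t / complex_of_real s"
  have yx: "cinner y x = cnj t" unfolding t_def by (rule cinner_commute)
  have "cinner (x + a *\<^sub>C y) (x + a *\<^sub>C y)
      = cinner x x + cnj a * t + a * cnj t + a * cnj a * cinner y y"
    by (simp add: cinner_add_left cinner_add_right cinner_scaleC_left cinner_scaleC_right yx
        algebra_simps flip: t_def)
  also have "\<dots> = complex_of_real ((norm x)\<^sup>2) - t * cnj t / complex_of_real s"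
    unfolding cinner_self s_def[symmetric] using s by (simp add: a_def field_simps)
  also have "\<dots> = complex_of_real ((norm x)\<^sup>2 - (cmod t)\<^sup>2 / s)"
    by (simp only: complex_norm_square of_real_diff of_real_divide)
  finally have "0 \<le> (norm x)\<^sup>2 - (cmod t)\<^sup>2 / s"
    using cinner_nonneg[of "x + a *\<^sub>C y"] by simp
  then have "(cmod t)\<^sup>2 \<le> (norm x * norm y)\<^sup>2"
    using s by (simp add: field_simps s_def)
  then show ?thesis unfolding t_def by (rule power2_le_imp_le) simp
qed

definition pencil_fun :: "('d::finite \<Rightarrow> 'h \<Rightarrow> 'h::complex_hilbert_space) \<Rightarrow> nat \<Rightarrow>
    'd tuple \<Rightarrow> (nat \<Rightarrow> 'h) \<Rightarrow> nat \<Rightarrow> 'h" where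
  "pencil_fun Q n X \<xi> a = (\<Sum>j\<in>UNIV. \<Sum>b<n. X j a b *\<^sub>C Q j (\<xi> b))"

text \<open>Membership in the closed operator ball. The cyclic block matrices and compressions that
  are constructed below stay in the closed ball; \<open>ball_of_contractive\<close> leads back to the open one.\<close>

definition contractive :: "('d::finite \<Rightarrow> 'h \<Rightarrow> 'h::complex_hilbert_space) \<Rightarrow> nat \<Rightarrow>
    'd tuple \<Rightarrow> bool" where
  "contractive Q n X \<longleftrightarrow> (\<forall>\<xi>. norm2 n (pencil_fun Q n X \<xi>) \<le> norm2 n \<xi>)"

lemma pencil_eq_pencil_fun:
  assumes "\<And>j. X j \<in> carrier_mat n n"
  shows "pencil Q X \<xi> a = pencil_fun Q n (\<lambda>j a b. X j $$ (a, b)) \<xi> a"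
proof -
  have "dim_col (X j) = n" for j using assms by auto
  then show ?thesis by (simp add: pencil_def tensor_op_def pencil_fun_def)
qed

locale bounded_tuple =
  fixes Q :: "'d::finite \<Rightarrow> 'h \<Rightarrow> 'h::complex_hilbert_space"
  assumes bounded_Q: "\<And>j. bounded_clinear (Q j)"
begin

lemma Q_scaleC: "Q j (c *\<^sub>C x) = c *\<^sub>C Q j x"
  using bounded_Q[of j] by (simp add: bounded_clinear_def)

lemma bound_Q: "\<exists>K>0. \<forall>j x. norm (Q j x) \<le> K * norm x"
proof -
  have "\<forall>j. \<exists>K>0. \<forall>x. norm (Q j x) \<le> norm x * K"
    using bounded_Q by (auto simp: bounded_clinear_def intro: bounded_linear.pos_bounded)
  from choice[OF this] obtain K where K: "\<And>j. K j > 0" "\<And>j x. norm (Q j x) \<le> norm x * K j" by blast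
  have "norm (Q j x) \<le> (\<Sum>j\<in>UNIV. K j) * norm x" for j x
  proof -
    have "K j \<le> (\<Sum>j\<in>UNIV. K j)" using K(1) by (intro member_le_sum) (auto intro: less_imp_le)
    then show ?thesis using K(2)[of j x] by (metis mult.commute mult_right_mono norm_ge_zero order_trans)
  qed
  moreover have "(\<Sum>j\<in>UNIV. K j) > 0" by (rule sum_pos) (auto simp: K)
  ultimately show ?thesis by blast
qed

lemma pencil_fun_scaleC: "pencil_fun Q n X (\<lambda>b. c *\<^sub>C \<xi> b) a = c *\<^sub>C pencil_fun Q n X \<xi> a"
  by (simp add: pencil_fun_def scaleC_sum_right Q_scaleC scaleC_scaleC mult.commute)

lemma pencil_fun_mult: "pencil_fun Q n (\<lambda>j a b. c * X j a b) \<xi> a = c *\<^sub>C pencil_fun Q n X \<xi> a"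
  by (simp add: pencil_fun_def scaleC_sum_right scaleC_scaleC)

lemma norm2_scaleC: "norm2 n (\<lambda>b. c *\<^sub>C (\<xi> b :: 'h)) = cmod c * norm2 n \<xi>"
  unfolding norm2_def by (subst L2_set_right_distrib) (auto simp: norm_scaleC)

lemma contractive_of_ball:
  assumes "(n, X) \<in> nc_ball Q"
  shows "0 < n" "\<And>j. X j \<in> carrier_mat n n" "contractive Q n (\<lambda>j a b. X j $$ (a, b))"
proof -
  show n: "0 < n" and X: "\<And>j. X j \<in> carrier_mat n n"
    using assms by (auto simp: nc_ball_def nc_universe_def)
  define Y where "Y j a b = X j $$ (a, b)" for j a b
  have lt1: "tensor_norm n (pencil Q X) < 1" using assms by (simp add: nc_ball_def)
  have pencil_fun: "pencil Q X \<xi> = pencil_fun Q n Y \<xi>" for \<xi>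
    using pencil_eq_pencil_fun[of X, OF X] by (auto simp: Y_def[abs_def])
  obtain K where K: "K > 0" "\<And>j x. norm (Q j x) \<le> K * norm x" using bound_Q by blast
  define B where "B = (\<Sum>a<n. \<Sum>j\<in>UNIV. \<Sum>b<n. cmod (Y j a b) * K)"
  have bound: "norm2 n (pencil_fun Q n Y \<xi>) \<le> B" if "norm2 n \<xi> \<le> 1" for \<xi>
  proof -
    have "norm (pencil_fun Q n Y \<xi> a) \<le> (\<Sum>j\<in>UNIV. \<Sum>b<n. cmod (Y j a b) * K)" for a
      unfolding pencil_fun_def
    proof (intro sum_norm_le)
      fix j b assume "b \<in> {..<n}"
      then have "norm (\<xi> b) \<le> 1" using norm2_member[of b n \<xi>] that by auto
      then have "K * norm (\<xi> b) \<le> K * 1" using K(1) by (intro mult_left_mono) auto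
      then have "norm (Q j (\<xi> b)) \<le> K" using K(2)[of j "\<xi> b"] by linarith
      then show "norm (Y j a b *\<^sub>C Q j (\<xi> b)) \<le> cmod (Y j a b) * K"
        by (simp add: norm_scaleC mult_left_mono)
    qed
    then have "(\<Sum>a<n. norm (pencil_fun Q n Y \<xi> a)) \<le> B" unfolding B_def by (rule sum_mono)
    moreover have "norm2 n (pencil_fun Q n Y \<xi>) \<le> (\<Sum>a<n. norm (pencil_fun Q n Y \<xi> a))"
      unfolding norm2_def by (rule L2_set_le_sum) auto
    ultimately show ?thesis by simp
  qed
  have le1: "norm2 n (pencil_fun Q n Y \<xi>) \<le> 1" if "norm2 n \<xi> \<le> 1" for \<xi>
  proof -
    have "norm2 n (pencil_fun Q n Y \<xi>) \<le> tensor_norm n (pencil Q X)"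
      unfolding tensor_norm_def pencil_fun norm2_def[symmetric]
      by (rule cSUP_upper) (use that bound in \<open>auto intro!: bdd_aboveI2\<close>)
    then show ?thesis using lt1 by simp
  qed
  have "norm2 n (pencil_fun Q n Y \<xi>) \<le> norm2 n \<xi>" for \<xi>
  proof (cases "norm2 n \<xi> = 0")
    case True
    then have "\<xi> b = 0" if "b < n" for b using that by (simp add: norm2_eq_0_iff)
    moreover have "Q j 0 = 0" for j using Q_scaleC[of j 0 0] by simp
    ultimately have "pencil_fun Q n Y \<xi> = (\<lambda>a. 0)" by (simp add: pencil_fun_def fun_eq_iff)
    then show ?thesis by simp
  next
    case False
    define s where "s = norm2 n \<xi>"
    have s: "s > 0" using False norm2_nonneg[of n \<xi>] unfolding s_def by linarith
    have "norm2 n (pencil_fun Q n Y (\<lambda>b. complex_of_real (1 / s) *\<^sub>C \<xi> b)) \<le> 1"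
      by (rule le1) (use s in \<open>simp add: norm2_scaleC norm_divide s_def\<close>)
    then show ?thesis
      using s by (simp add: pencil_fun_scaleC[abs_def] norm2_scaleC norm_divide field_simps s_def)
  qed
  then show "contractive Q n (\<lambda>j a b. X j $$ (a, b))" by (simp add: contractive_def Y_def[abs_def])
qed

lemma ball_of_contractive:
  assumes "0 < n" "contractive Q n X" "cmod \<mu> < 1"
  shows "(n, \<lambda>j. mat n n (\<lambda>(a, b). \<mu> * X j a b)) \<in> nc_ball Q"
proof -
  define Y where "Y j = mat n n (\<lambda>(a, b). \<mu> * X j a b)" for j
  have Y: "Y j \<in> carrier_mat n n" for j by (simp add: Y_def)
  have "tensor_norm n (pencil Q Y) \<le> cmod \<mu>"
    unfolding tensor_norm_def norm2_def[symmetric]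
  proof (rule cSUP_least)
    show "{h :: nat \<Rightarrow> 'h. norm2 n h \<le> 1} \<noteq> {}" by (auto intro!: exI[of _ "\<lambda>_. 0"])
    fix \<xi> :: "nat \<Rightarrow> 'h" assume "\<xi> \<in> {h. norm2 n h \<le> 1}"
    then have \<xi>: "norm2 n \<xi> \<le> 1" by simp
    have "norm2 n (pencil Q Y \<xi>) = norm2 n (\<lambda>a. \<mu> *\<^sub>C pencil_fun Q n X \<xi> a)"
      by (intro norm2_cong) (simp add: pencil_eq_pencil_fun[OF Y] pencil_fun_mult[symmetric], simp add: pencil_fun_def Y_def)
    also have "\<dots> = cmod \<mu> * norm2 n (pencil_fun Q n X \<xi>)" by (rule norm2_scaleC)
    also have "\<dots> \<le> cmod \<mu> * norm2 n \<xi>"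
      using assms(2) by (simp add: contractive_def mult_left_mono)
    also have "\<dots> \<le> cmod \<mu>" using \<xi> by (simp add: mult_left_le)
    finally show "norm2 n (pencil Q Y \<xi>) \<le> cmod \<mu>" .
  qed
  then have "(n, Y) \<in> nc_ball Q" using assms Y by (auto simp: nc_ball_def nc_universe_def)
  then show ?thesis by (simp add: Y_def[abs_def])
qed

lemma contractive_mult: "contractive Q n X \<Longrightarrow> cmod \<mu> \<le> 1 \<Longrightarrow> contractive Q n (\<lambda>j a b. \<mu> * X j a b)"
  unfolding contractive_def pencil_fun_mult[abs_def] norm2_scaleC
  by (meson mult_left_le_one_le norm2_nonneg norm_ge_zero order_trans)

lemma contractive_zero: "contractive Q n (\<lambda>j a b. 0)"
  by (simp add: contractive_def pencil_fun_def[abs_def])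

text \<open>The tuple \<open>h g\<^sup>* X\<close>: left multiplication by a contraction preserves the operator ball.\<close>

lemma contractive_corner:
  assumes X: "contractive Q n X" and g: "norm2 n g \<le> 1" and h: "norm2 n (h :: nat \<Rightarrow> complex) \<le> 1"
  shows "contractive Q n (\<lambda>j a b. h a * (\<Sum>c<n. cnj (g c) * X j c b))"
  unfolding contractive_def
proof
  fix \<xi> :: "nat \<Rightarrow> 'h"
  have pencil_fun: "pencil_fun Q n (\<lambda>j a b. h a * (\<Sum>c<n. cnj (g c) * X j c b)) \<xi> a
      = h a *\<^sub>C (\<Sum>c<n. cnj (g c) *\<^sub>C pencil_fun Q n X \<xi> c)" for a
  proof -
    have "(\<Sum>c<n. cnj (g c) *\<^sub>C pencil_fun Q n X \<xi> c)
        = (\<Sum>c<n. \<Sum>j\<in>UNIV. \<Sum>b<n. (cnj (g c) * X j c b) *\<^sub>C Q j (\<xi> b))"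
      by (simp add: pencil_fun_def scaleC_sum_right scaleC_scaleC)
    also have "\<dots> = (\<Sum>j\<in>UNIV. \<Sum>c<n. \<Sum>b<n. (cnj (g c) * X j c b) *\<^sub>C Q j (\<xi> b))"
      by (rule sum.swap)
    also have "\<dots> = (\<Sum>j\<in>UNIV. \<Sum>b<n. \<Sum>c<n. (cnj (g c) * X j c b) *\<^sub>C Q j (\<xi> b))"
      by (intro sum.cong refl sum.swap)
    finally show ?thesis
      by (simp add: pencil_fun_def scaleC_sum_right scaleC_sum_left flip: scaleC_scaleC)
  qed
  have "norm (\<Sum>c<n. cnj (g c) *\<^sub>C pencil_fun Q n X \<xi> c) \<le> (\<Sum>c<n. norm (g c) * norm (pencil_fun Q n X \<xi> c))"
    by (intro sum_norm_le) (simp add: norm_scaleC)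
  also have "\<dots> \<le> norm2 n g * norm2 n (pencil_fun Q n X \<xi>)" by (rule norm2_inner_le)
  also have "\<dots> \<le> 1 * norm2 n \<xi>" using X g by (intro mult_mono) (auto simp: contractive_def)
  finally have le: "norm (\<Sum>c<n. cnj (g c) *\<^sub>C pencil_fun Q n X \<xi> c) \<le> norm2 n \<xi>" by simp
  have "norm2 n (pencil_fun Q n (\<lambda>j a b. h a * (\<Sum>c<n. cnj (g c) * X j c b)) \<xi>) \<le> norm2 n \<xi> * norm2 n h"
  proof (rule norm2_le_scale)
    fix a
    show "norm (pencil_fun Q n (\<lambda>j a b. h a * (\<Sum>c<n. cnj (g c) * X j c b)) \<xi> a) \<le> norm2 n \<xi> * norm (h a)"
      using mult_right_mono[OF le, of "cmod (h a)"] by (simp add: pencil_fun norm_scaleC mult.commute)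
  qed simp
  also have "\<dots> \<le> norm2 n \<xi>" using h by (simp add: mult_left_le)
  finally show "norm2 n (pencil_fun Q n (\<lambda>j a b. h a * (\<Sum>c<n. cnj (g c) * X j c b)) \<xi>) \<le> norm2 n \<xi>" .
qed

lemma contractive_coordinate:
  "\<exists>\<epsilon>>0. \<forall>n j0. contractive Q n (\<lambda>j a b. if j = j0 \<and> a = b then complex_of_real \<epsilon> else 0)"
proof -
  obtain K where K: "K > 0" "\<And>j x. norm (Q j x) \<le> K * norm x" using bound_Q by blast
  have "contractive Q n (\<lambda>j a b. if j = j0 \<and> a = b then complex_of_real (1 / K) else 0)" for n j0
    unfolding contractive_def
  proof
    fix \<xi> :: "nat \<Rightarrow> 'h"
    have pencil_fun: "pencil_fun Q n (\<lambda>j a b. if j = j0 \<and> a = b then complex_of_real (1 / K) else 0) \<xi> a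
        = complex_of_real (1 / K) *\<^sub>C Q j0 (\<xi> a)" if "a < n" for a
    proof -
      have "pencil_fun Q n (\<lambda>j a b. if j = j0 \<and> a = b then complex_of_real (1 / K) else 0) \<xi> a
        = (\<Sum>j\<in>UNIV. \<Sum>b<n. if b = a then (if j = j0 then complex_of_real (1 / K) *\<^sub>C Q j0 (\<xi> b) else 0) else 0)"
        unfolding pencil_fun_def by (intro sum.cong refl) auto
      then show ?thesis using that by simp
    qed
    show "norm2 n (pencil_fun Q n (\<lambda>j a b. if j = j0 \<and> a = b then complex_of_real (1 / K) else 0) \<xi>) \<le> norm2 n \<xi>"
      using K by (intro norm2_mono) (simp add: pencil_fun norm_scaleC norm_divide field_simps)
  qed
  then show ?thesis using K(1) by (intro exI[of _ "1 / K"]) auto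
qed

end

text \<open>The \<open>s \<times> s\<close> block matrix with blocks of size \<open>n\<close> whose only nonzero blocks are \<open>ys t\<close> in
  row \<open>t\<close>, column \<open>t + 1\<close> modulo \<open>s\<close>.\<close>

definition cyclic_block :: "nat \<Rightarrow> nat \<Rightarrow> (nat \<Rightarrow> 'd \<Rightarrow> nat \<Rightarrow> nat \<Rightarrow> complex) \<Rightarrow> 'd \<Rightarrow> nat \<Rightarrow> nat \<Rightarrow> complex" where
  "cyclic_block s n ys j p q =
     (if q div n = Suc (p div n) mod s then ys (p div n) j (p mod n) (q mod n) else 0)"

lemma sum_cyclic_block:
  fixes F :: "complex \<Rightarrow> nat \<Rightarrow> 'z::comm_monoid_add"
  assumes "t < s" "a < n" "\<And>q. F 0 q = 0"
  shows "(\<Sum>q<s * n. F (cyclic_block s n ys j (t * n + a) q) q)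
    = (\<Sum>b<n. F (ys t j a b) (Suc t mod s * n + b))"
proof -
  have "(\<Sum>q<s * n. F (cyclic_block s n ys j (t * n + a) q) q)
      = (\<Sum>t'<s. \<Sum>b<n. F (cyclic_block s n ys j (t * n + a) (t' * n + b)) (t' * n + b))"
    by (rule sum_blocks)
  also have "\<dots> = (\<Sum>t'<s. if t' = Suc t mod s then (\<Sum>b<n. F (ys t j a b) (t' * n + b)) else 0)"
    using assms by (intro sum.cong refl) (auto simp: cyclic_block_def intro!: sum.neutral)
  also have "\<dots> = (\<Sum>b<n. F (ys t j a b) (Suc t mod s * n + b))"
    using assms(1) by simp
  finally show ?thesis .
qed

lemma norm2_blocks: "(norm2 (s * n) \<xi>)\<^sup>2 = (\<Sum>t<s. (norm2 n (\<lambda>a. \<xi> (t * n + a)))\<^sup>2)"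
  by (simp add: norm2_def L2_set_def sum_nonneg sum_blocks)

text \<open>Every block row and every block column contains one contraction, so the pencil maps the
  orthogonal summands contractively to different orthogonal summands.\<close>

lemma contractive_cyclic_block:
  assumes s: "0 < s" and ys: "\<And>t. t < s \<Longrightarrow> contractive Q n (ys t)"
  shows "contractive Q (s * n) (cyclic_block s n ys)"
  unfolding contractive_def
proof
  fix \<xi> :: "nat \<Rightarrow> 'b"
  have "(norm2 (s * n) (pencil_fun Q (s * n) (cyclic_block s n ys) \<xi>))\<^sup>2
      = (\<Sum>t<s. (norm2 n (pencil_fun Q n (ys t) (\<lambda>b. \<xi> (Suc t mod s * n + b))))\<^sup>2)"
    unfolding norm2_blocks
  proof (intro sum.cong refl arg_cong[of _ _ "\<lambda>x. x\<^sup>2"] norm2_cong)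
    fix t a assume "t \<in> {..<s}" "a < n"
    then show "pencil_fun Q (s * n) (cyclic_block s n ys) \<xi> (t * n + a) = pencil_fun Q n (ys t) (\<lambda>b. \<xi> (Suc t mod s * n + b)) a"
      unfolding pencil_fun_def by (intro sum.cong refl sum_cyclic_block) auto
  qed
  also have "\<dots> \<le> (\<Sum>t<s. (norm2 n (\<lambda>b. \<xi> (Suc t mod s * n + b)))\<^sup>2)"
    using ys by (intro sum_mono power_mono) (auto simp: contractive_def)
  also have "\<dots> = (norm2 (s * n) \<xi>)\<^sup>2"
    unfolding norm2_blocks by (rule sum_cyclic[OF s])
  finally show "norm2 (s * n) (pencil_fun Q (s * n) (cyclic_block s n ys) \<xi>) \<le> norm2 (s * n) \<xi>"
    by (rule power2_le_imp_le) simp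
qed

text \<open>The bound is clear for the combinations \<open>\<Sum>\<^sub>j \<langle>Q\<^sub>j \<xi>, \<zeta>\<rangle> X\<^sub>j\<close>, as they are compressions of
  \<open>Q(X)\<close>. If the vectors \<open>(\<langle>Q\<^sub>j \<xi>, \<zeta>\<rangle>)\<^sub>j\<close> did not span \<open>\<complex>\<^sup>d\<close>, an annihilating vector would be a
  linear relation between the \<open>Q\<^sub>j\<close>.\<close>

lemma coordinates_bounded:
  fixes Q :: "'d::finite \<Rightarrow> 'h \<Rightarrow> 'h::complex_hilbert_space"
  assumes "operator_space_basis E Q"
  shows "\<exists>M\<ge>0. \<forall>n X j h. contractive Q n X \<longrightarrow> norm2 n (\<lambda>a. \<Sum>b<n. X j a b * h b) \<le> M * norm2 n h"
proof -
  interpret bounded_tuple Q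
    by standard (use assms in \<open>auto simp: operator_space_basis_def\<close>)
  define K where "K = {x :: 'd \<Rightarrow> complex. \<exists>M\<ge>0. \<forall>n X h. contractive Q n X \<longrightarrow>
     norm2 n (\<lambda>a. \<Sum>j\<in>UNIV. x j * (\<Sum>b<n. X j a b * h b)) \<le> M * norm2 n h}"
  have "(\<forall>z. \<exists>x\<in>K. \<forall>j\<in>UNIV. x j = z j) \<or>
         (\<exists>y. (\<exists>j\<in>UNIV. y j \<noteq> 0) \<and> (\<forall>x\<in>K. (\<Sum>j\<in>UNIV. x j * y j) = 0))"
  proof (rule subspace_full_or_annihilated)
    fix x y c assume "x \<in> K" "y \<in> K"
    then obtain M M' where M: "M \<ge> 0" "M' \<ge> 0"
      "\<And>n X h. contractive Q n X \<Longrightarrow> norm2 n (\<lambda>a. \<Sum>j\<in>UNIV. x j * (\<Sum>b<n. X j a b * h b)) \<le> M * norm2 n h"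
      "\<And>n X h. contractive Q n X \<Longrightarrow> norm2 n (\<lambda>a. \<Sum>j\<in>UNIV. y j * (\<Sum>b<n. X j a b * h b)) \<le> M' * norm2 n h"
      by (auto simp: K_def)
    have "norm2 n (\<lambda>a. \<Sum>j\<in>UNIV. (x j + c * y j) * (\<Sum>b<n. X j a b * h b)) \<le> (M + cmod c * M') * norm2 n h"
      if "contractive Q n X" for n X h
    proof -
      have "norm2 n (\<lambda>a. \<Sum>j\<in>UNIV. (x j + c * y j) * (\<Sum>b<n. X j a b * h b))
          = norm2 n (\<lambda>a. (\<Sum>j\<in>UNIV. x j * (\<Sum>b<n. X j a b * h b)) + c * (\<Sum>j\<in>UNIV. y j * (\<Sum>b<n. X j a b * h b)))"
        by (simp add: distrib_right sum.distrib sum_distrib_left mult.assoc)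
      also have "\<dots> \<le> norm2 n (\<lambda>a. \<Sum>j\<in>UNIV. x j * (\<Sum>b<n. X j a b * h b))
          + cmod c * norm2 n (\<lambda>a. \<Sum>j\<in>UNIV. y j * (\<Sum>b<n. X j a b * h b))"
        unfolding norm2_mult[symmetric] by (rule norm2_triangle)
      also have "\<dots> \<le> M * norm2 n h + cmod c * (M' * norm2 n h)"
        by (intro add_mono mult_left_mono M that) auto
      finally show ?thesis by (simp add: algebra_simps)
    qed
    moreover have "M + cmod c * M' \<ge> 0" using M by simp
    ultimately show "(\<lambda>j. x j + c * y j) \<in> K" unfolding K_def by blast
  next
    show "\<exists>x. x \<in> K" unfolding K_def by (intro exI[of _ "\<lambda>_. 0"]) auto
  qed simp
  then have full: "\<forall>z. \<exists>x\<in>K. \<forall>j\<in>UNIV. x j = z j"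
  proof
    assume "\<exists>y. (\<exists>j\<in>UNIV. y j \<noteq> 0) \<and> (\<forall>x\<in>K. (\<Sum>j\<in>UNIV. x j * y j) = 0)"
    then obtain y where y: "\<exists>j. y j \<noteq> 0" "\<And>x. x \<in> K \<Longrightarrow> (\<Sum>j\<in>UNIV. x j * y j) = 0" by auto
    have "(\<lambda>j. cinner (Q j \<xi>) \<zeta>) \<in> K" for \<xi> \<zeta>
    proof -
      have "norm2 n (\<lambda>a. \<Sum>j\<in>UNIV. cinner (Q j \<xi>) \<zeta> * (\<Sum>b<n. X j a b * h b)) \<le> norm \<zeta> * norm \<xi> * norm2 n h"
        if X: "contractive Q n X" for n X h
      proof -
        have eq: "(\<Sum>j\<in>UNIV. cinner (Q j \<xi>) \<zeta> * (\<Sum>b<n. X j a b * h b)) = cinner (pencil_fun Q n X (\<lambda>b. h b *\<^sub>C \<xi>) a) \<zeta>" for a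
          by (simp add: pencil_fun_def cinner_sum_left Q_scaleC cinner_scaleC_left sum_distrib_left mult_ac)
        have "norm2 n (\<lambda>a. \<Sum>j\<in>UNIV. cinner (Q j \<xi>) \<zeta> * (\<Sum>b<n. X j a b * h b)) \<le> norm \<zeta> * norm2 n (pencil_fun Q n X (\<lambda>b. h b *\<^sub>C \<xi>))"
          unfolding eq
          by (rule norm2_le_scale) (subst mult.commute, rule cinner_Cauchy_Schwarz, simp)
        also have "\<dots> \<le> norm \<zeta> * norm2 n (\<lambda>b. h b *\<^sub>C \<xi>)"
          using X by (intro mult_left_mono) (auto simp: contractive_def)
        also have "\<dots> \<le> norm \<zeta> * (norm \<xi> * norm2 n h)"
          by (intro mult_left_mono norm2_le_scale) (auto simp: norm_scaleC mult.commute)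
        finally show ?thesis by (simp add: mult.assoc)
      qed
      moreover have "norm \<zeta> * norm \<xi> \<ge> 0" by simp
      ultimately show ?thesis unfolding K_def by blast
    qed
    from y(2)[OF this] have "cinner (\<Sum>j\<in>UNIV. y j *\<^sub>C Q j \<xi>) \<zeta> = 0" for \<xi> \<zeta>
      by (simp add: cinner_sum_left cinner_scaleC_left mult.commute)
    then have "(\<Sum>j\<in>UNIV. y j *\<^sub>C Q j \<xi>) = 0" for \<xi> using cinner_eq_zero_iff by blast
    then have "\<forall>j. y j = 0" using assms unfolding operator_space_basis_def by blast
    then show ?thesis using y(1) by blast
  qed
  have "\<forall>j. \<exists>M\<ge>0. \<forall>n X h. contractive Q n X \<longrightarrow> norm2 n (\<lambda>a. \<Sum>b<n. X j a b * h b) \<le> M * norm2 n h"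
  proof
    fix j0
    obtain x where x: "x \<in> K" "\<forall>j\<in>UNIV. x j = delta j j0"
      using full[rule_format, of "\<lambda>j. delta j j0"] by blast
    have "x = (\<lambda>j. delta j j0)" using x by auto
    then have "(\<Sum>j\<in>UNIV. x j * f j) = f j0" for f
      by (simp add: if_distrib[of "\<lambda>c. c * _"] cong: if_cong)
    then show "\<exists>M\<ge>0. \<forall>n X h. contractive Q n X \<longrightarrow> norm2 n (\<lambda>a. \<Sum>b<n. X j0 a b * h b) \<le> M * norm2 n h"
      using x(1) by (simp add: K_def)
  qed
  from choice[OF this] obtain M where M: "\<And>j. M j \<ge> 0"
    "\<And>j n X h. contractive Q n X \<Longrightarrow> norm2 n (\<lambda>a. \<Sum>b<n. X j a b * h b) \<le> M j * norm2 n h" by blast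
  have "norm2 n (\<lambda>a. \<Sum>b<n. X j a b * h b) \<le> (\<Sum>j\<in>UNIV. M j) * norm2 n h" if "contractive Q n X" for n X j h
  proof -
    have "M j \<le> (\<Sum>j\<in>UNIV. M j)" using M(1) by (intro member_le_sum) auto
    then show ?thesis using M(2)[OF that, of j h] mult_right_mono[OF _ norm2_nonneg[of n h]] order_trans by blast
  qed
  moreover have "(\<Sum>j\<in>UNIV. M j) \<ge> 0" by (intro sum_nonneg M)
  ultimately show ?thesis by blast
qed

section \<open>Resolvents of irreducible stable pencils\<close>

text \<open>\<open>L(X) = \<Sum>\<^sub>j A\<^sub>j \<otimes> X\<^sub>j\<close>, acting on \<open>\<complex>\<^sup>N \<otimes> \<complex>\<^sup>n\<close>, the families of \<open>N\<close> vectors of length \<open>n\<close>.\<close>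

definition lin_op :: "nat \<Rightarrow> 'd::finite tuple \<Rightarrow> nat \<Rightarrow> 'd tuple \<Rightarrow>
    (nat \<Rightarrow> nat \<Rightarrow> complex) \<Rightarrow> nat \<Rightarrow> nat \<Rightarrow> complex" where
  "lin_op N A n X \<eta> i a = (\<Sum>l<N. \<Sum>j\<in>UNIV. A j i l * (\<Sum>b<n. X j a b * \<eta> l b))"

lemma lin_op_linear: "lin_op N A n X (\<lambda>i b. x i b + c * y i b) i a = lin_op N A n X x i a + c * lin_op N A n X y i a"
  by (simp add: lin_op_def distrib_left sum.distrib sum_distrib_left mult_ac)

lemma lin_op_mult: "lin_op N A n (\<lambda>j a b. c * X j a b) \<eta> i a = c * lin_op N A n X \<eta> i a"
  by (simp add: lin_op_def sum_distrib_left mult_ac)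

lemma lin_op_cong:
  "(\<And>l b. l < N \<Longrightarrow> b < n \<Longrightarrow> x l b = y l b) \<Longrightarrow> lin_op N A n X x i a = lin_op N A n X y i a"
  unfolding lin_op_def by (intro sum.cong refl arg_cong[of _ _ "\<lambda>x. _ * x"]) auto

lemma lin_op_zero [simp]: "lin_op N A n X (\<lambda>i b. 0) = (\<lambda>i a. 0)"
  by (simp add: lin_op_def fun_eq_iff)

lemma lin_op_pow_linear:
  "(lin_op N A n X ^^ m) (\<lambda>i b. x i b + c * y i b) = (\<lambda>i a. (lin_op N A n X ^^ m) x i a + c * (lin_op N A n X ^^ m) y i a)"
proof (induction m)
  case (Suc m)
  have "lin_op N A n X (\<lambda>i a. (lin_op N A n X ^^ m) x i a + c * (lin_op N A n X ^^ m) y i a)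
      = (\<lambda>i a. lin_op N A n X ((lin_op N A n X ^^ m) x) i a + c * lin_op N A n X ((lin_op N A n X ^^ m) y) i a)"
    by (intro ext lin_op_linear)
  then show ?case using Suc by simp
qed simp

lemma lin_op_pow_zero [simp]: "(lin_op N A n X ^^ m) (\<lambda>i b. 0) = (\<lambda>i b. 0)"
  by (induction m) auto

lemma lin_op_pow_cong:
  assumes "\<And>l b. l < N \<Longrightarrow> b < n \<Longrightarrow> x l b = y l b" "i < N" "a < n"
  shows "(lin_op N A n X ^^ m) x i a = (lin_op N A n X ^^ m) y i a"
  using assms(2,3)
proof (induction m arbitrary: i a)
  case (Suc m)
  then show ?case by (simp only: funpow.simps o_apply) (rule lin_op_cong)
qed (use assms(1) in simp)

lemma lin_op_pow_sum:
  "(lin_op N A n X ^^ m) (\<lambda>i b. \<Sum>s\<in>S. c s * f s i b) = (\<lambda>i a. \<Sum>s\<in>S. c s * (lin_op N A n X ^^ m) (f s) i a)"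
proof (induction S rule: infinite_finite_induct)
  case (insert s S)
  then show ?case
    using lin_op_pow_linear[where N = N and A = A and n = n and X = X and m = m and x = "\<lambda>i b. \<Sum>s\<in>S. c s * f s i b" and c = "c s" and y = "f s"]
    by (simp add: add.commute)
qed auto

text \<open>The entries of the compression \<open>(1 \<otimes> g\<^sup>* ) L(X)\<^bsup>m\<^esup> (1 \<otimes> h)\<close>.\<close>

definition corner :: "nat \<Rightarrow> 'd::finite tuple \<Rightarrow> nat \<Rightarrow> 'd tuple \<Rightarrow> nat \<Rightarrow> (nat \<Rightarrow> complex) \<Rightarrow> (nat \<Rightarrow> complex) \<Rightarrow> nat \<Rightarrow> nat \<Rightarrow> complex" where
  "corner N A n X m g h i l = (\<Sum>c<n. cnj (g c) * (lin_op N A n X ^^ m) (\<lambda>i' b. delta i' l * h b) i c)"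

lemma corner_apply:
  assumes i: "i < N"
  shows "(\<Sum>c<n. cnj (g c) * (lin_op N A n X ^^ m) (\<lambda>i' b. z i' * h b) i c) = (\<Sum>l<N. corner N A n X m g h i l * z l)"
proof -
  have "(lin_op N A n X ^^ m) (\<lambda>i' b. z i' * h b) i c
      = (\<Sum>l<N. z l * (lin_op N A n X ^^ m) (\<lambda>i' b. delta i' l * h b) i c)" if c: "c < n" for c
  proof -
    have "(lin_op N A n X ^^ m) (\<lambda>i' b. z i' * h b) i c
      = (lin_op N A n X ^^ m) (\<lambda>i' b. \<Sum>l<N. z l * (delta i' l * h b)) i c"
      using i c by (intro lin_op_pow_cong) (auto simp: if_distrib[of "\<lambda>c. c * _"] if_distrib[of "\<lambda>c. _ * c"] cong: if_cong)
    then show ?thesis by (simp only: lin_op_pow_sum)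
  qed
  then have "(\<Sum>c<n. cnj (g c) * (lin_op N A n X ^^ m) (\<lambda>i' b. z i' * h b) i c)
      = (\<Sum>c<n. \<Sum>l<N. cnj (g c) * (lin_op N A n X ^^ m) (\<lambda>i' b. delta i' l * h b) i c * z l)"
    by (simp add: sum_distrib_left mult_ac)
  then show ?thesis unfolding corner_def by (subst (asm) sum.swap) (simp add: sum_distrib_right)
qed

text \<open>\<open>1 - L\<close> is injective on the open ball.\<close>

definition stable_pencil :: "('d::finite \<Rightarrow> 'h \<Rightarrow> 'h::complex_hilbert_space) \<Rightarrow> nat \<Rightarrow>
    'd tuple \<Rightarrow> bool" where
  "stable_pencil Q N A \<longleftrightarrow> (\<forall>n X \<mu> \<eta>. 0 < n \<longrightarrow> contractive Q n X \<longrightarrow> cmod \<mu> < 1 \<longrightarrow>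
     (\<forall>i<N. \<forall>a<n. \<eta> i a = \<mu> * lin_op N A n X \<eta> i a) \<longrightarrow> (\<forall>i<N. \<forall>a<n. \<eta> i a = 0))"

text \<open>\<open>Z\<close> records the partial products applied to an eigenvector \<open>Z s\<close> of
  \<open>L(ys 0) \<cdots> L(ys (s - 1))\<close>. If \<open>|\<kappa>| > 1\<close>, choose \<open>\<mu>\<close> with \<open>\<mu>\<^sup>s \<kappa> = 1\<close>; the vectors \<open>\<mu>\<^bsup>s - t\<^esup> Z t\<close>
  fit together to a fixed vector of \<open>L(\<mu> Y)\<close>, with \<open>Y\<close> the cyclic block matrix of the \<open>ys t\<close>. As
  \<open>|\<mu>| < 1\<close>, this contradicts stability.\<close>

lemma cyclic_product_eigenvalue_le_1:
  assumes stable: "stable_pencil Q N A"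
    and n: "0 < n" and s: "0 < s" and ys: "\<And>t. t < s \<Longrightarrow> contractive Q n (ys t)"
    and Z: "\<And>t i a. t < s \<Longrightarrow> i < N \<Longrightarrow> a < n \<Longrightarrow> Z t i a = lin_op N A n (ys t) (Z (Suc t)) i a"
    and eig: "\<And>i a. i < N \<Longrightarrow> a < n \<Longrightarrow> Z 0 i a = \<kappa> * Z s i a"
    and nz: "i0 < N" "a0 < n" "Z s i0 a0 \<noteq> 0"
  shows "cmod \<kappa> \<le> 1"
proof (rule ccontr)
  assume "\<not> ?thesis"
  then have gt: "cmod \<kappa> > 1" by simp
  define \<mu> where "\<mu> = exp (- Ln \<kappa> / of_nat s)"
  have "\<mu> ^ s = exp (- Ln \<kappa>)"
    unfolding \<mu>_def exp_of_nat_mult[symmetric] using s by simp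
  moreover have "\<kappa> \<noteq> 0" using gt by auto
  ultimately have \<mu>s: "\<mu> ^ s * \<kappa> = 1" by (simp add: exp_minus)
  have \<mu>: "cmod \<mu> < 1"
  proof (rule ccontr)
    assume "\<not> ?thesis"
    then have "1 \<le> cmod \<mu> ^ s" by (simp add: one_le_power)
    then have "1 * cmod \<kappa> \<le> cmod \<mu> ^ s * cmod \<kappa>" by (intro mult_right_mono) auto
    with gt have "1 < cmod \<mu> ^ s * cmod \<kappa>" by linarith
    then show False using arg_cong[OF \<mu>s, of cmod] by (simp add: norm_mult norm_power)
  qed
  \<comment> \<open>At \<open>t = 0\<close> both expressions agree where the indices are in range; the value \<open>Z s\<close> closes the cycle.\<close>
  define E where "E t i a = (if t = 0 then Z s i a else \<mu> ^ (s - t) * Z t i a)" for t i a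
  have E: "E t i a = \<mu> ^ (s - t) * Z t i a" if "i < N" "a < n" for t i a
    using eig[OF that] \<mu>s by (simp add: E_def flip: mult.assoc)
  have E_next: "E (Suc t mod s) i a = \<mu> ^ (s - Suc t) * Z (Suc t) i a" if "t < s" "i < N" "a < n" for t i a
  proof (cases "Suc t = s")
    case True
    then show ?thesis by (simp add: E_def)
  next
    case False
    then show ?thesis using that by (simp add: E)
  qed
  define \<eta> where "\<eta> i p = E (p div n) i (p mod n)" for i p
  have "\<forall>i<N. \<forall>p<s * n. \<eta> i p = \<mu> * lin_op N A (s * n) (cyclic_block s n ys) \<eta> i p"
  proof (intro allI impI)
    fix i p assume i: "i < N" and p: "p < s * n"
    define t a where "t = p div n" and "a = p mod n"
    have t: "t < s" using p n by (simp add: t_def less_mult_imp_div_less)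
    have a: "a < n" using n by (simp add: a_def)
    have p_eq: "p = t * n + a" by (simp add: t_def a_def)
    have "(\<Sum>q<s * n. cyclic_block s n ys j (t * n + a) q * \<eta> l q) = (\<Sum>b<n. ys t j a b * E (Suc t mod s) l b)" for l j
    proof -
      have "(\<Sum>q<s * n. cyclic_block s n ys j (t * n + a) q * \<eta> l q)
          = (\<Sum>b<n. ys t j a b * \<eta> l (Suc t mod s * n + b))"
        by (rule sum_cyclic_block[OF t a]) simp
      then show ?thesis using n by (simp add: \<eta>_def)
    qed
    then have "lin_op N A (s * n) (cyclic_block s n ys) \<eta> i p = lin_op N A n (ys t) (E (Suc t mod s)) i a"
      unfolding lin_op_def p_eq by simp
    also have "\<dots> = lin_op N A n (ys t) (\<lambda>l b. 0 + \<mu> ^ (s - Suc t) * Z (Suc t) l b) i a"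
      by (rule lin_op_cong) (simp add: E_next[OF t])
    also have "\<dots> = \<mu> ^ (s - Suc t) * Z t i a"
      by (simp only: lin_op_linear) (simp add: Z[OF t i a])
    finally have "\<mu> * lin_op N A (s * n) (cyclic_block s n ys) \<eta> i p = \<mu> ^ (s - t) * Z t i a"
      using t by (simp add: Suc_diff_Suc flip: power_Suc mult.assoc)
    then show "\<eta> i p = \<mu> * lin_op N A (s * n) (cyclic_block s n ys) \<eta> i p"
      using E[OF i a, of t] by (simp add: \<eta>_def t_def a_def)
  qed
  moreover have "0 < s * n" using s n by simp
  moreover have "contractive Q (s * n) (cyclic_block s n ys)" by (rule contractive_cyclic_block[OF s ys])
  ultimately have "\<forall>i<N. \<forall>p<s * n. \<eta> i p = 0"
    using stable \<mu> unfolding stable_pencil_def by blast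
  moreover have "a0 < s * n"
    using nz(2) s by (cases s) auto
  ultimately have "\<eta> i0 a0 = 0" using nz(1) by blast
  then show False using nz by (simp add: \<eta>_def E_def)
qed

definition fam_norm :: "nat \<Rightarrow> nat \<Rightarrow> (nat \<Rightarrow> nat \<Rightarrow> complex) \<Rightarrow> real" where
  "fam_norm N n \<eta> = (\<Sum>i<N. norm2 n (\<eta> i))"

lemma fam_norm_nonneg [simp]: "0 \<le> fam_norm N n \<eta>" unfolding fam_norm_def by (intro sum_nonneg) auto

lemma fam_norm_cong: "(\<And>i a. i < N \<Longrightarrow> a < n \<Longrightarrow> x i a = y i a) \<Longrightarrow> fam_norm N n x = fam_norm N n y"
  unfolding fam_norm_def by (intro sum.cong refl norm2_cong) auto

lemma fam_norm_triangle: "fam_norm N n (\<lambda>i a. x i a + y i a) \<le> fam_norm N n x + fam_norm N n y"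
  unfolding fam_norm_def sum.distrib[symmetric] by (intro sum_mono norm2_triangle)

lemma fam_norm_mult: "fam_norm N n (\<lambda>i a. c * x i a) = cmod c * fam_norm N n x"
  unfolding fam_norm_def by (simp add: norm2_mult sum_distrib_left)

lemma fam_norm_member: "i < N \<Longrightarrow> norm2 n (x i) \<le> fam_norm N n x"
  unfolding fam_norm_def by (intro member_le_sum) auto

context bounded_tuple
begin

context
  fixes N :: nat and A :: "'d tuple"
  assumes irr: "irreducible_tuple N A"
    and stable: "stable_pencil Q N A"
begin

text \<open>With \<open>B\<close> the corner matrix and \<open>A\<^sup>w\<close> the word, \<open>T = \<epsilon>\<^bsup>|w|\<^esup> B A\<^sup>w\<close> satisfies
  \<open>(T y) \<otimes> h = L(h g\<^sup>* X) L(X)\<^bsup>m - 1\<^esup> L(\<epsilon> e\<^bsub>w 0\<^esub>) \<cdots> (y \<otimes> h)\<close>, where \<open>\<epsilon> e\<^sub>j\<close> is the tuple with the single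
  nonzero coordinate \<open>\<epsilon> 1\<close> at \<open>j\<close>. So the eigenvalues of \<open>T\<close> are eigenvalues of a cyclic product
  of contractive tuples.\<close>

lemma corner_word_trace:
  assumes eps: "0 < \<epsilon>" "\<And>n j0. contractive Q n (\<lambda>j a b. if j = j0 \<and> a = b then complex_of_real \<epsilon> else 0)"
    and X: "0 < n" "contractive Q n X" and m: "0 < m" and g: "norm2 n g \<le> 1" and h: "norm2 n h \<le> 1"
  shows "cmod (\<Sum>i<N. \<Sum>l<N. corner N A n X m g h i l * word_act N A w (\<lambda>b. delta b i) l) \<le> real N / \<epsilon> ^ length w"
proof (cases "\<forall>b<n. h b = 0")
  case True
  have "(lin_op N A n X ^^ m) (\<lambda>i' b. delta i' l * h b) i c = (lin_op N A n X ^^ m) (\<lambda>i b. 0) i c"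
    if "i < N" "c < n" for i l c
    using that True by (intro lin_op_pow_cong) auto
  then have "corner N A n X m g h i l = 0" if "i < N" for i l using that unfolding corner_def by simp
  then show ?thesis using eps by simp
next
  case False
  then obtain b0 where b0: "b0 < n" "h b0 \<noteq> 0" by blast
  define E where "E = complex_of_real \<epsilon>"
  define s where "s = m + length w"
  define T where "T i i' = E ^ length w * (\<Sum>l<N. corner N A n X m g h i l * word_act N A w (\<lambda>b. delta b i') l)" for i i'
  have word_expand: "word_act N A w y l = (\<Sum>i'<N. y i' * word_act N A w (\<lambda>b. delta b i') l)"
    if "l < N" for y l
    using act_expand[OF that, of A "Poly_Mapping.single (NC_Word w) 1" y] by simp
  have T: "(\<Sum>i'<N. T i i' * y i') = E ^ length w * (\<Sum>l<N. corner N A n X m g h i l * word_act N A w y l)" for y i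
  proof -
    have "(\<Sum>i'<N. (\<Sum>l<N. corner N A n X m g h i l * word_act N A w (\<lambda>b. delta b i') l) * y i')
      = (\<Sum>l<N. corner N A n X m g h i l * (\<Sum>i'<N. word_act N A w (\<lambda>b. delta b i') l * y i'))"
      by (rule sum_mult_assoc)
    also have "\<dots> = (\<Sum>l<N. corner N A n X m g h i l * word_act N A w y l)"
      by (intro sum.cong refl arg_cong[of _ _ "\<lambda>x. _ * x"]) (subst (2) word_expand, auto simp: mult.commute)
    finally show ?thesis by (simp add: T_def mult.assoc flip: sum_distrib_left)
  qed
  have "cmod (\<Sum>i<N. T i i) \<le> real N"
  proof (rule norm_trace_le[where T = T])
    fix \<kappa> y l0 assume l0: "l0 < N" "y l0 \<noteq> 0" and Ty: "\<And>i. i < N \<Longrightarrow> (\<Sum>i'<N. T i i' * y i') = \<kappa> * y i"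
    define ys where "ys t = (if t = 0 then (\<lambda>j a b. h a * (\<Sum>c<n. cnj (g c) * X j c b)) else if t < m then X
        else (\<lambda>j a b. if j = w ! (t - m) \<and> a = b then E else 0))" for t
    define Y where "Y t i b = E ^ (s - t) * (word_act N A (drop (t - m) w) y i * h b)" for t i b
    define Z where "Z t = (if m \<le> t then Y t
       else if 0 < t then (lin_op N A n X ^^ (m - t)) (Y m)
       else (\<lambda>i a. h a * (\<Sum>c<n. cnj (g c) * (lin_op N A n X ^^ m) (Y m) i c)))" for t
    show "cmod \<kappa> \<le> 1"
    proof (rule cyclic_product_eigenvalue_le_1[OF stable, of n s ys Z \<kappa> l0 b0])
      show "contractive Q n (ys t)" for t
        unfolding ys_def using contractive_corner[OF X(2) g h] X(2) eps(2)[folded E_def] by simp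
      show "0 < s" using m by (simp add: s_def)
      show "Z s l0 b0 \<noteq> 0" using l0 b0 by (simp add: Z_def Y_def s_def)
    next
      fix t i a assume t: "t < s" and i: "i < N" and a: "a < n"
      consider "t = 0" | "0 < t" "t < m" | "m \<le> t" by linarith
      then show "Z t i a = lin_op N A n (ys t) (Z (Suc t)) i a"
      proof cases
        case 1
        have Z1: "Z (Suc 0) = (lin_op N A n X ^^ (m - 1)) (Y m)"
          using m by (cases "m = 1") (auto simp: Z_def)
        have "lin_op N A n (ys 0) \<zeta> i a = h a * (\<Sum>c<n. cnj (g c) * lin_op N A n X \<zeta> i c)" for \<zeta>
        proof -
          define S where "S j l c = (\<Sum>b<n. X j c b * \<zeta> l b)" for j l c
          have "(\<Sum>b<n. ys 0 j a b * \<zeta> l b) = h a * (\<Sum>c<n. cnj (g c) * S j l c)" for j l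
            by (simp add: ys_def S_def mult.assoc sum_mult_assoc flip: sum_distrib_left)
          then have "lin_op N A n (ys 0) \<zeta> i a
              = h a * (\<Sum>l<N. \<Sum>j\<in>UNIV. \<Sum>c<n. cnj (g c) * (A j i l * S j l c))"
            unfolding lin_op_def by (simp add: sum_distrib_left mult_ac)
          also have "(\<Sum>l<N. \<Sum>j\<in>UNIV. \<Sum>c<n. cnj (g c) * (A j i l * S j l c))
              = (\<Sum>l<N. \<Sum>c<n. \<Sum>j\<in>UNIV. cnj (g c) * (A j i l * S j l c))"
            by (rule sum.cong[OF refl], rule sum.swap)
          also have "\<dots> = (\<Sum>c<n. \<Sum>l<N. \<Sum>j\<in>UNIV. cnj (g c) * (A j i l * S j l c))"
            by (rule sum.swap)
          finally show ?thesis unfolding lin_op_def S_def by (simp add: sum_distrib_left)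
        qed
        then have "lin_op N A n (ys 0) (Z (Suc 0)) i a
            = h a * (\<Sum>c<n. cnj (g c) * lin_op N A n X ((lin_op N A n X ^^ (m - 1)) (Y m)) i c)"
          unfolding Z1 .
        moreover have "lin_op N A n X ((lin_op N A n X ^^ (m - 1)) (Y m)) = (lin_op N A n X ^^ m) (Y m)"
          using m by (cases m) auto
        ultimately show ?thesis using 1 m by (simp add: Z_def)
      next
        case 2
        have "Z (Suc t) = (lin_op N A n X ^^ (m - Suc t)) (Y m)"
          using 2 by (cases "Suc t = m") (auto simp: Z_def)
        moreover have "m - t = Suc (m - Suc t)" using 2 by simp
        ultimately show ?thesis using 2 by (simp add: Z_def ys_def)
      next
        case 3
        have drop: "drop (t - m) w = w ! (t - m) # drop (Suc t - m) w"
          using 3 t by (simp add: s_def Cons_nth_drop_Suc Suc_diff_le)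
        have pw: "E ^ (s - t) = E * E ^ (s - Suc t)" using t by (simp add: Suc_diff_Suc flip: power_Suc)
        have lopE: "lin_op N A n (ys t) \<zeta> i a = E * (\<Sum>l<N. A (w ! (t - m)) i l * \<zeta> l a)" for \<zeta>
        proof -
          have *: "(\<Sum>b<n. ys t j a b * \<zeta> l b) = (if j = w ! (t - m) then E * \<zeta> l a else 0)" for j l
          proof -
            have "(\<Sum>b<n. ys t j a b * \<zeta> l b) = (\<Sum>b<n. if b = a then (if j = w ! (t - m) then E * \<zeta> l a else 0) else 0)"
              using 3 m by (intro sum.cong) (auto simp: ys_def)
            then show ?thesis using a by simp
          qed
          have "lin_op N A n (ys t) \<zeta> i a = (\<Sum>l<N. \<Sum>j\<in>UNIV. if j = w ! (t - m) then A j i l * (E * \<zeta> l a) else 0)"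
            unfolding lin_op_def by (intro sum.cong refl) (simp add: *)
          then show ?thesis by (simp add: sum_distrib_left mult_ac)
        qed
        show ?thesis using 3
          by (simp add: Z_def lopE Y_def drop pw sum_distrib_left sum_distrib_right mult_ac)
      qed
    next
      fix i a assume i: "i < N" and a: "a < n"
      define y' where "y' i = E ^ length w * word_act N A w y i" for i
      have Ym: "Y m = (\<lambda>i b. y' i * h b)" by (intro ext) (simp add: Y_def y'_def s_def mult.assoc)
      have "Z 0 i a = h a * (\<Sum>c<n. cnj (g c) * (lin_op N A n X ^^ m) (\<lambda>i b. y' i * h b) i c)"
        using m by (simp add: Z_def Ym)
      also have "\<dots> = h a * (\<Sum>i'<N. T i i' * y i')"
        unfolding corner_apply[OF i] T by (simp add: y'_def sum_distrib_left mult_ac)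
      finally show "Z 0 i a = \<kappa> * Z s i a"
        unfolding Ty[OF i] by (simp add: Z_def Y_def s_def mult_ac)
    qed (use X l0 b0 in auto)
  qed
  moreover have "(\<Sum>i<N. T i i) = E ^ length w *
      (\<Sum>i<N. \<Sum>l<N. corner N A n X m g h i l * word_act N A w (\<lambda>b. delta b i) l)"
    by (simp add: T_def sum_distrib_left)
  moreover have "cmod (E ^ length w) = \<epsilon> ^ length w" using eps by (simp add: E_def norm_power)
  ultimately show ?thesis using eps(1) by (simp add: norm_mult field_simps)
qed

text \<open>Burnside's theorem writes the elementary matrix \<open>e\<^bsub>l i\<^esub>\<close> as \<open>\<Sum>\<^sub>w c\<^sub>w A\<^sup>w\<close>, so that the entry
  \<open>B\<^bsub>i l\<^esub> = tr (B e\<^bsub>l i\<^esub>)\<close> is a fixed combination of the traces in \<open>corner_word_trace\<close>.\<close>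

lemma corner_bounded:
  "\<exists>C\<ge>0. \<forall>n X m g h i l. 0 < n \<longrightarrow> contractive Q n X \<longrightarrow> 0 < m \<longrightarrow> norm2 n g \<le> 1 \<longrightarrow> norm2 n h \<le> 1 \<longrightarrow>
     i < N \<longrightarrow> l < N \<longrightarrow> cmod (corner N A n X m g h i l) \<le> C"
proof -
  obtain \<epsilon> where eps: "0 < \<epsilon>" "\<And>n j0. contractive Q n (\<lambda>j a b. if j = j0 \<and> a = b then complex_of_real \<epsilon> else 0)"
    using contractive_coordinate by blast
  have "\<forall>i l. \<exists>p. i < N \<longrightarrow> l < N \<longrightarrow> (\<forall>y. \<forall>m<N. act N A p y m = (if m = i then y l else 0))"
    using elementary_matrix_in_span[OF irr] by blast
  then obtain p where p: "\<And>i l y m. i < N \<Longrightarrow> l < N \<Longrightarrow> m < N \<Longrightarrow> act N A (p i l) y m = (if m = i then y l else 0)"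
    by metis
  define B where "B i l = (\<Sum>w\<in>Poly_Mapping.keys (p l i). cmod (lookup (p l i) w) * (real N / \<epsilon> ^ length (letters w)))" for i l
  define C where "C = (\<Sum>i<N. \<Sum>l<N. B i l)"
  have B0: "0 \<le> B i l" for i l unfolding B_def using eps by (intro sum_nonneg) auto
  have "cmod (corner N A n X m g h i l) \<le> C"
    if X: "0 < n" "contractive Q n X" "0 < m" "norm2 n g \<le> 1" "norm2 n h \<le> 1" and il: "i < N" "l < N"
    for n X m g h i l
  proof -
    have "(\<Sum>i'<N. \<Sum>l'<N. corner N A n X m g h i' l' * act N A (p l i) (\<lambda>b. delta b i') l')
        = (\<Sum>i'<N. \<Sum>l'<N. if l' = l then (if i' = i then corner N A n X m g h i' l' else 0) else 0)"
      using il by (intro sum.cong refl) (auto simp: p)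
    also have "\<dots> = corner N A n X m g h i l" using il by simp
    finally have "corner N A n X m g h i l
        = (\<Sum>i'<N. \<Sum>l'<N. \<Sum>w\<in>Poly_Mapping.keys (p l i). lookup (p l i) w *
            (corner N A n X m g h i' l' * word_act N A (letters w) (\<lambda>b. delta b i') l'))"
      by (simp add: act_def sum_distrib_left mult_ac)
    also have "\<dots> = (\<Sum>i'<N. \<Sum>w\<in>Poly_Mapping.keys (p l i). \<Sum>l'<N. lookup (p l i) w *
            (corner N A n X m g h i' l' * word_act N A (letters w) (\<lambda>b. delta b i') l'))"
      by (intro sum.cong refl sum.swap)
    also have "\<dots> = (\<Sum>w\<in>Poly_Mapping.keys (p l i). lookup (p l i) w *
            (\<Sum>i'<N. \<Sum>l'<N. corner N A n X m g h i' l' * word_act N A (letters w) (\<lambda>b. delta b i') l'))"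
      by (subst sum.swap) (simp add: sum_distrib_left)
    also have "cmod \<dots> \<le> B i l"
      unfolding B_def
      by (intro sum_norm_le, unfold norm_mult)
        (intro mult_left_mono corner_word_trace[OF eps] X norm_ge_zero)
    also have "\<dots> \<le> (\<Sum>l<N. B i l)" using il B0 by (intro member_le_sum) auto
    also have "\<dots> \<le> C" unfolding C_def using il B0 by (intro member_le_sum[of i _ "\<lambda>i. \<Sum>l<N. B i l"]) (auto intro: sum_nonneg)
    finally show ?thesis .
  qed
  moreover have "0 \<le> C" unfolding C_def by (intro sum_nonneg B0)
  ultimately show ?thesis by blast
qed

text \<open>The corners for all unit vectors \<open>g\<close> and \<open>h\<close> give the norms of the \<open>N\<^sup>2\<close> blocks of \<open>L(X)\<^bsup>m\<^esup>\<close>.\<close>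

lemma power_bounded:
  "\<exists>C\<ge>0. \<forall>n X m \<eta>. 0 < n \<longrightarrow> contractive Q n X \<longrightarrow> fam_norm N n ((lin_op N A n X ^^ m) \<eta>) \<le> C * fam_norm N n \<eta>"
proof -
  obtain C where C: "C \<ge> 0" and corner: "\<And>n X m g h i l. 0 < n \<Longrightarrow> contractive Q n X \<Longrightarrow> 0 < m \<Longrightarrow> norm2 n g \<le> 1 \<Longrightarrow> norm2 n h \<le> 1 \<Longrightarrow>
     i < N \<Longrightarrow> l < N \<Longrightarrow> cmod (corner N A n X m g h i l) \<le> C"
    using corner_bounded by blast
  have column: "norm2 n ((lin_op N A n X ^^ m) (\<lambda>i' b. delta i' l * h b) i) \<le> C * norm2 n h"
    if X: "0 < n" "contractive Q n X" "0 < m" and il: "i < N" "l < N" for n X m h i l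
  proof (cases "norm2 n h = 0")
    case True
    then have h: "\<forall>b<n. h b = 0" by (simp add: norm2_eq_0_iff)
    have "(lin_op N A n X ^^ m) (\<lambda>i' b. delta i' l * h b) i c = (lin_op N A n X ^^ m) (\<lambda>i b. 0) i c"
      if "c < n" for c
      using that h il by (intro lin_op_pow_cong) auto
    then have "norm2 n ((lin_op N A n X ^^ m) (\<lambda>i' b. delta i' l * h b) i) = norm2 n (\<lambda>c. (0::complex))"
      by (intro norm2_cong) simp
    then show ?thesis using C by simp
  next
    case False
    define t where "t = norm2 n h"
    have t: "t > 0" using False norm2_nonneg[of n h] unfolding t_def by linarith
    define h' where "h' b = complex_of_real (1 / t) * h b" for b
    have h': "norm2 n h' \<le> 1" unfolding h'_def norm2_mult using t by (simp add: t_def norm_divide)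
    have hh': "(\<lambda>i' b. delta i' l * h b) = (\<lambda>i' b. 0 + complex_of_real t * (delta i' l * h' b))"
      using t by (simp add: h'_def fun_eq_iff)
    have "norm2 n ((lin_op N A n X ^^ m) (\<lambda>i' b. delta i' l * h b) i)
        = t * norm2 n ((lin_op N A n X ^^ m) (\<lambda>i' b. delta i' l * h' b) i)"
      unfolding hh' lin_op_pow_linear using t by (simp add: norm2_mult)
    also have "norm2 n ((lin_op N A n X ^^ m) (\<lambda>i' b. delta i' l * h' b) i) \<le> C"
      by (rule norm2_le_dual[OF _ C]) (rule corner[OF X _ h' il, unfolded corner_def])
    finally show ?thesis using t by (simp add: t_def mult.commute mult_left_mono)
  qed
  have "fam_norm N n ((lin_op N A n X ^^ m) \<eta>) \<le> (1 + real N * C) * fam_norm N n \<eta>"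
    if X: "0 < n" "contractive Q n X" for n X m \<eta>
  proof (cases "m = 0")
    case True
    have "0 \<le> real N * C * fam_norm N n \<eta>" using C by simp
    then show ?thesis using True by (simp add: distrib_right)
  next
    case False
    have "norm2 n ((lin_op N A n X ^^ m) \<eta> i) \<le> C * fam_norm N n \<eta>" if i: "i < N" for i
    proof -
      have "norm2 n ((lin_op N A n X ^^ m) \<eta> i)
          = norm2 n (\<lambda>c. \<Sum>l<N. (lin_op N A n X ^^ m) (\<lambda>i' b. delta i' l * \<eta> l b) i c)"
      proof (rule norm2_cong)
        fix c assume c: "c < n"
        have "(lin_op N A n X ^^ m) \<eta> i c = (lin_op N A n X ^^ m) (\<lambda>i' b. \<Sum>l<N. 1 * (delta i' l * \<eta> l b)) i c"
          using i c by (intro lin_op_pow_cong) (auto simp: if_distrib[of "\<lambda>c. c * _"] cong: if_cong)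
        then show "(lin_op N A n X ^^ m) \<eta> i c = (\<Sum>l<N. (lin_op N A n X ^^ m) (\<lambda>i' b. delta i' l * \<eta> l b) i c)"
          by (simp only: lin_op_pow_sum) simp
      qed
      also have "\<dots> \<le> (\<Sum>l<N. norm2 n ((lin_op N A n X ^^ m) (\<lambda>i' b. delta i' l * \<eta> l b) i))"
        by (rule norm2_sum)
      also have "\<dots> \<le> (\<Sum>l<N. C * norm2 n (\<eta> l))"
        using X i False by (intro sum_mono column) auto
      finally show ?thesis by (simp add: fam_norm_def sum_distrib_left)
    qed
    then have "fam_norm N n ((lin_op N A n X ^^ m) \<eta>) \<le> (\<Sum>i<N. C * fam_norm N n \<eta>)"
      unfolding fam_norm_def[of N n "(lin_op N A n X ^^ m) \<eta>"] by (intro sum_mono) auto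
    then show ?thesis by (simp add: distrib_right add_increasing)
  qed
  moreover have "1 + real N * C \<ge> 0" using C by simp
  ultimately show ?thesis by blast
qed

text \<open>In the norm \<open>sup\<^sub>m \<parallel>L(X)\<^bsup>m\<^esup> \<eta>\<parallel>\<close>, which is equivalent to the given one, \<open>L(X)\<close> is a
  contraction, so \<open>\<eta> = \<zeta> + r L(X) \<eta>\<close> gives \<open>(1 - r) \<parallel>\<eta>\<parallel> \<le> \<parallel>\<zeta>\<parallel>\<close>.\<close>

theorem resolvent_growth:
  "\<exists>C\<ge>0. \<forall>n X r \<eta> \<zeta>. 0 < n \<longrightarrow> contractive Q n X \<longrightarrow> 0 \<le> r \<longrightarrow> r < 1 \<longrightarrow>
     (\<forall>i<N. \<forall>a<n. \<eta> i a = \<zeta> i a + complex_of_real r * lin_op N A n X \<eta> i a) \<longrightarrow>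
     (1 - r) * fam_norm N n \<eta> \<le> C * fam_norm N n \<zeta>"
proof -
  obtain C where C: "C \<ge> 0" and pow: "\<And>n X m \<eta>. 0 < n \<Longrightarrow> contractive Q n X \<Longrightarrow>
      fam_norm N n ((lin_op N A n X ^^ m) \<eta>) \<le> C * fam_norm N n \<eta>"
    using power_bounded by blast
  have "(1 - r) * fam_norm N n \<eta> \<le> C * fam_norm N n \<zeta>"
    if X: "0 < n" "contractive Q n X" and r: "0 \<le> r" "r < 1"
      and eq: "\<forall>i<N. \<forall>a<n. \<eta> i a = \<zeta> i a + complex_of_real r * lin_op N A n X \<eta> i a"
    for n X r \<eta> \<zeta>
  proof -
    define M where "M = (SUP m. fam_norm N n ((lin_op N A n X ^^ m) \<eta>))"
    have bdd: "bdd_above (range (\<lambda>m. fam_norm N n ((lin_op N A n X ^^ m) \<eta>)))"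
      using pow[OF X] by (intro bdd_aboveI2)
    have le_M: "fam_norm N n ((lin_op N A n X ^^ m) \<eta>) \<le> M" for m
      unfolding M_def by (intro cSUP_upper bdd) simp
    have "fam_norm N n ((lin_op N A n X ^^ m) \<eta>) \<le> C * fam_norm N n \<zeta> + r * M" for m
    proof -
      have "fam_norm N n ((lin_op N A n X ^^ m) \<eta>)
          = fam_norm N n ((lin_op N A n X ^^ m) (\<lambda>i a. \<zeta> i a + complex_of_real r * lin_op N A n X \<eta> i a))"
        using eq by (intro fam_norm_cong lin_op_pow_cong) auto
      also have "\<dots> = fam_norm N n (\<lambda>i a. (lin_op N A n X ^^ m) \<zeta> i a + complex_of_real r * (lin_op N A n X ^^ Suc m) \<eta> i a)"
        by (simp only: lin_op_pow_linear funpow_Suc_right o_apply)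
      also have "\<dots> \<le> fam_norm N n ((lin_op N A n X ^^ m) \<zeta>) + r * fam_norm N n ((lin_op N A n X ^^ Suc m) \<eta>)"
        using fam_norm_triangle[of N n "(lin_op N A n X ^^ m) \<zeta>" "\<lambda>i a. complex_of_real r * (lin_op N A n X ^^ Suc m) \<eta> i a"] r
        by (simp only: fam_norm_mult norm_of_real abs_of_nonneg)
      also have "\<dots> \<le> C * fam_norm N n \<zeta> + r * M"
        by (intro add_mono pow X mult_left_mono le_M r)
      finally show ?thesis .
    qed
    then have "M \<le> C * fam_norm N n \<zeta> + r * M" unfolding M_def by (intro cSUP_least) auto
    then have "(1 - r) * M \<le> C * fam_norm N n \<zeta>" by (simp add: algebra_simps)
    moreover have "(1 - r) * fam_norm N n \<eta> \<le> (1 - r) * M"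
      using le_M[of 0] r by (intro mult_left_mono) auto
    ultimately show ?thesis by linarith
  qed
  with C show ?thesis by blast
qed

end

end

section \<open>Growth of the inverse\<close>

lemma act_lin_entry: "(\<Sum>l<N. act n X (lin_entry A i l) (\<eta> l) a) = lin_op N A n X \<eta> i a"
proof -
  have "act n X (lin_entry A i l) (\<eta> l) a = (\<Sum>j\<in>UNIV. A j i l * (\<Sum>b<n. X j a b * \<eta> l b))" for l
  proof -
    have "act n X (const c) h = (\<lambda>b. c * h b)" for c h by (rule ext) simp
    then show ?thesis
      by (simp add: lin_entry_def act_sum act_mult sum_distrib_left mult_ac)
  qed
  then show ?thesis by (simp add: lin_op_def)
qed

lemma one_minus_power_le:
  fixes r :: real
  assumes "0 \<le> r" "r \<le> 1"
  shows "1 - r ^ m \<le> real m * (1 - r)"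
proof (induction m)
  case (Suc m)
  have "r ^ m * (1 - r) \<le> 1 * (1 - r)" using assms by (intro mult_right_mono power_le_one) auto
  then show ?case using Suc by (simp add: algebra_simps)
qed simp

lemma fam_norm_matrix_le:
  assumes T: "\<And>i l. i < K \<Longrightarrow> l < L \<Longrightarrow> norm2 n (T i l) \<le> c * C i l * norm2 n (y l)"
    and C: "\<And>i l. 0 \<le> C i l" and c: "0 \<le> c"
  shows "fam_norm K n (\<lambda>i a. \<Sum>l<L. T i l a) \<le> c * (\<Sum>i<K. \<Sum>l<L. C i l) * fam_norm L n y"
proof -
  have "fam_norm K n (\<lambda>i a. \<Sum>l<L. T i l a) \<le> (\<Sum>i<K. \<Sum>l<L. norm2 n (T i l))"
    unfolding fam_norm_def by (intro sum_mono norm2_sum)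
  also have "\<dots> \<le> (\<Sum>i<K. \<Sum>l<L. c * C i l * fam_norm L n y)"
  proof (intro sum_mono)
    fix i l assume il: "i \<in> {..<K}" "l \<in> {..<L}"
    have "norm2 n (T i l) \<le> c * C i l * norm2 n (y l)" using T il by simp
    also have "\<dots> \<le> c * C i l * fam_norm L n y"
      using il C c by (intro mult_left_mono fam_norm_member) auto
    finally show "norm2 n (T i l) \<le> c * C i l * fam_norm L n y" .
  qed
  finally show ?thesis by (simp add: sum_distrib_left sum_distrib_right mult.assoc)
qed

locale operator_ball = bounded_tuple Q
  for Q :: "'d::finite \<Rightarrow> 'h \<Rightarrow> 'h::complex_hilbert_space" +
  assumes coordinates: "\<exists>M\<ge>0. \<forall>n X j h. contractive Q n X \<longrightarrow> norm2 n (\<lambda>a. \<Sum>b<n. X j a b * h b) \<le> M * norm2 n h"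
begin

lemma word_act_bounded: "\<exists>M\<ge>0. \<forall>n X w h. contractive Q n X \<longrightarrow> norm2 n (word_act n X w h) \<le> M ^ length w * norm2 n h"
proof -
  obtain M where M: "M \<ge> 0" "\<And>n X j h. contractive Q n X \<Longrightarrow> norm2 n (\<lambda>a. \<Sum>b<n. X j a b * h b) \<le> M * norm2 n h"
    using coordinates by blast
  have "norm2 n (word_act n X w h) \<le> M ^ length w * norm2 n h" if X: "contractive Q n X" for n X w h
  proof (induction w)
    case (Cons j w)
    have "norm2 n (word_act n X (j # w) h) \<le> M * norm2 n (word_act n X w h)" using M(2)[OF X] by simp
    also have "\<dots> \<le> M * (M ^ length w * norm2 n h)" using Cons M(1) by (rule mult_left_mono)
    finally show ?case by simp
  qed simp
  with M(1) show ?thesis by blast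
qed

lemma act_bounded: "\<exists>C\<ge>0. \<forall>n X h. contractive Q n X \<longrightarrow> norm2 n (act n X p h) \<le> C * norm2 n h"
proof -
  obtain M where M: "M \<ge> 0" "\<And>n X w h. contractive Q n X \<Longrightarrow> norm2 n (word_act n X w h) \<le> M ^ length w * norm2 n h"
    using word_act_bounded by blast
  define C where "C = (\<Sum>w\<in>Poly_Mapping.keys p. cmod (lookup p w) * M ^ length (letters w))"
  have "norm2 n (act n X p h) \<le> C * norm2 n h" if X: "contractive Q n X" for n X h
  proof -
    have "norm2 n (act n X p h) \<le> (\<Sum>w\<in>Poly_Mapping.keys p. norm2 n (\<lambda>a. lookup p w * word_act n X (letters w) h a))"
      unfolding act_def[abs_def] by (rule norm2_sum)
    also have "\<dots> \<le> (\<Sum>w\<in>Poly_Mapping.keys p. cmod (lookup p w) * (M ^ length (letters w) * norm2 n h))"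
      unfolding norm2_mult by (intro sum_mono mult_left_mono M X) auto
    finally show ?thesis by (simp add: C_def sum_distrib_right mult.assoc)
  qed
  moreover have "C \<ge> 0" unfolding C_def using M by (intro sum_nonneg) auto
  ultimately show ?thesis by blast
qed

text \<open>On a word of length \<open>m\<close> the difference is \<open>1 - r\<^sup>m \<le> m (1 - r)\<close> times the action of the
  word.\<close>

lemma act_dilation_close:
  "\<exists>C\<ge>0. \<forall>n X r h. contractive Q n X \<longrightarrow> 0 \<le> r \<longrightarrow> r < 1 \<longrightarrow>
     norm2 n (\<lambda>a. act n X p h a - act n (dilate r X) p h a) \<le> (1 - r) * C * norm2 n h"
proof -
  obtain M where M: "M \<ge> 0" "\<And>n X w h. contractive Q n X \<Longrightarrow> norm2 n (word_act n X w h) \<le> M ^ length w * norm2 n h"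
    using word_act_bounded by blast
  define C where "C = (\<Sum>w\<in>Poly_Mapping.keys p. cmod (lookup p w) * (real (length (letters w)) * M ^ length (letters w)))"
  have "norm2 n (\<lambda>a. act n X p h a - act n (dilate r X) p h a) \<le> (1 - r) * C * norm2 n h"
    if X: "contractive Q n X" and r: "0 \<le> r" "r < 1" for n X r h
  proof -
    define c where "c w = lookup p w * complex_of_real (1 - r ^ length (letters w))" for w
    have "act n X p h a - act n (dilate r X) p h a
        = (\<Sum>w\<in>Poly_Mapping.keys p. c w * word_act n X (letters w) h a)" for a
      by (simp add: act_def word_act_scale c_def sum_subtractf algebra_simps)
    then have "norm2 n (\<lambda>a. act n X p h a - act n (dilate r X) p h a)
        \<le> (\<Sum>w\<in>Poly_Mapping.keys p. norm2 n (\<lambda>a. c w * word_act n X (letters w) h a))"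
      by (simp only:) (rule norm2_sum)
    also have "\<dots> \<le> (\<Sum>w\<in>Poly_Mapping.keys p. cmod (lookup p w) * (real (length (letters w)) * (1 - r)) * (M ^ length (letters w) * norm2 n h))"
      unfolding norm2_mult
    proof (intro sum_mono mult_mono M X)
      fix w :: "'d nc_word"
      have "cmod (complex_of_real (1 - r ^ length (letters w))) \<le> real (length (letters w)) * (1 - r)"
        using one_minus_power_le[of r "length (letters w)"] r power_le_one[of r "length (letters w)"]
        by (simp only: norm_of_real) simp
      then show "cmod (c w) \<le> cmod (lookup p w) * (real (length (letters w)) * (1 - r))"
        unfolding c_def norm_mult by (intro mult_left_mono) auto
    qed (use r M in auto)
    also have "\<dots> = (1 - r) * C * norm2 n h"
      by (simp add: C_def sum_distrib_left sum_distrib_right mult_ac)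
    finally show ?thesis .
  qed
  moreover have "C \<ge> 0" unfolding C_def using M by (intro sum_nonneg) auto
  ultimately show ?thesis by blast
qed

lemma matrix_act_bounded:
  "\<exists>C\<ge>0. \<forall>n X y. contractive Q n X \<longrightarrow> fam_norm K n (mat_act L n X M y) \<le> C * fam_norm L n y"
proof -
  have "\<forall>i. \<exists>C. \<forall>l. 0 \<le> C l \<and> (\<forall>n X h. contractive Q n X \<longrightarrow> norm2 n (act n X (M i l) h) \<le> C l * norm2 n h)"
    using act_bounded by (intro allI choice) blast
  from choice[OF this] obtain C where C: "\<And>i l. 0 \<le> C i l"
    "\<And>i l n X h. contractive Q n X \<Longrightarrow> norm2 n (act n X (M i l) h) \<le> C i l * norm2 n h" by blast
  have "fam_norm K n (mat_act L n X M y) \<le> 1 * (\<Sum>i<K. \<Sum>l<L. C i l) * fam_norm L n y"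
    if "contractive Q n X" for n X y
    by (rule fam_norm_matrix_le) (use C that in auto)
  then show ?thesis by (intro exI[of _ "\<Sum>i<K. \<Sum>l<L. C i l"]) (auto intro!: sum_nonneg C)
qed

lemma matrix_act_dilation_close:
  "\<exists>C\<ge>0. \<forall>n X r y. contractive Q n X \<longrightarrow> 0 \<le> r \<longrightarrow> r < 1 \<longrightarrow>
     fam_norm K n (\<lambda>i a. mat_act L n X M y i a - mat_act L n (dilate r X) M y i a)
     \<le> (1 - r) * C * fam_norm L n y"
proof -
  have "\<forall>i. \<exists>C. \<forall>l. 0 \<le> C l \<and> (\<forall>n X r h. contractive Q n X \<longrightarrow> 0 \<le> r \<longrightarrow> r < 1 \<longrightarrow>
     norm2 n (\<lambda>a. act n X (M i l) h a - act n (dilate r X) (M i l) h a) \<le> (1 - r) * C l * norm2 n h)"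
    using act_dilation_close by (intro allI choice) blast
  from choice[OF this] obtain C where C: "\<And>i l. 0 \<le> C i l"
    "\<And>i l n X r h. contractive Q n X \<Longrightarrow> 0 \<le> r \<Longrightarrow> r < 1 \<Longrightarrow>
     norm2 n (\<lambda>a. act n X (M i l) h a - act n (dilate r X) (M i l) h a) \<le> (1 - r) * C i l * norm2 n h" by blast
  have "fam_norm K n (\<lambda>i a. mat_act L n X M y i a - mat_act L n (dilate r X) M y i a)
     \<le> (1 - r) * (\<Sum>i<K. \<Sum>l<L. C i l) * fam_norm L n y"
    if "contractive Q n X" "0 \<le> r" "r < 1" for n X r y
    unfolding sum_subtractf[symmetric]
    by (rule fam_norm_matrix_le) (use C that in auto)
  then show ?thesis by (intro exI[of _ "\<Sum>i<K. \<Sum>l<L. C i l"]) (auto intro!: sum_nonneg C)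
qed

end

locale stable_atom = operator_ball Q + invertible_at_zero_atom k P Ci
  for Q :: "'d::finite \<Rightarrow> 'h \<Rightarrow> 'h::complex_hilbert_space" and k :: nat
    and P :: "nat \<Rightarrow> nat \<Rightarrow> 'd nc_poly" and Ci :: "nat \<Rightarrow> nat \<Rightarrow> complex" +
  assumes injective: "\<And>n X \<mu> y i a. 0 < n \<Longrightarrow> contractive Q n X \<Longrightarrow> cmod \<mu> < 1 \<Longrightarrow>
      (\<And>i a. i < k \<Longrightarrow> a < n \<Longrightarrow> (mat_act k n (\<lambda>j a b. \<mu> * X j a b) P y i a) = 0) \<Longrightarrow>
      i < k \<Longrightarrow> a < n \<Longrightarrow> y i a = 0"
begin

text \<open>For the pencil of \<open>stable_association\<close>, stability follows from that of \<open>P\<close>: if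
  \<open>(1 - L) \<eta> = 0\<close> at a point of the ball, then \<open>P a \<eta> = e (1 - L) \<eta> = 0\<close>, so \<open>a \<eta> = 0\<close> and
  \<open>\<eta> = v a \<eta> + c (1 - L) \<eta> = 0\<close>. For \<open>z = P y\<close>, the vector \<open>\<eta> = v y\<close> solves \<open>(1 - L) \<eta> = H z\<close>, so
  \<open>resolvent_growth\<close> bounds it, and \<open>y = a \<eta> + b z\<close>.\<close>

theorem inverse_growth:
  "\<exists>C\<ge>0. \<forall>n X r y. 0 < n \<longrightarrow> contractive Q n X \<longrightarrow> 0 \<le> r \<longrightarrow> r < 1 \<longrightarrow>
     (1 - r) * fam_norm k n y \<le> C * fam_norm k n (mat_act k n (dilate r X) P y)"
  using stable_association
proof (elim disjE exE conjE)
  fix q assume q: "\<forall>i<k. \<forall>m<k. mprod k q P i m = delta i m"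
  obtain C where C: "C \<ge> 0" "\<And>n X y. contractive Q n X \<Longrightarrow> fam_norm k n (mat_act k n X q y) \<le> C * fam_norm k n y"
    using matrix_act_bounded by blast
  have "(1 - r) * fam_norm k n y \<le> C * fam_norm k n (mat_act k n (dilate r X) P y)"
    if X: "contractive Q n X" and r: "0 \<le> r" "r < 1" for n X r y
  proof -
    define Y where "Y j a b = complex_of_real r * X j a b" for j a b
    have Y: "contractive Q n Y" using contractive_mult[OF X, of "complex_of_real r"] r by (simp add: Y_def[abs_def])
    have "y i a = (\<Sum>l<k. act n Y (q i l) (mat_act k n Y P y l) a)" if "i < k" for i a
    proof -
      have "(\<Sum>l<k. act n Y (q i l) (mat_act k n Y P y l) a)
          = mat_act k n Y delta y i a"
        unfolding act_matrix_mult[symmetric] using q that by (intro sum.cong) auto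
      also have "\<dots> = (\<Sum>m<k. if m = i then y m a else 0)" by (intro sum.cong) auto
      finally show ?thesis using that by simp
    qed
    then have "fam_norm k n y = fam_norm k n (\<lambda>i a. \<Sum>l<k. act n Y (q i l) (mat_act k n Y P y l) a)"
      by (intro fam_norm_cong)
    also have "\<dots> \<le> C * fam_norm k n (mat_act k n Y P y)" by (rule C(2)[OF Y])
    finally have "fam_norm k n y \<le> C * fam_norm k n (mat_act k n Y P y)" .
    moreover have "(1 - r) * fam_norm k n y \<le> 1 * fam_norm k n y" using r by (intro mult_right_mono) auto
    ultimately show ?thesis by (simp add: Y_def[abs_def])
  qed
  with C(1) show ?thesis by blast
next
  fix N A v H a b c e
  assume irr: "irreducible_tuple N A"
    and vH: "\<forall>i<N. \<forall>m<k. v i m = mprod k H P i m + mprod N (lin_entry A) v i m"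
    and ab: "\<forall>i<k. \<forall>m<k. mprod N a v i m + mprod k b P i m = delta i m"
    and c: "\<forall>i<N. \<forall>m<N. mprod k v a i m + (c i m - mprod N c (lin_entry A) i m) = delta i m"
    and e: "\<forall>i<k. \<forall>m<N. mprod k P a i m = e i m - mprod N e (lin_entry A) i m"
  have "stable_pencil Q N A"
    unfolding stable_pencil_def
  proof (intro allI impI)
    fix n X \<mu> \<eta> i0 a0
    assume n: "0 < n" and X: "contractive Q n X" and \<mu>: "cmod \<mu> < 1"
      and \<eta>: "\<forall>i<N. \<forall>a<n. \<eta> i a = \<mu> * lin_op N A n X \<eta> i a" and i0: "i0 < N" and a0: "a0 < n"
    define Y where "Y j a b = \<mu> * X j a b" for j a b
    have \<eta>Y: "(\<Sum>l<N. act n Y (lin_entry A i l) (\<eta> l) x) = \<eta> i x" if "i < N" "x < n" for i x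
      unfolding act_lin_entry using \<eta> that by (simp add: Y_def[abs_def] lin_op_mult)
    \<comment> \<open>Multiples of \<open>1 - L\<close> annihilate \<open>\<eta>\<close>.\<close>
    have drop: "(\<Sum>m<N. act n Y (f m - (\<Sum>l<N. f l * lin_entry A l m)) (\<eta> m) x) = 0" if x: "x < n" for f x
    proof -
      have "(\<Sum>m<N. act n Y (\<Sum>l<N. f l * lin_entry A l m) (\<eta> m) x)
          = (\<Sum>l<N. act n Y (f l) (\<lambda>b. \<Sum>m<N. act n Y (lin_entry A l m) (\<eta> m) b) x)"
        by (rule act_matrix_mult)
      also have "\<dots> = (\<Sum>l<N. act n Y (f l) (\<eta> l) x)"
        using x by (intro sum.cong refl act_cong) (auto simp: \<eta>Y)
      finally show ?thesis by (simp add: act_diff sum_subtractf)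
    qed
    define \<alpha> where "\<alpha> l x = mat_act N n Y a \<eta> l x" for l x
    have \<alpha>0: "\<alpha> l x = 0" if "l < k" "x < n" for l x
    proof (rule injective[OF n X \<mu> _ that])
      fix i x assume i: "i < k" and x: "x < n"
      have "mat_act k n Y P \<alpha> i x = (\<Sum>m<N. act n Y (mprod k P a i m) (\<eta> m) x)"
        unfolding \<alpha>_def[abs_def] by (rule act_matrix_mult[symmetric])
      also have "\<dots> = (\<Sum>m<N. act n Y (e i m - mprod N e (lin_entry A) i m) (\<eta> m) x)"
        using e i by (intro sum.cong) auto
      also have "\<dots> = 0" by (rule drop[OF x])
      finally show "mat_act k n (\<lambda>j a b. \<mu> * X j a b) P \<alpha> i x = 0" by (simp add: Y_def[abs_def])
    qed
    have "\<eta> i0 a0 = (\<Sum>m<N. if m = i0 then \<eta> m a0 else 0)" using i0 by simp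
    also have "\<dots> = mat_act N n Y delta \<eta> i0 a0" by (intro sum.cong) auto
    also have "\<dots> = (\<Sum>m<N. act n Y (mprod k v a i0 m + (c i0 m - mprod N c (lin_entry A) i0 m)) (\<eta> m) a0)"
      using c i0 by (intro sum.cong) auto
    also have "\<dots> = (\<Sum>m<N. act n Y (mprod k v a i0 m) (\<eta> m) a0)"
      using drop[OF a0, of "c i0"] by (simp add: act_add sum.distrib)
    also have "\<dots> = mat_act k n Y v \<alpha> i0 a0"
      unfolding \<alpha>_def[abs_def] by (rule act_matrix_mult)
    also have "\<dots> = (\<Sum>l<k. act n Y (v i0 l) (\<lambda>b. 0) a0)"
      using a0 by (intro sum.cong refl act_cong) (auto simp: \<alpha>0)
    finally show "\<eta> i0 a0 = 0" by simp
  qed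
  from resolvent_growth[OF irr this] obtain C where C: "C \<ge> 0" and growth:
    "\<And>n X r \<eta> \<zeta>. 0 < n \<Longrightarrow> contractive Q n X \<Longrightarrow> 0 \<le> r \<Longrightarrow> r < 1 \<Longrightarrow>
     (\<forall>i<N. \<forall>a<n. \<eta> i a = \<zeta> i a + complex_of_real r * lin_op N A n X \<eta> i a) \<Longrightarrow>
     (1 - r) * fam_norm N n \<eta> \<le> C * fam_norm N n \<zeta>" by blast
  obtain CH where CH: "CH \<ge> 0" "\<And>n X y. contractive Q n X \<Longrightarrow> fam_norm N n (mat_act k n X H y) \<le> CH * fam_norm k n y"
    using matrix_act_bounded by blast
  obtain Ca where Ca: "Ca \<ge> 0" "\<And>n X y. contractive Q n X \<Longrightarrow> fam_norm k n (mat_act N n X a y) \<le> Ca * fam_norm N n y"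
    using matrix_act_bounded by blast
  obtain Cb where Cb: "Cb \<ge> 0" "\<And>n X y. contractive Q n X \<Longrightarrow> fam_norm k n (mat_act k n X b y) \<le> Cb * fam_norm k n y"
    using matrix_act_bounded by blast
  have "(1 - r) * fam_norm k n y \<le> (Ca * (C * CH) + Cb) * fam_norm k n (mat_act k n (dilate r X) P y)"
    if n: "0 < n" and X: "contractive Q n X" and r: "0 \<le> r" "r < 1" for n X r y
  proof -
    define Y where "Y j a b = complex_of_real r * X j a b" for j a b
    have Y: "contractive Q n Y" using contractive_mult[OF X, of "complex_of_real r"] r by (simp add: Y_def[abs_def])
    define z where "z i x = mat_act k n Y P y i x" for i x
    define \<eta> where "\<eta> i x = mat_act k n Y v y i x" for i x
    define \<zeta> where "\<zeta> i x = mat_act k n Y H z i x" for i x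
    have "\<eta> i x = \<zeta> i x + complex_of_real r * lin_op N A n X \<eta> i x" if i: "i < N" for i x
    proof -
      have "\<zeta> i x = (\<Sum>m<k. act n Y (mprod k H P i m) (y m) x)"
        unfolding \<zeta>_def z_def[abs_def] by (rule act_matrix_mult[symmetric])
      moreover have "(\<Sum>l<N. act n Y (lin_entry A i l) (\<eta> l) x)
          = (\<Sum>m<k. act n Y (mprod N (lin_entry A) v i m) (y m) x)"
        unfolding \<eta>_def[abs_def] by (rule act_matrix_mult[symmetric])
      moreover have "\<eta> i x = (\<Sum>m<k. act n Y (mprod k H P i m) (y m) x
          + act n Y (mprod N (lin_entry A) v i m) (y m) x)"
        unfolding \<eta>_def
      proof (rule sum.cong[OF refl])
        fix m assume "m \<in> {..<k}"
        then have v: "v i m = mprod k H P i m + mprod N (lin_entry A) v i m" using vH i by blast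
        show "act n Y (v i m) (y m) x = act n Y (mprod k H P i m) (y m) x
          + act n Y (mprod N (lin_entry A) v i m) (y m) x"
          by (subst v) (rule act_add)
      qed
      ultimately have "\<eta> i x = \<zeta> i x + (\<Sum>l<N. act n Y (lin_entry A i l) (\<eta> l) x)"
        by (simp only: sum.distrib)
      then show ?thesis unfolding act_lin_entry by (simp only: Y_def[abs_def] lin_op_mult)
    qed
    then have "(1 - r) * fam_norm N n \<eta> \<le> C * fam_norm N n \<zeta>" by (intro growth[OF n X r]) auto
    also have "\<dots> \<le> C * (CH * fam_norm k n z)"
      unfolding \<zeta>_def[abs_def] by (intro mult_left_mono C CH(2) Y)
    finally have \<eta>: "(1 - r) * fam_norm N n \<eta> \<le> C * CH * fam_norm k n z" by (simp add: mult.assoc)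
    have "y i x = mat_act N n Y a \<eta> i x + mat_act k n Y b z i x" if i: "i < k" for i x
    proof -
      have "mat_act N n Y a \<eta> i x = (\<Sum>m<k. act n Y (mprod N a v i m) (y m) x)"
        unfolding \<eta>_def[abs_def] by (rule act_matrix_mult[symmetric])
      moreover have "mat_act k n Y b z i x = (\<Sum>m<k. act n Y (mprod k b P i m) (y m) x)"
        unfolding z_def[abs_def] by (rule act_matrix_mult[symmetric])
      ultimately have "mat_act N n Y a \<eta> i x + mat_act k n Y b z i x
          = (\<Sum>m<k. act n Y (mprod N a v i m + mprod k b P i m) (y m) x)"
        by (simp only: act_add sum.distrib)
      also have "\<dots> = mat_act k n Y delta y i x"
        using ab i by (intro sum.cong) auto
      also have "\<dots> = (\<Sum>m<k. if m = i then y m x else 0)" by (intro sum.cong) auto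
      finally show ?thesis using i by simp
    qed
    then have "fam_norm k n y = fam_norm k n (\<lambda>i x. mat_act N n Y a \<eta> i x + mat_act k n Y b z i x)"
      by (intro fam_norm_cong)
    also have "\<dots> \<le> fam_norm k n (mat_act N n Y a \<eta>) + fam_norm k n (mat_act k n Y b z)"
      by (rule fam_norm_triangle)
    also have "\<dots> \<le> Ca * fam_norm N n \<eta> + Cb * fam_norm k n z" by (intro add_mono Ca Cb Y)
    finally have "(1 - r) * fam_norm k n y \<le> (1 - r) * (Ca * fam_norm N n \<eta> + Cb * fam_norm k n z)"
      using r by (intro mult_left_mono) auto
    also have "\<dots> = Ca * ((1 - r) * fam_norm N n \<eta>) + (1 - r) * (Cb * fam_norm k n z)" by (simp add: algebra_simps)
    also have "\<dots> \<le> Ca * (C * CH * fam_norm k n z) + 1 * (Cb * fam_norm k n z)"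
      using r Ca Cb by (intro add_mono mult_left_mono mult_right_mono \<eta>) auto
    finally have "(1 - r) * fam_norm k n y \<le> (Ca * (C * CH) + Cb) * fam_norm k n z" by (simp add: algebra_simps)
    then show ?thesis by (simp add: z_def[abs_def] Y_def[abs_def])
  qed
  moreover have "Ca * (C * CH) + Cb \<ge> 0" using C CH Ca Cb by simp
  ultimately show ?thesis by blast
qed

text \<open>The growth of the inverse against the decay of \<open>P(X) - P(rX)\<close>. In the first part
  \<open>P(rX) y = P(X) z\<close>, so that \<open>P(rX) (y - z) = (P(X) - P(rX)) z\<close>; in the second,
  \<open>P(X) y = P(rX) y + (P(X) - P(rX)) y\<close>.\<close>

theorem dilation_quotients_bounded:
  "\<exists>C\<ge>0. \<forall>n X r y z. 0 < n \<longrightarrow> contractive Q n X \<longrightarrow> 0 \<le> r \<longrightarrow> r < 1 \<longrightarrow>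
     ((\<forall>i<k. \<forall>a<n. mat_act k n (dilate r X) P y i a
          = mat_act k n X P z i a) \<longrightarrow> fam_norm k n y \<le> C * fam_norm k n z) \<and>
     fam_norm k n (mat_act k n X P y)
       \<le> C * fam_norm k n (mat_act k n (dilate r X) P y)"
proof -
  obtain C where C: "C \<ge> 0" "\<And>n X r y. 0 < n \<Longrightarrow> contractive Q n X \<Longrightarrow> 0 \<le> r \<Longrightarrow> r < 1 \<Longrightarrow>
     (1 - r) * fam_norm k n y \<le> C * fam_norm k n (mat_act k n (dilate r X) P y)"
    using inverse_growth by blast
  obtain D where D: "D \<ge> 0" "\<And>n X r y. contractive Q n X \<Longrightarrow> 0 \<le> r \<Longrightarrow> r < 1 \<Longrightarrow>
     fam_norm k n (\<lambda>i a. mat_act k n X P y i a - mat_act k n (dilate r X) P y i a)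
     \<le> (1 - r) * D * fam_norm k n y"
    using matrix_act_dilation_close by blast
  have "fam_norm k n y \<le> (1 + C * D) * fam_norm k n z"
    if n: "0 < n" and X: "contractive Q n X" and r: "0 \<le> r" "r < 1"
      and eq: "\<forall>i<k. \<forall>a<n. mat_act k n (dilate r X) P y i a
          = mat_act k n X P z i a" for n X r y z
  proof -
    define Y where "Y j a b = complex_of_real r * X j a b" for j a b
    have "(1 - r) * fam_norm k n (\<lambda>i a. y i a - z i a)
        \<le> C * fam_norm k n (\<lambda>i a. \<Sum>l<k. act n Y (P i l) (\<lambda>b. y l b - z l b) a)"
      unfolding Y_def by (rule C(2)[OF n X r])
    also have "fam_norm k n (\<lambda>i a. \<Sum>l<k. act n Y (P i l) (\<lambda>b. y l b - z l b) a)
        = fam_norm k n (\<lambda>i a. mat_act k n X P z i a - mat_act k n Y P z i a)"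
      using eq by (intro fam_norm_cong) (simp add: act_arg_diff sum_subtractf Y_def[abs_def])
    also have "C * \<dots> \<le> C * ((1 - r) * D * fam_norm k n z)"
      unfolding Y_def by (intro mult_left_mono D(2) X r C(1))
    finally have "(1 - r) * fam_norm k n (\<lambda>i a. y i a - z i a) \<le> (1 - r) * (C * D * fam_norm k n z)"
      by (simp add: mult_ac)
    then have "fam_norm k n (\<lambda>i a. y i a - z i a) \<le> C * D * fam_norm k n z"
      using r by (simp add: mult_le_cancel_left_pos)
    moreover have "fam_norm k n y \<le> fam_norm k n z + fam_norm k n (\<lambda>i a. y i a - z i a)"
      using fam_norm_triangle[of k n z "\<lambda>i a. y i a - z i a"] by simp
    ultimately show ?thesis by (simp add: algebra_simps)
  qed
  moreover have "fam_norm k n (mat_act k n X P y)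
       \<le> (1 + C * D) * fam_norm k n (mat_act k n (dilate r X) P y)"
    if n: "0 < n" and X: "contractive Q n X" and r: "0 \<le> r" "r < 1" for n X r y
  proof -
    define z where "z i a = mat_act k n (dilate r X) P y i a" for i a
    have "fam_norm k n (mat_act k n X P y)
        \<le> fam_norm k n z + fam_norm k n (\<lambda>i a. mat_act k n X P y i a - z i a)"
      using fam_norm_triangle[of k n z "\<lambda>i a. mat_act k n X P y i a - z i a"] by simp
    also have "fam_norm k n (\<lambda>i a. mat_act k n X P y i a - z i a) \<le> (1 - r) * D * fam_norm k n y"
      unfolding z_def by (rule D(2)[OF X r])
    also have "\<dots> = D * ((1 - r) * fam_norm k n y)" by simp
    also have "\<dots> \<le> D * (C * fam_norm k n z)"
      unfolding z_def[abs_def] by (intro mult_left_mono C(2) n X r D(1))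
    finally show ?thesis unfolding z_def[abs_def] by (simp add: algebra_simps)
  qed
  moreover have "1 + C * D \<ge> 0" using C(1) D(1) by simp
  ultimately show ?thesis by blast
qed

end

section \<open>Evaluated matrices\<close>

definition entries :: "('d \<Rightarrow> complex mat) \<Rightarrow> 'd \<Rightarrow> nat \<Rightarrow> nat \<Rightarrow> complex" where
  "entries X j a b = X j $$ (a, b)"

text \<open>The vectors \<open>y\<^sub>l\<close> of \<open>v = \<Sum>\<^sub>l e\<^sub>l \<otimes> y\<^sub>l\<close> in the index convention of the Kronecker product.\<close>

abbreviation blocks :: "nat \<Rightarrow> complex vec \<Rightarrow> nat \<Rightarrow> nat \<Rightarrow> complex" where
  "blocks n v l b \<equiv> v $ (l * n + b)"

abbreviation poly_entries :: "'d nc_poly mat \<Rightarrow> nat \<Rightarrow> nat \<Rightarrow> 'd nc_poly" where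
  "poly_entries P i l \<equiv> P $$ (i, l)"

lemma word_eval_carrier:
  assumes "\<And>j. X j \<in> carrier_mat n n"
  shows "word_eval n X w \<in> carrier_mat n n"
proof -
  have "foldr (\<lambda>j A. X j * A) u (1\<^sub>m n) \<in> carrier_mat n n" for u
    by (induction u) (auto intro!: mult_carrier_mat assms)
  then show ?thesis by (simp add: word_eval_def)
qed

lemma word_eval_entry:
  assumes X: "\<And>j. X j \<in> carrier_mat n n" and "a < n" "b < n"
  shows "word_eval n X w $$ (a, b) = word_act n (entries X) (letters w) (\<lambda>c. delta c b) a"
proof -
  have "foldr (\<lambda>j A. X j * A) u (1\<^sub>m n) $$ (a, b) = word_act n (entries X) u (\<lambda>c. delta c b) a"
    if "a < n" for u a
    using that
  proof (induction u arbitrary: a)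
    case Nil
    then show ?case using assms by simp
  next
    case (Cons j u)
    have c: "foldr (\<lambda>j A. X j * A) u (1\<^sub>m n) \<in> carrier_mat n n"
      using word_eval_carrier[of X n "NC_Word u", OF X] by (simp add: word_eval_def)
    have "foldr (\<lambda>j A. X j * A) (j # u) (1\<^sub>m n) $$ (a, b)
        = (\<Sum>c<n. X j $$ (a, c) * foldr (\<lambda>j A. X j * A) u (1\<^sub>m n) $$ (c, b))"
      using c X[of j] Cons.prems \<open>b < n\<close> by (simp add: times_mat_def scalar_prod_def atLeast0LessThan)
    also have "\<dots> = (\<Sum>c<n. entries X j a c * word_act n (entries X) u (\<lambda>c. delta c b) c)"
    proof (rule sum.cong[OF refl])
      fix c assume "c \<in> {..<n}"
      then show "X j $$ (a, c) * foldr (\<lambda>j A. X j * A) u (1\<^sub>m n) $$ (c, b)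
          = entries X j a c * word_act n (entries X) u (\<lambda>c. delta c b) c"
        by (subst entries_def) (simp add: Cons.IH)
    qed
    finally show ?case by simp
  qed
  then show ?thesis using assms by (simp add: word_eval_def)
qed

lemma index_less: "i < k \<Longrightarrow> a < n \<Longrightarrow> i * n + a < k * (n :: nat)"
proof -
  assume "i < k" "a < n"
  then have "i * n + a < Suc i * n" by simp
  also have "\<dots> \<le> k * n" using \<open>i < k\<close> by (intro mult_le_mono1) simp
  finally show "i * n + a < k * n" .
qed

lemma nc_eval_entry:
  assumes P: "P \<in> carrier_mat k k" and X: "\<And>j. X j \<in> carrier_mat n n"
    and il: "i < k" "l < k" and ab: "a < n" "b < n"
  shows "nc_eval P n X $$ (i * n + a, l * n + b) = act n (entries X) (P $$ (i, l)) (\<lambda>c. delta c b) a"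
proof -
  have fin: "finite (nc_support P)"
    unfolding nc_support_def by (simp add: elements_mat_def)
  have sub: "Poly_Mapping.keys (P $$ (i, l)) \<subseteq> nc_support P"
    unfolding nc_support_def using elements_matI[OF P il refl] by blast
  have "nc_eval P n X $$ (i * n + a, l * n + b)
      = (\<Sum>w\<in>nc_support P. kron (coeff_mat P w) (word_eval n X w) $$ (i * n + a, l * n + b))"
    using P index_less[OF il(1) ab(1)] index_less[OF il(2) ab(2)] by (simp add: nc_eval_def)
  also have "\<dots> = (\<Sum>w\<in>nc_support P. lookup (P $$ (i, l)) w * word_act n (entries X) (letters w) (\<lambda>c. delta c b) a)"
  proof (rule sum.cong[OF refl])
    fix w
    have W: "dim_row (word_eval n X w) = n" "dim_col (word_eval n X w) = n"
      using word_eval_carrier[of X n w, OF X] by auto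
    show "kron (coeff_mat P w) (word_eval n X w) $$ (i * n + a, l * n + b)
        = lookup (P $$ (i, l)) w * word_act n (entries X) (letters w) (\<lambda>c. delta c b) a"
      using P il ab index_less[OF il(1) ab(1)] index_less[OF il(2) ab(2)]
      by (simp add: kron_def coeff_mat_def W word_eval_entry[of X, OF X])
  qed
  also have "\<dots> = act n (entries X) (P $$ (i, l)) (\<lambda>c. delta c b) a"
    by (rule act_superset[OF fin sub, symmetric])
  finally show ?thesis .
qed

lemma nc_eval_carrier: "P \<in> carrier_mat k k \<Longrightarrow> nc_eval P n X \<in> carrier_mat (k * n) (k * n)"
  by (auto simp: nc_eval_def)

lemma nc_eval_mult_vec:
  assumes P: "P \<in> carrier_mat k k" and X: "\<And>j. X j \<in> carrier_mat n n"
    and v: "v \<in> carrier_vec (k * n)" and i: "i < k" and a: "a < n"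
  shows "(nc_eval P n X *\<^sub>v v) $ (i * n + a) = mat_act k n (entries X) (poly_entries P) (blocks n v) i a"
proof -
  have "(nc_eval P n X *\<^sub>v v) $ (i * n + a) = (\<Sum>q<k * n. nc_eval P n X $$ (i * n + a, q) * v $ q)"
    using nc_eval_carrier[OF P, of n X] v index_less[OF i a]
    by (simp add: scalar_prod_def atLeast0LessThan)
  also have "\<dots> = (\<Sum>l<k. \<Sum>b<n. nc_eval P n X $$ (i * n + a, l * n + b) * v $ (l * n + b))"
    by (rule sum_blocks)
  also have "\<dots> = (\<Sum>l<k. \<Sum>b<n. v $ (l * n + b) * act n (entries X) (P $$ (i, l)) (\<lambda>c. delta c b) a)"
    using i a by (intro sum.cong) (auto simp: nc_eval_entry[OF P X])
  also have "\<dots> = mat_act k n (entries X) (poly_entries P) (blocks n v) i a"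
    by (intro sum.cong refl) (rule act_expand[OF a, symmetric])
  finally show ?thesis .
qed

lemma vec_l2norm_eq: "v \<in> carrier_vec m \<Longrightarrow> vec_l2norm v = norm2 m (\<lambda>p. v $ p)"
  by (auto simp: vec_l2norm_def norm2_def)

lemma vec_l2norm_le_fam_norm:
  assumes "v \<in> carrier_vec (k * n)"
  shows "vec_l2norm v \<le> fam_norm k n (blocks n v)"
proof -
  have "vec_l2norm v = L2_set (\<lambda>l. norm2 n (\<lambda>b. v $ (l * n + b))) {..<k}"
  proof -
    have "vec_l2norm v = sqrt ((norm2 (k * n) (\<lambda>p. v $ p))\<^sup>2)"
      using assms by (simp add: vec_l2norm_eq)
    then show ?thesis unfolding norm2_blocks L2_set_def .
  qed
  also have "\<dots> \<le> fam_norm k n (blocks n v)"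
    unfolding fam_norm_def by (rule L2_set_le_sum) auto
  finally show ?thesis .
qed

lemma fam_norm_le_vec_l2norm:
  assumes "v \<in> carrier_vec (k * n)"
  shows "fam_norm k n (blocks n v) \<le> real k * vec_l2norm v"
proof -
  have "norm2 n (\<lambda>b. v $ (l * n + b)) \<le> vec_l2norm v" if "l < k" for l
  proof -
    have "(norm2 n (\<lambda>b. v $ (l * n + b)))\<^sup>2 \<le> (norm2 (k * n) (\<lambda>p. v $ p))\<^sup>2"
      unfolding norm2_blocks using that by (intro member_le_sum) auto
    then show ?thesis unfolding vec_l2norm_eq[OF assms] by (rule power2_le_imp_le) simp
  qed
  then have "fam_norm k n (blocks n v) \<le> (\<Sum>l<k. vec_l2norm v)"
    unfolding fam_norm_def by (intro sum_mono) auto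
  then show ?thesis by simp
qed

lemma mat_opnorm_le:
  assumes "A \<in> carrier_mat m m" "\<And>v. v \<in> carrier_vec m \<Longrightarrow> vec_l2norm v \<le> 1 \<Longrightarrow> vec_l2norm (A *\<^sub>v v) \<le> C"
  shows "mat_opnorm A \<le> C"
  unfolding mat_opnorm_def
proof (rule cSUP_least)
  have "vec_l2norm (0\<^sub>v (dim_col A)) \<le> 1"
    by (simp add: vec_l2norm_def L2_set_def)
  then show "{v \<in> carrier_vec (dim_col A). vec_l2norm v \<le> 1} \<noteq> {}" by force
qed (use assms in auto)

lemma nc_stable_injective:
  assumes P: "P \<in> carrier_mat k k" and stable: "nc_stable Q P" and Xball: "(n, X) \<in> nc_ball Q"
    and X: "\<And>j. X j \<in> carrier_mat n n"
    and zero: "\<And>i a. i < k \<Longrightarrow> a < n \<Longrightarrow> (mat_act k n (entries X) (poly_entries P) y i a) = 0"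
    and i: "i < k" and a: "a < n"
  shows "y i a = 0"
proof -
  define v where "v = vec (k * n) (\<lambda>p. y (p div n) (p mod n))"
  have v: "v \<in> carrier_vec (k * n)" by (simp add: v_def)
  have v_entry: "v $ (l * n + b) = y l b" if "l < k" "b < n" for l b
    using that index_less[OF that] by (simp add: v_def)
  have "nc_eval P n X *\<^sub>v v = 0\<^sub>v (k * n)"
  proof (rule eq_vecI)
    fix p assume p: "p < dim_vec (0\<^sub>v (k * n) :: complex vec)"
    then have n: "n > 0" by (cases n) auto
    have il: "p div n < k" "p mod n < n" using p n by (auto simp: less_mult_imp_div_less)
    have "(nc_eval P n X *\<^sub>v v) $ (p div n * n + p mod n)
        = (\<Sum>l<k. act n (entries X) (P $$ (p div n, l)) (\<lambda>b. v $ (l * n + b)) (p mod n))"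
      by (rule nc_eval_mult_vec[OF P X v il])
    also have "\<dots> = (\<Sum>l<k. act n (entries X) (P $$ (p div n, l)) (y l) (p mod n))"
      using il by (intro sum.cong refl act_cong) (auto simp: v_entry)
    also have "\<dots> = 0" by (rule zero[OF il])
    finally show "(nc_eval P n X *\<^sub>v v) $ p = 0\<^sub>v (k * n) $ p" using p by simp
  qed (use nc_eval_carrier[OF P, of n X] in simp)
  moreover have "Determinant.det (nc_eval P n X) \<noteq> 0"
    using stable Xball by (auto simp: nc_stable_def)
  ultimately have "v = 0\<^sub>v (k * n)"
    using det_0_iff_vec_prod_zero_field[OF nc_eval_carrier[OF P, of n X]] v by blast
  then show ?thesis using v_entry[OF i a] index_less[OF i a] by simp
qed

lemma mat_inv_of_stable:
  assumes P: "P \<in> carrier_mat k k" and stable: "nc_stable Q P" and Xball: "(n, X) \<in> nc_ball Q"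
  shows "mat_inv (nc_eval P n X) \<in> carrier_mat (k * n) (k * n)"
    "nc_eval P n X * mat_inv (nc_eval P n X) = 1\<^sub>m (k * n)"
    "mat_inv (nc_eval P n X) * nc_eval P n X = 1\<^sub>m (k * n)"
proof -
  note A = nc_eval_carrier[OF P, of n X]
  have "Determinant.det (nc_eval P n X) \<noteq> 0" using stable Xball by (auto simp: nc_stable_def)
  from det_non_zero_imp_unit[OF A this] mat_inverse(1)[OF A]
  obtain B where "mat_inverse (nc_eval P n X) = Some B" by fastforce
  with mat_inverse(2)[OF A this]
  show "mat_inv (nc_eval P n X) \<in> carrier_mat (k * n) (k * n)"
    "nc_eval P n X * mat_inv (nc_eval P n X) = 1\<^sub>m (k * n)"
    "mat_inv (nc_eval P n X) * nc_eval P n X = 1\<^sub>m (k * n)" by auto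
qed

lemma nc_GL_left_inverse:
  assumes "F \<in> nc_GL k"
  obtains F' where "\<And>i m. i < k \<Longrightarrow> m < k \<Longrightarrow> (\<Sum>t<k. F' i t * F $$ (t, m)) = delta i m"
proof -
  obtain G where F: "F \<in> carrier_mat k k" and G: "G \<in> carrier_mat k k" "G * F = 1\<^sub>m k"
    using assms by (auto simp: nc_GL_def Units_def ring_mat_simps)
  have "(\<Sum>t<k. G $$ (i, t) * F $$ (t, m)) = delta i m" if "i < k" "m < k" for i m
  proof -
    have "(G * F) $$ (i, m) = (\<Sum>t<k. G $$ (i, t) * F $$ (t, m))"
      using F G(1) that by (simp add: times_mat_def scalar_prod_def atLeast0LessThan)
    then show ?thesis using G(2) that by simp
  qed
  then show ?thesis by (rule that)
qed

text \<open>The inverse of \<open>P(0)\<close> comes from stability at the origin of \<open>M\<^sub>1\<close>.\<close>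

lemma stable_atom_of_nc_atom:
  fixes P :: "'d::finite nc_poly mat"
  assumes E: "operator_space_basis E Q" and P: "P \<in> carrier_mat k k"
    and stable: "nc_stable Q P" and atom: "nc_atom k P"
  shows "\<exists>Ci. stable_atom Q k (poly_entries P) Ci"
proof -
  interpret bounded_tuple Q
    by standard (use E in \<open>auto simp: operator_space_basis_def\<close>)
  define Z0 where "Z0 = (\<lambda>j :: 'd. mat 1 1 (\<lambda>(a, b). 0 :: complex))"
  have Z0: "Z0 j \<in> carrier_mat 1 1" for j by (simp add: Z0_def)
  have Zball: "(1, Z0) \<in> nc_ball Q"
    using ball_of_contractive[of 1 "\<lambda>j a b. 0" 0] contractive_zero by (simp add: Z0_def)
  define A where "A = nc_eval P 1 Z0"
  have A: "A \<in> carrier_mat k k" using nc_eval_carrier[OF P, of 1 Z0] by (simp add: A_def)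
  note inv = mat_inv_of_stable[OF P stable Zball, folded A_def, simplified]
  have entry: "A $$ (i, l) = coeff0 (P $$ (i, l))" if "i < k" "l < k" for i l
  proof -
    have "A $$ (i, l) = act 1 (entries Z0) (P $$ (i, l)) (\<lambda>c. delta c 0) 0"
      using nc_eval_entry[OF P Z0 that, of 0 0] by (simp add: A_def)
    also have "\<dots> = act 1 (\<lambda>j a b. 0) (P $$ (i, l)) (\<lambda>c. delta c 0) 0"
      by (rule act_cong_tuple) (auto simp: entries_def Z0_def)
    finally show ?thesis by (simp add: act_at_zero)
  qed
  have "stable_atom Q k (poly_entries P) (\<lambda>i l. mat_inv A $$ (i, l))"
  proof unfold_locales
    show "\<exists>M\<ge>0. \<forall>n X j h. contractive Q n X \<longrightarrow> norm2 n (\<lambda>a. \<Sum>b<n. X j a b * h b) \<le> M * norm2 n h"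
      by (rule coordinates_bounded[OF E])
  next
    fix i m assume im: "i < k" "m < k"
    have "(mat_inv A * A) $$ (i, m) = (\<Sum>l<k. mat_inv A $$ (i, l) * A $$ (l, m))"
      using A inv(1) im by (simp add: times_mat_def scalar_prod_def atLeast0LessThan)
    then show "(\<Sum>l<k. mat_inv A $$ (i, l) * coeff0 (P $$ (l, m))) = delta i m"
      using inv(3) im by (simp add: entry)
    have "(A * mat_inv A) $$ (i, m) = (\<Sum>l<k. A $$ (i, l) * mat_inv A $$ (l, m))"
      using A inv(1) im by (simp add: times_mat_def scalar_prod_def atLeast0LessThan)
    then show "(\<Sum>l<k. coeff0 (P $$ (i, l)) * mat_inv A $$ (l, m)) = delta i m"
      using inv(2) im by (simp add: entry)
  next
    fix F G :: "nat \<Rightarrow> nat \<Rightarrow> 'd nc_poly"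
    assume FG: "\<And>i m. i < k \<Longrightarrow> m < k \<Longrightarrow> P $$ (i, m) = mprod k F G i m"
    define F0 where "F0 = mat k k (\<lambda>(i, j). F i j)"
    define G0 where "G0 = mat k k (\<lambda>(i, j). G i j)"
    have "P = F0 * G0"
      using P FG by (intro eq_matI) (auto simp: F0_def G0_def scalar_prod_def atLeast0LessThan)
    moreover have "F0 \<in> carrier_mat k k" "G0 \<in> carrier_mat k k" by (auto simp: F0_def G0_def)
    ultimately have "F0 \<in> nc_GL k \<or> G0 \<in> nc_GL k" using atom unfolding nc_atom_def by blast
    then show "(\<exists>F'. \<forall>i<k. \<forall>m<k. (\<Sum>t<k. F' i t * F t m) = delta i m) \<or>
       (\<exists>G'. \<forall>i<k. \<forall>m<k. (\<Sum>t<k. G' i t * G t m) = delta i m)"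
    proof
      assume "F0 \<in> nc_GL k"
      then obtain F' where F': "\<And>i m. i < k \<Longrightarrow> m < k \<Longrightarrow> (\<Sum>t<k. F' i t * F0 $$ (t, m)) = delta i m"
        by (rule nc_GL_left_inverse) (rule that)
      show ?thesis using F' by (intro disjI1 exI[of _ F']) (simp add: F0_def)
    next
      assume "G0 \<in> nc_GL k"
      then obtain G' where G': "\<And>i m. i < k \<Longrightarrow> m < k \<Longrightarrow> (\<Sum>t<k. G' i t * G0 $$ (t, m)) = delta i m"
        by (rule nc_GL_left_inverse) (rule that)
      show ?thesis using G' by (intro disjI2 exI[of _ G']) (simp add: G0_def)
    qed
  next
    fix n X \<mu> y i a
    assume n: "0 < n" and X: "contractive Q n X" and \<mu>: "cmod \<mu> < 1"
      and zero: "\<And>i a. i < k \<Longrightarrow> a < n \<Longrightarrow> (mat_act k n (\<lambda>j a b. \<mu> * X j a b) (poly_entries P) y i a) = 0"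
      and i: "i < k" and a: "a < n"
    define Y where "Y j = mat n n (\<lambda>(a, b). \<mu> * X j a b)" for j
    have "(n, Y) \<in> nc_ball Q" using ball_of_contractive[OF n X \<mu>] by (simp add: Y_def[abs_def])
    then show "y i a = 0"
    proof (rule nc_stable_injective[OF P stable])
      fix i a assume ia: "i < k" "a < n"
      have "mat_act k n (entries Y) (poly_entries P) y i a = mat_act k n (\<lambda>j a b. \<mu> * X j a b) (poly_entries P) y i a"
        using ia by (intro sum.cong refl act_cong_tuple) (auto simp: entries_def Y_def)
      then show "mat_act k n (entries Y) (poly_entries P) y i a = 0" using zero[OF ia] by simp
    qed (use i a in \<open>auto simp: Y_def\<close>)
  qed
  then show ?thesis by blast
qed

theorem theorem1:
  fixes k :: nat
    and E :: "('h :: complex_hilbert_space \<Rightarrow> 'h) set"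
    and Q :: "'d :: finite \<Rightarrow> 'h \<Rightarrow> 'h"
    and P :: "'d nc_poly mat"
  assumes "operator_space_basis E Q"
    and "P \<in> carrier_mat k k"
    and "nc_stable Q P"
    and "nc_atom k P"
  shows "(SUP r\<in>{0..<1}. nc_supnorm Q (\<lambda>n X. mat_inv (nc_dilate r P n X) * nc_eval P n X)) < \<infinity>
       \<and> (SUP r\<in>{0..<1}. nc_supnorm Q (\<lambda>n X. nc_eval P n X * mat_inv (nc_dilate r P n X))) < \<infinity>"
proof -
  note P = assms(2)
  obtain Ci where "stable_atom Q k (poly_entries P) Ci"
    using stable_atom_of_nc_atom[OF assms] by blast
  then interpret stable_atom Q k "poly_entries P" Ci .
  from dilation_quotients_bounded obtain C where C: "C \<ge> 0"
    and left: "\<And>n X r y z. 0 < n \<Longrightarrow> contractive Q n X \<Longrightarrow> 0 \<le> r \<Longrightarrow> r < 1 \<Longrightarrow>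
      \<forall>i<k. \<forall>a<n. mat_act k n (dilate r X) (poly_entries P) y i a
          = mat_act k n X (poly_entries P) z i a \<Longrightarrow> fam_norm k n y \<le> C * fam_norm k n z"
    and right: "\<And>n X r y. 0 < n \<Longrightarrow> contractive Q n X \<Longrightarrow> 0 \<le> r \<Longrightarrow> r < 1 \<Longrightarrow>
      fam_norm k n (mat_act k n X (poly_entries P) y)
       \<le> C * fam_norm k n (mat_act k n (dilate r X) (poly_entries P) y)"
    by blast
  have bound: "mat_opnorm (mat_inv (nc_dilate r P n X) * nc_eval P n X) \<le> C * real k \<and>
      mat_opnorm (nc_eval P n X * mat_inv (nc_dilate r P n X)) \<le> C * real k"
    if r: "r \<in> {0..<1}" and ball: "(n, X) \<in> nc_ball Q" for r n X
  proof -
    note n = contractive_of_ball(1)[OF ball] and X = contractive_of_ball(2)[OF ball]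
    have contractive: "contractive Q n (entries X)"
      using contractive_of_ball(3)[OF ball] by (simp add: entries_def[abs_def])
    have r01: "0 \<le> r" "r < 1" using r by auto
    define Y where "Y j = complex_of_real r \<cdot>\<^sub>m X j" for j
    have Y: "Y j \<in> carrier_mat n n" for j using X by (simp add: Y_def)
    have entries_Y: "entries Y j a b = complex_of_real r * entries X j a b" if "a < n" "b < n" for j a b
      using X[of j] that by (simp add: Y_def entries_def)
    have "Y = (\<lambda>j. mat n n (\<lambda>(a, b). complex_of_real r * entries X j a b))"
    proof
      fix j
      show "Y j = mat n n (\<lambda>(a, b). complex_of_real r * entries X j a b)"
        using X[of j] by (intro eq_matI) (auto simp: Y_def entries_def)
    qed
    then have Yball: "(n, Y) \<in> nc_ball Q"
      using ball_of_contractive[OF n contractive, of "complex_of_real r"] r01 by simp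
    define A where "A = nc_eval P n X"
    define B where "B = nc_eval P n Y"
    have dil: "nc_dilate r P n X = B" by (simp add: nc_dilate_def B_def Y_def[abs_def])
    note Ac = nc_eval_carrier[OF P, of n X, folded A_def]
    note Bc = nc_eval_carrier[OF P, of n Y, folded B_def]
    note inv = mat_inv_of_stable[OF P assms(3) Yball, folded B_def]
    have Av: "(A *\<^sub>v v) $ (i * n + a) = mat_act k n (entries X) (poly_entries P) (blocks n v) i a"
      if "v \<in> carrier_vec (k * n)" "i < k" "a < n" for v i a
      unfolding A_def by (rule nc_eval_mult_vec[OF P X that])
    have Bv: "(B *\<^sub>v v) $ (i * n + a)
        = mat_act k n (dilate r (entries X)) (poly_entries P) (blocks n v) i a"
      if "v \<in> carrier_vec (k * n)" "i < k" "a < n" for v i a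
      unfolding B_def nc_eval_mult_vec[OF P Y that]
      by (intro sum.cong refl act_cong_tuple) (auto simp: entries_Y that)
    have "mat_opnorm (mat_inv B * A) \<le> C * real k"
    proof (rule mat_opnorm_le)
      show "mat_inv B * A \<in> carrier_mat (k * n) (k * n)" using inv Ac by auto
      fix v :: "complex vec" assume v: "v \<in> carrier_vec (k * n)" "vec_l2norm v \<le> 1"
      define w where "w = (mat_inv B * A) *\<^sub>v v"
      have w: "w \<in> carrier_vec (k * n)" using inv Ac v by (auto simp: w_def)
      have "B *\<^sub>v w = (B * (mat_inv B * A)) *\<^sub>v v"
        unfolding w_def using inv(1) Ac Bc v by (intro assoc_mult_mat_vec[symmetric]) auto
      also have "B * (mat_inv B * A) = (B * mat_inv B) * A"
        using inv(1) Ac Bc by (intro assoc_mult_mat[symmetric]) auto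
      finally have Bw: "B *\<^sub>v w = A *\<^sub>v v" using inv(2) Ac by simp
      have "vec_l2norm w \<le> fam_norm k n (blocks n w)" by (rule vec_l2norm_le_fam_norm[OF w])
      also have "\<dots> \<le> C * fam_norm k n (blocks n v)"
      proof (rule left[OF n contractive r01], intro allI impI)
        fix i a assume ia: "i < k" "a < n"
        show "mat_act k n (dilate r (entries X)) (poly_entries P) (blocks n w) i a
          = mat_act k n (entries X) (poly_entries P) (blocks n v) i a"
          by (simp only: Av[OF v(1) ia, symmetric] Bv[OF w ia, symmetric] Bw)
      qed
      also have "\<dots> \<le> C * (real k * 1)"
        using order_trans[OF fam_norm_le_vec_l2norm[OF v(1)] mult_left_mono[OF v(2), of "real k"]] C
        by (intro mult_left_mono) auto
      finally show "vec_l2norm ((mat_inv B * A) *\<^sub>v v) \<le> C * real k" by (simp add: w_def)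
    qed
    moreover have "mat_opnorm (A * mat_inv B) \<le> C * real k"
    proof (rule mat_opnorm_le)
      show "A * mat_inv B \<in> carrier_mat (k * n) (k * n)" using inv Ac by auto
      fix v :: "complex vec" assume v: "v \<in> carrier_vec (k * n)" "vec_l2norm v \<le> 1"
      define w where "w = mat_inv B *\<^sub>v v"
      have w: "w \<in> carrier_vec (k * n)" using inv v by (auto simp: w_def)
      have Aw: "(A * mat_inv B) *\<^sub>v v = A *\<^sub>v w"
        unfolding w_def using inv(1) Ac v by (intro assoc_mult_mat_vec) auto
      have "B *\<^sub>v w = (B * mat_inv B) *\<^sub>v v"
        unfolding w_def using inv(1) Bc v by (intro assoc_mult_mat_vec[symmetric]) auto
      then have Bw: "B *\<^sub>v w = v" using inv(2) v by simp
      have "vec_l2norm (A *\<^sub>v w) \<le> fam_norm k n (blocks n (A *\<^sub>v w))"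
        by (rule vec_l2norm_le_fam_norm) (use Ac w in auto)
      also have "\<dots> = fam_norm k n (mat_act k n (entries X) (poly_entries P) (blocks n w))"
        by (intro fam_norm_cong Av w)
      also have "\<dots> \<le> C * fam_norm k n (mat_act k n (dilate r (entries X)) (poly_entries P) (blocks n w))"
        by (rule right[OF n contractive r01])
      also have "\<dots> = C * fam_norm k n (blocks n v)"
        by (intro arg_cong[of _ _ "\<lambda>x. C * x"] fam_norm_cong) (simp add: Bv[OF w, symmetric] Bw)
      also have "\<dots> \<le> C * (real k * 1)"
        using order_trans[OF fam_norm_le_vec_l2norm[OF v(1)] mult_left_mono[OF v(2), of "real k"]] C
        by (intro mult_left_mono) auto
      finally show "vec_l2norm ((A * mat_inv B) *\<^sub>v v) \<le> C * real k" by (simp add: Aw)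
    qed
    ultimately show ?thesis unfolding dil A_def[symmetric] by blast
  qed
  have "(SUP r\<in>{0..<1}. nc_supnorm Q (\<lambda>n X. mat_inv (nc_dilate r P n X) * nc_eval P n X)) \<le> ennreal (C * real k)"
    unfolding nc_supnorm_def using bound by (intro SUP_least) (auto intro!: ennreal_leI)
  moreover have "(SUP r\<in>{0..<1}. nc_supnorm Q (\<lambda>n X. nc_eval P n X * mat_inv (nc_dilate r P n X))) \<le> ennreal (C * real k)"
    unfolding nc_supnorm_def using bound by (intro SUP_least) (auto intro!: ennreal_leI)
  moreover have "ennreal (C * real k) < \<infinity>" by simp
  ultimately show ?thesis by (meson order.strict_trans1)
qed

end
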